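(* Let $\rho$ be an $n$-qubit density operator, $O$ a Hermitian observable, and consider the parametrized circuit $$U(\vec{\theta})=\prod_{l=1}^{m} V_l e^{-i\theta_l H_l}=V_1e^{-i\theta_1H_1}V_2e^{-i\theta_2H_2}\cdots V_me^{-i\theta_mH_m},$$ with fixed unitaries $V_l$, Hermitian generators $H_l$ and $m$ independent parameters $\vec\theta=(\theta_1,\dots,\theta_m)\in\mathbb{R}^m$, each generator having its own parameter (i.e. the number of generators $M$ equals $m$). Let $\mathcal{L}(\vec\theta)=\operatorname{Tr}[U(\vec\theta)\rho U^\dagger(\vec\theta)O]=\operatorname{Tr}[\rho\,U^\dagger(\vec\theta)OU(\vec\theta)]$. Fix any point $\vec\phi\in\mathbb{R}^m$ and any subset $\Lambda\subseteq\{1,\dots,m\}$. Define $$c_l(\vec\phi)=\left|\frac{\partial^2\mathcal{L}}{\partial\theta_l^2}(\vec\phi)\right|,\quad \omega^{(\max)}_\mu=\lambda_{\max}(H_\mu)-\lambda_{\min}(H_\mu),$$ $$\omega^{(\mathrm{eff})}_\mu(\vec\phi)=\sqrt{\Big\|\tfrac{\partial^2}{\partial\theta_\mu^2}[U(\vec\theta)^\dagger OU(\vec\theta)]\big|_{\vec\theta=\vec\phi}\Big\|_\infty},\quad \widetilde\omega^{(\mathrm{eff})}_{l,\mu}(\vec\phi)=\sqrt{\Big\|\tfrac{\partial^4}{\partial\theta_\mu^2\partial\theta_l^2}[U(\vec\theta)^\dagger OU(\vec\theta)]\big|_{\vec\theta=\vec\phi}\Big\|_\infty},$$ $$\beta_l=\tfrac{32}{3}(\omega^{(\max)}_l)^6\|O\|_\infty^2\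 \text{ for } l>1,\qquad \beta_1=\tfrac{2}{3}(\omega^{(\max)}_1)^2(\omega^{(\mathrm{eff})}_1(\vec\phi))^4,$$ $$\mathcal{A}_l(\vec\phi)=4(\omega^{(\max)}_l)^2\sum_{\mu=1}^{l-1}(\omega^{(\mathrm{eff})}_\mu(\vec\phi))^2+\sum_{\mu=l+1}^{m}(\widetilde\omega^{(\mathrm{eff})}_{l,\mu}(\vec\phi))^2,$$ and $$r_{\mathrm{patch}}^2:=\min_{l\in\Lambda}\frac{9c_l(\vec\phi)^2}{8c_l(\vec\phi)\mathcal{A}_l(\vec\phi)+24\beta_l}.$$ Then for every $r>0$ with $r^2\le r_{\mathrm{patch}}^2$, $$\operatorname{Var}_{\vec\theta\sim\mathcal{U}(\vec\phi,r)}[\mathcal{L}(\vec\theta)]\ \ge\ \sum_{l\in\Lambda}\frac{r^4}{45}\left(\Big(c_l(\vec\phi)-\tfrac16\mathcal{A}_l(\vec\phi)\,r^2\Big)^2-\beta_l r^2\right),$$ and moreover $$\operatorname{Var}_{\vec\theta\sim\mathcal{U}(\vec\phi,r_{\mathrm{patch}})}[\mathcal{L}(\vec\theta)]\ \ge\ \frac{1}{72}\Big(\sum_{l\in\Lambda}c_l(\vec\phi)^2\Big)r_{\mathrm{patch}}^4.$$ Finally, for a family of such instances indexed by $n$ with $\|O\|_\infty,\|H_k\|_\infty\in\mathcal{O}(\mathrm{poly}(n))$ and $c_q(\vec\phi)\in\Omega(1/\mathrm{poly}(n))$ for some $q\in\Lambda$, choosing $r\in\Theta\big(1/(\mathrm{poly}(n)\sqrt{m})\big)$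 gives $$\operatorname{Var}_{\vec\theta\sim\mathcal{U}(\vec\phi,r)}[\mathcal{L}(\vec\theta)]\in\Omega\Big(\frac{1}{\mathrm{poly}(n)\,m^2}\Big).$$
   Context: $\|\cdot\|_\infty$ is the operator norm. For $\vec\phi\in\mathbb{R}^m$ and $r>0$, $\mathcal{U}(\vec\phi,r)$ is the uniform distribution over the hypercube $\{\vec\theta:\theta_i\in[\phi_i-r,\phi_i+r],\ i=1,\dots,m\}$ (coordinates independent and uniform). Note the ordering convention: generator $H_1$ is the gate adjacent to the observable in the Heisenberg picture $U^\dagger OU$, and $H_m$ is the gate adjacent to the initial state $\rho$. $\lambda_{\max},\lambda_{\min}$ denote largest and smallest eigenvalues. *)

theory Defs
  imports "Jordan_Normal_Form.Matrix" "Jordan_Normal_Form.Char_Poly"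
    "Jordan_Normal_Form.Schur_Decomposition" "HOL-Probability.Probability"
begin

definition mtrace :: "complex mat \<Rightarrow> complex" where
  "mtrace A = (\<Sum>i<dim_row A. A $$ (i,i))"

definition hermitian_mat :: "nat \<Rightarrow> complex mat \<Rightarrow> bool" where
  "hermitian_mat d A \<longleftrightarrow> A \<in> carrier_mat d d \<and> mat_adjoint A = A"

definition unitary_mat :: "nat \<Rightarrow> complex mat \<Rightarrow> bool" where
  "unitary_mat d A \<longleftrightarrow> A \<in> carrier_mat d d \<and> A * mat_adjoint A = 1\<^sub>m d
      \<and> mat_adjoint A * A = 1\<^sub>m d"

definition cinner :: "complex Matrix.vec \<Rightarrow> complex Matrix.vec \<Rightarrow> complex" where
  "cinner v w = (\<Sum>i<dim_vec v. cnj (vec_index v i) * vec_index w i)"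

definition density_op :: "nat \<Rightarrow> complex mat \<Rightarrow> bool" where
  "density_op d \<rho> \<longleftrightarrow> hermitian_mat d \<rho>
     \<and> (\<forall>v \<in> carrier_vec d. 0 \<le> Re (cinner v (\<rho> *\<^sub>v v)))
     \<and> mtrace \<rho> = 1"

definition vnorm :: "complex Matrix.vec \<Rightarrow> real" where
  "vnorm v = sqrt (\<Sum>i<dim_vec v. (cmod (vec_index v i))^2)"

definition opnorm :: "complex mat \<Rightarrow> real" where
  "opnorm A = Sup {vnorm (A *\<^sub>v v) | v. v \<in> carrier_vec (dim_col A) \<and> vnorm v \<le> 1}"

(* largest / smallest eigenvalue (eigenvalues of a Hermitian matrix are real) *)
definition lambda_max :: "complex mat \<Rightarrow> real" where
  "lambda_max A = Max {Re k | k. eigenvalue A k}"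

definition lambda_min :: "complex mat \<Rightarrow> real" where
  "lambda_min A = Min {Re k | k. eigenvalue A k}"

definition mexp :: "complex mat \<Rightarrow> complex mat" where
  "mexp A = Matrix.mat (dim_row A) (dim_col A) (\<lambda>(i,j). \<Sum>k. (A ^\<^sub>m k) $$ (i,j) / of_nat (fact k))"

definition circU :: "nat \<Rightarrow> nat \<Rightarrow> (nat \<Rightarrow> complex mat) \<Rightarrow> (nat \<Rightarrow> complex mat)
    \<Rightarrow> (nat \<Rightarrow> real) \<Rightarrow> complex mat" where
  "circU d m V H \<theta> = foldr (\<lambda>l A. V l * mexp ((- \<i> * complex_of_real (\<theta> l)) \<cdot>\<^sub>m H l) * A)
      [1..<Suc m] (1\<^sub>m d)"

definition heis :: "nat \<Rightarrow> nat \<Rightarrow> (nat \<Rightarrow> complex mat) \<Rightarrow> (nat \<Rightarrow> complex mat)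
    \<Rightarrow> complex mat \<Rightarrow> (nat \<Rightarrow> real) \<Rightarrow> complex mat" where
  "heis d m V H Obs \<theta> = mat_adjoint (circU d m V H \<theta>) * Obs * circU d m V H \<theta>"

(* L(theta) = Tr[U rho U^dagger Obs] (real since rho, Obs Hermitian) *)
definition lossL :: "nat \<Rightarrow> nat \<Rightarrow> (nat \<Rightarrow> complex mat) \<Rightarrow> (nat \<Rightarrow> complex mat)
    \<Rightarrow> complex mat \<Rightarrow> complex mat \<Rightarrow> (nat \<Rightarrow> real) \<Rightarrow> real" where
  "lossL d m V H \<rho> Obs \<theta> =
     Re (mtrace (circU d m V H \<theta> * \<rho> * mat_adjoint (circU d m V H \<theta>) * Obs))"

definition d2 :: "(real \<Rightarrow> 'a::real_normed_vector) \<Rightarrow> real \<Rightarrow> 'a" where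
  "d2 g t = vector_derivative (\<lambda>s. vector_derivative g (at s)) (at t)"

definition mat_d2 :: "nat \<Rightarrow> (real \<Rightarrow> complex mat) \<Rightarrow> real \<Rightarrow> complex mat" where
  "mat_d2 d F t = Matrix.mat d d (\<lambda>(i,j). d2 (\<lambda>s. F s $$ (i,j)) t)"

definition c_coef :: "nat \<Rightarrow> nat \<Rightarrow> (nat \<Rightarrow> complex mat) \<Rightarrow> (nat \<Rightarrow> complex mat)
    \<Rightarrow> complex mat \<Rightarrow> complex mat \<Rightarrow> (nat \<Rightarrow> real) \<Rightarrow> nat \<Rightarrow> real" where
  "c_coef d m V H \<rho> Obs \<phi> l = \<bar>d2 (\<lambda>t. lossL d m V H \<rho> Obs (\<phi>(l := t))) (\<phi> l)\<bar>"

definition omega_max :: "complex mat \<Rightarrow> real" where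
  "omega_max A = lambda_max A - lambda_min A"

definition omega_eff :: "nat \<Rightarrow> nat \<Rightarrow> (nat \<Rightarrow> complex mat) \<Rightarrow> (nat \<Rightarrow> complex mat)
    \<Rightarrow> complex mat \<Rightarrow> (nat \<Rightarrow> real) \<Rightarrow> nat \<Rightarrow> real" where
  "omega_eff d m V H Obs \<phi> \<mu> =
     sqrt (opnorm (mat_d2 d (\<lambda>t. heis d m V H Obs (\<phi>(\<mu> := t))) (\<phi> \<mu>)))"

definition omega_tilde :: "nat \<Rightarrow> nat \<Rightarrow> (nat \<Rightarrow> complex mat) \<Rightarrow> (nat \<Rightarrow> complex mat)
    \<Rightarrow> complex mat \<Rightarrow> (nat \<Rightarrow> real) \<Rightarrow> nat \<Rightarrow> nat \<Rightarrow> real" where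
  "omega_tilde d m V H Obs \<phi> l \<mu> =
     sqrt (opnorm (mat_d2 d (\<lambda>a. mat_d2 d (\<lambda>b. heis d m V H Obs (\<phi>(\<mu> := a, l := b))) (\<phi> l))
                    (\<phi> \<mu>)))"

definition beta_coef :: "nat \<Rightarrow> nat \<Rightarrow> (nat \<Rightarrow> complex mat) \<Rightarrow> (nat \<Rightarrow> complex mat)
    \<Rightarrow> complex mat \<Rightarrow> (nat \<Rightarrow> real) \<Rightarrow> nat \<Rightarrow> real" where
  "beta_coef d m V H Obs \<phi> l =
     (if l = 1 then 2/3 * (omega_max (H 1))^2 * (omega_eff d m V H Obs \<phi> 1)^4
      else 32/3 * (omega_max (H l))^6 * (opnorm Obs)^2)"

definition A_coef :: "nat \<Rightarrow> nat \<Rightarrow> (nat \<Rightarrow> complex mat) \<Rightarrow> (nat \<Rightarrow> complex mat)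
    \<Rightarrow> complex mat \<Rightarrow> (nat \<Rightarrow> real) \<Rightarrow> nat \<Rightarrow> real" where
  "A_coef d m V H Obs \<phi> l =
     4 * (omega_max (H l))^2 * (\<Sum>\<mu>\<in>{1..<l}. (omega_eff d m V H Obs \<phi> \<mu>)^2)
     + (\<Sum>\<mu>\<in>{l<..m}. (omega_tilde d m V H Obs \<phi> l \<mu>)^2)"

definition rpatch2 :: "nat \<Rightarrow> nat \<Rightarrow> (nat \<Rightarrow> complex mat) \<Rightarrow> (nat \<Rightarrow> complex mat)
    \<Rightarrow> complex mat \<Rightarrow> complex mat \<Rightarrow> (nat \<Rightarrow> real) \<Rightarrow> nat set \<Rightarrow> real" where
  "rpatch2 d m V H \<rho> Obs \<phi> \<Lambda> =
     Min ((\<lambda>l. 9 * (c_coef d m V H \<rho> Obs \<phi> l)^2 /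
               (8 * c_coef d m V H \<rho> Obs \<phi> l * A_coef d m V H Obs \<phi> l
                + 24 * beta_coef d m V H Obs \<phi> l)) ` \<Lambda>)"

definition unif_cube :: "nat \<Rightarrow> (nat \<Rightarrow> real) \<Rightarrow> real \<Rightarrow> (nat \<Rightarrow> real) measure" where
  "unif_cube m \<phi> r = PiM {1..m} (\<lambda>i. uniform_measure lborel {\<phi> i - r .. \<phi> i + r})"

definition variance_under :: "'a measure \<Rightarrow> ('a \<Rightarrow> real) \<Rightarrow> real" where
  "variance_under M f = (\<integral>x. (f x - (\<integral>y. f y \<partial>M))^2 \<partial>M)"

definition qinstance :: "nat \<Rightarrow> nat \<Rightarrow> complex mat \<Rightarrow> complex mat \<Rightarrow> (nat \<Rightarrow> complex mat)
    \<Rightarrow> (nat \<Rightarrow> complex mat) \<Rightarrow> bool" where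
  "qinstance n m \<rho> Obs V H \<longleftrightarrow> density_op (2^n) \<rho> \<and> hermitian_mat (2^n) Obs
     \<and> (\<forall>l\<in>{1..m}. unitary_mat (2^n) (V l) \<and> hermitian_mat (2^n) (H l))"

end

theory Submission
  imports Defs
begin

text \<open>
  The polynomials \<open>p\<^sub>l = (\<theta>\<^sub>l - \<phi>\<^sub>l)\<^sup>2 - r\<^sup>2 / 3\<close> are centred and mutually orthogonal under the uniform
  distribution on the cube, so by Bessel's inequality the variance of the loss is at least the sum of
  \<open>(E[L p\<^sub>l])\<^sup>2 / E[p\<^sub>l\<^sup>2]\<close>. A Taylor expansion in \<open>\<theta>\<^sub>l\<close> identifies \<open>E[L p\<^sub>l]\<close>, up to a fourth order term
  that is absorbed into \<open>\<beta>\<^sub>l\<close>, with \<open>2 r\<^sup>4 / 45\<close> times the mean over the remaining parameters of the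
  second derivative of the loss in direction \<open>l\<close>.

  To compare this mean with the value at \<open>\<phi>\<close>, the parameters are averaged one after the other, from the
  gate next to the observable outwards. Averaging over \<open>\<theta>\<^sub>\<mu>\<close> costs \<open>r\<^sup>2 / 6\<close> times the norm of a second
  derivative in direction \<open>\<mu>\<close>; as the gates from \<open>\<mu>\<close> on act on that derivative by unitary conjugation,
  its norm depends only on the parameters before \<open>\<mu>\<close>, which have already been set to \<open>\<phi>\<close>. This is why
  the coefficients evaluated at \<open>\<phi>\<close> suffice. Norms of commutators with a generator \<open>H\<close> are controlled by
  \<open>\<parallel>[H, X]\<parallel> \<le> \<omega> \<parallel>X\<parallel>\<close> with \<open>\<omega>\<close> the width of the spectrum, obtained by shifting the spectrum of \<open>H\<close> to be symmetric about 0.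
\<close>

subsection \<open>Uniform distributions and Taylor expansion\<close>

text \<open>\<open>c_coef\<close> controls nothing but a second derivative at one point, so the test
  functions must see curvature and be blind to slope. On an interval of half-width \<open>r\<close>
  about \<open>a\<close>, \<open>(t - a)^2 - r^2/3\<close> is orthogonal to constants and to odd
  powers of \<open>t - a\<close>, has mean square \<open>4 r^4/45\<close> and pairs with
  \<open>(t - a)^2/2\<close> to \<open>2 r^4/45\<close>; the prefactor \<open>r^4/45\<close> is the
  square of the latter over the former. The fourth order remainder enters the square through a cross
  term: a bound on a second derivative times one on a fourth, both uniform over all parameters. The
  general uniform bounds \<open>\<omega>^2 \<parallel>O\<parallel>\<close> and
  \<open>\<omega>^4 \<parallel>O\<parallel>\<close> account for the sixth power in
  \<open>\<beta>\<^sub>l\<close>. Nothing parametrised lies between layer 1 and the observable, so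
  there the norm of the second derivative is the same at all points and its value at
  \<open>\<phi>\<close> may be used, whence the separate \<open>\<beta>\<^sub>1\<close>. Matrices
  enter only through norm bounds: the averaging is carried out for an abstract family of bounded
  partial derivatives indexed by multi-indices.\<close>

definition unif :: "real \<Rightarrow> real \<Rightarrow> real measure" where
  "unif a r = uniform_measure lborel {a - r..a + r}"

lemma sets_unif [simp, measurable_cong]: "sets (unif a r) = sets borel"
  and space_unif [simp]: "space (unif a r) = UNIV"
  by (simp_all add: unif_def)

lemma prob_space_unif: "0 < r \<Longrightarrow> prob_space (unif a r)"
  unfolding unif_def by (intro prob_space_uniform_measure) (auto simp: ennreal_eq_0_iff)

lemma AE_unif: "0 < r \<Longrightarrow> AE t in unif a r. \<bar>t - a\<bar> \<le> r"
  unfolding unif_def by (intro AE_uniform_measureI) (auto intro!: AE_I2)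

text \<open>The normalisation in \<open>uniform_measure\<close> is an \<open>ennreal\<close>
  quotient; rewriting it once as the real density \<open>1 / (2 * r)\<close> on the interval reduces
  expectations to ordinary integrals.\<close>

lemma has_bochner_integral_unif:
  fixes f :: "real \<Rightarrow> real"
  assumes r: "0 < r" and f: "f \<in> borel_measurable borel"
    and I: "has_bochner_integral lborel (\<lambda>x. f x * indicator {a - r..a + r} x) I"
  shows "has_bochner_integral (unif a r) f (I / (2 * r))"
proof -
  have eq: "unif a r = density lborel (\<lambda>x. ennreal (indicator {a - r..a + r} x / (2 * r)))"
    unfolding unif_def uniform_measure_def
    using r by (intro arg_cong[where f = "density lborel"] ext)
      (auto simp: indicator_def divide_ennreal ennreal_divide_numeral simp flip: ennreal_1)
  have "has_bochner_integral lborel (\<lambda>x. (1 / (2 * r)) * (f x * indicator {a - r..a + r} x)) ((1 / (2 * r)) * I)"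
    using I by (rule has_bochner_integral_mult_right)
  then have "has_bochner_integral lborel (\<lambda>x. (indicator {a - r..a + r} x / (2 * r)) *\<^sub>R f x) (I / (2 * r))"
    by (simp add: mult_ac)
  then show ?thesis
    unfolding eq using r f by (intro has_bochner_integral_density) auto
qed

text \<open>Comes from the antiderivative \<open>(x - a) ^ Suc k / real (Suc k)\<close>. The
  difference of powers stays unsimplified because it covers both parities: it vanishes for odd
  \<open>k\<close> and is \<open>2 * r ^ Suc k\<close> for even \<open>k\<close>.\<close>

lemma moment_unif:
  assumes r: "0 < r"
  shows "has_bochner_integral (unif a r) (\<lambda>t. (t - a) ^ k)
    ((r ^ Suc k - (- r) ^ Suc k) / (real (Suc k)) / (2 * r))"
proof -
  have d: "((\<lambda>x. (x - a) ^ Suc k / real (Suc k)) has_real_derivative (x - a) ^ k) (at x)" for x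
  proof -
    have "((\<lambda>x. x - a) has_real_derivative 1) (at x)" by (auto intro!: derivative_eq_intros)
    from DERIV_cdivide[OF DERIV_power[OF this, of "Suc k"], of "real (Suc k)"]
    show ?thesis by (simp del: power_Suc of_nat_Suc)
  qed
  have "has_bochner_integral lborel (\<lambda>x. (x - a) ^ k * indicator {a - r..a + r} x)
     ((a + r - a) ^ Suc k / real (Suc k) - (a - r - a) ^ Suc k / real (Suc k))"
    using r by (intro has_bochner_integral_FTC_Icc_real[where F = "\<lambda>x. (x - a) ^ Suc k / real (Suc k)"] d)
     (auto intro!: continuous_intros)
  then show ?thesis
    by (intro has_bochner_integral_unif r) (auto simp: diff_divide_distrib add_divide_distrib)
qed

lemma moment_unif_even: "0 < r \<Longrightarrow> (\<integral>t. (t - a)^2 \<partial>unif a r) = r^2 / 3"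
    "0 < r \<Longrightarrow> (\<integral>t. (t - a)^4 \<partial>unif a r) = r^4 / 5"
  and moment_unif_odd: "0 < r \<Longrightarrow> (\<integral>t. (t - a) \<partial>unif a r) = 0"
    "0 < r \<Longrightarrow> (\<integral>t. (t - a)^3 \<partial>unif a r) = 0"
    "0 < r \<Longrightarrow> (\<integral>t. (t - a)^5 \<partial>unif a r) = 0"
  using moment_unif[of r a 1, THEN has_bochner_integral_integral_eq]
    moment_unif[of r a 2, THEN has_bochner_integral_integral_eq]
    moment_unif[of r a 3, THEN has_bochner_integral_integral_eq]
    moment_unif[of r a 4, THEN has_bochner_integral_integral_eq]
    moment_unif[of r a 5, THEN has_bochner_integral_integral_eq]
  by (auto simp: field_simps power2_eq_square power3_eq_cube power4_eq_xxxx eval_nat_numeral)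

lemma integrable_moment_unif: "0 < r \<Longrightarrow> integrable (unif a r) (\<lambda>t. (t - a) ^ k)"
  using moment_unif by (auto simp: has_bochner_integral_iff)

lemma taylor_bound:
  fixes D :: "nat \<Rightarrow> real \<Rightarrow> real"
  assumes der: "\<And>k x. k < n \<Longrightarrow> (D k has_real_derivative D (Suc k) x) (at x)"
    and B: "\<And>x. \<bar>D n x\<bar> \<le> B" and n: "0 < n"
  shows "\<bar>D 0 x - (\<Sum>k<n. D k a / fact k * (x - a) ^ k)\<bar> \<le> B / fact n * \<bar>x - a\<bar> ^ n"
\<comment> \<open>The Lagrange form of the remainder presupposes \<open>x\<close> different from
  \<open>a\<close>; at \<open>x = a\<close> only the term of order 0 survives.\<close>
proof (cases "x = a")
  case True
  then have "(\<Sum>k<n. D k a / fact k * (x - a) ^ k) = D 0 a"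
    using n by (subst sum.remove[of _ 0]) auto
  then show ?thesis using True n by (simp add: zero_power)
next
  case False
  obtain t where t: "D 0 x = (\<Sum>k<n. D k a / fact k * (x - a) ^ k) + D n t / fact n * (x - a) ^ n"
    using Taylor[of n D "D 0" "min a x" "max a x" a x] der n False by fastforce
  have "\<bar>D n t / fact n * (x - a) ^ n\<bar> \<le> B / fact n * \<bar>x - a\<bar> ^ n"
    by (auto simp: abs_mult power_abs intro!: mult_right_mono divide_right_mono B)
  then show ?thesis by (simp add: t)
qed

text \<open>The linear Taylor term has mean zero, so only the remainder, at most
  \<open>B / 2 * (t - a)^2\<close>, is left, and the second moment \<open>r^2 / 3\<close> turns it
  into \<open>B * r^2 / 6\<close>.\<close>

lemma unif_mean_approx:
  fixes D :: "nat \<Rightarrow> real \<Rightarrow> real"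
  assumes r: "0 < r" and der: "\<And>k x. k < 2 \<Longrightarrow> (D k has_real_derivative D (Suc k) x) (at x)"
    and B: "\<And>x. \<bar>D 2 x\<bar> \<le> B" and int: "integrable (unif a r) (D 0)"
  shows "\<bar>(\<integral>t. D 0 t \<partial>unif a r) - D 0 a\<bar> \<le> B * r^2 / 6"
proof -
  interpret U: prob_space "unif a r" by (rule prob_space_unif[OF r])
  note i = integrable_moment_unif[OF r, of a]
  have i1: "integrable (unif a r) (\<lambda>t. t - a)" using i[of 1] by simp
  have e: "(\<integral>t. D 0 t - (D 0 a + D 1 a * (t - a)) \<partial>unif a r) = (\<integral>t. D 0 t \<partial>unif a r) - D 0 a"
    using int i1 by (simp add: moment_unif_odd[OF r] U.prob_space[simplified])
  have "\<bar>\<integral>t. D 0 t - (D 0 a + D 1 a * (t - a)) \<partial>unif a r\<bar>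
      \<le> (\<integral>t. \<bar>D 0 t - (D 0 a + D 1 a * (t - a))\<bar> \<partial>unif a r)"
    by (rule integral_abs_bound)
  also have "\<dots> \<le> (\<integral>t. B / 2 * (t - a)^2 \<partial>unif a r)"
  proof (intro integral_mono)
    fix t
    show "\<bar>D 0 t - (D 0 a + D 1 a * (t - a))\<bar> \<le> B / 2 * (t - a)\<^sup>2"
      using taylor_bound[of 2 D B t a] der B by (simp add: eval_nat_numeral)
  qed (use int i1 i[of 2] in \<open>auto\<close>)
  also have "\<dots> = B * r^2 / 6"
    by (simp add: moment_unif_even[OF r])
  finally show ?thesis unfolding e .
qed

text \<open>The weight kills constants and odd powers. Against \<open>D 2 a / 2 * (t - a)^2\<close>
  it gives \<open>D 2 a\<close> times half of \<open>r^4/5 - r^4/9\<close>, hence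
  \<open>2 * r^4 / 45\<close>. The remainder costs \<open>B / 24\<close> times the bound
  \<open>2 * r^2 / 3\<close> of the weight times the fourth moment \<open>r^4 / 5\<close>.\<close>

lemma unif_curvature_approx:
  fixes D :: "nat \<Rightarrow> real \<Rightarrow> real"
  assumes r: "0 < r" and der: "\<And>k x. k < 4 \<Longrightarrow> (D k has_real_derivative D (Suc k) x) (at x)"
    and B: "\<And>x. \<bar>D 4 x\<bar> \<le> B"
    and int: "integrable (unif a r) (\<lambda>t. D 0 t * ((t - a)^2 - r^2 / 3))"
  shows "\<bar>(\<integral>t. D 0 t * ((t - a)^2 - r^2 / 3) \<partial>unif a r) - 2 * r^4 / 45 * D 2 a\<bar> \<le> B * r^6 / 180"
proof -
  interpret U: prob_space "unif a r" by (rule prob_space_unif[OF r])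
  note i = integrable_moment_unif[OF r, of a]
  have i1: "integrable (unif a r) (\<lambda>t. t - a)" using i[of 1] by simp
  define R where "R t = D 0 t - (D 0 a + D 1 a * (t - a) + D 2 a / 2 * (t - a)^2 + D 3 a / 6 * (t - a)^3)" for t
  \<comment> \<open>The cubic Taylor polynomial times the weight, sorted by powers so that the
    moments can be inserted.\<close>
  define P where "P t = (- (D 0 a * r^2 / 3)) + (- (D 1 a * r^2 / 3)) * (t - a)
     + (D 0 a - D 2 a * r^2 / 6) * (t - a)^2 + (D 1 a - D 3 a * r^2 / 18) * (t - a)^3
     + (D 2 a / 2) * (t - a)^4 + (D 3 a / 6) * (t - a)^5" for t
  have P: "(D 0 a + D 1 a * (t - a) + D 2 a / 2 * (t - a)^2 + D 3 a / 6 * (t - a)^3) * ((t - a)^2 - r^2 / 3) = P t" for t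
    unfolding P_def by (simp add: field_simps eval_nat_numeral)
  have iP: "integrable (unif a r) P"
    unfolding P_def using i1 i[of 2] i[of 3] i[of 4] i[of 5] by auto
  have IP: "(\<integral>t. P t \<partial>unif a r) = 2 * r^4 / 45 * D 2 a"
    unfolding P_def using i1 i[of 2] i[of 3] i[of 4] i[of 5]
    by (simp add: moment_unif_odd[OF r] moment_unif_even[OF r] U.prob_space[simplified])
      (simp add: field_simps eval_nat_numeral)
  have RP: "R t * ((t - a)^2 - r^2 / 3) = D 0 t * ((t - a)^2 - r^2 / 3) - P t" for t
    unfolding R_def P[symmetric] by (simp add: algebra_simps)
  have e: "(\<integral>t. R t * ((t - a)^2 - r^2 / 3) \<partial>unif a r)
      = (\<integral>t. D 0 t * ((t - a)^2 - r^2 / 3) \<partial>unif a r) - 2 * r^4 / 45 * D 2 a"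
    unfolding RP using int iP by (simp add: IP)
  have "\<bar>\<integral>t. R t * ((t - a)^2 - r^2 / 3) \<partial>unif a r\<bar> \<le> (\<integral>t. \<bar>R t * ((t - a)^2 - r^2 / 3)\<bar> \<partial>unif a r)"
    by (rule integral_abs_bound)
  also have "\<dots> \<le> (\<integral>t. B / 24 * (2 * r^2 / 3) * (t - a)^4 \<partial>unif a r)"
  proof (intro integral_mono_AE)
    \<comment> \<open>The weight is bounded by \<open>2 * r^2 / 3\<close> only inside the interval,
      hence the comparison almost everywhere.\<close>
    show "AE t in unif a r. \<bar>R t * ((t - a)\<^sup>2 - r\<^sup>2 / 3)\<bar> \<le> B / 24 * (2 * r\<^sup>2 / 3) * (t - a) ^ 4"
      using AE_unif[OF r]
    proof eventually_elim
      case (elim t)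
      have "\<bar>R t\<bar> \<le> B / 24 * (t - a)^4"
      proof -
        have "(\<Sum>k<4. D k a / fact k * (t - a) ^ k)
            = D 0 a + D 1 a * (t - a) + D 2 a / 2 * (t - a)^2 + D 3 a / 6 * (t - a)^3"
          by (simp add: numeral_2_eq_2 numeral_3_eq_3 eval_nat_numeral(2,3))
        moreover have "\<bar>t - a\<bar> ^ 4 = (t - a) ^ 4" by (rule power_even_abs) simp
        moreover have "fact 4 = (24::real)" by (simp add: eval_nat_numeral)
        ultimately show ?thesis
          using taylor_bound[of 4 D B t a] der B unfolding R_def by simp
      qed
      moreover have "(t - a)^2 \<le> r^2" using elim r by (simp add: abs_le_square_iff[symmetric])
      then have "\<bar>(t - a)\<^sup>2 - r\<^sup>2 / 3\<bar> \<le> 2 * r\<^sup>2 / 3"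
        using zero_le_power2[of "t - a"] zero_le_power2[of r] by linarith
      ultimately have "\<bar>R t\<bar> * \<bar>(t - a)\<^sup>2 - r\<^sup>2 / 3\<bar> \<le> (B / 24 * (t - a)^4) * (2 * r\<^sup>2 / 3)"
        by (intro mult_mono) auto
      then show ?case by (simp add: abs_mult mult_ac)
    qed
  qed (use int iP i[of 4] in \<open>auto simp: RP\<close>)
  also have "\<dots> = B * r^6 / 180"
    by (simp add: moment_unif_even[OF r])
  finally show ?thesis unfolding e .
qed

section \<open>Bessel's inequality and integration over product measures\<close>

lemma bessel_variance:
  fixes f :: "'a \<Rightarrow> real" and p :: "'i \<Rightarrow> 'a \<Rightarrow> real"
  assumes M: "prob_space M" and fin: "finite L" and s: "0 < s"
    and f: "integrable M f" "integrable M (\<lambda>x. f x * f x)"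
    and p: "\<And>l. l \<in> L \<Longrightarrow> integrable M (p l)"
    and fp: "\<And>l. l \<in> L \<Longrightarrow> integrable M (\<lambda>x. f x * p l x)"
    and pp: "\<And>l k. l \<in> L \<Longrightarrow> k \<in> L \<Longrightarrow> integrable M (\<lambda>x. p l x * p k x)"
    and p0: "\<And>l. l \<in> L \<Longrightarrow> (\<integral>x. p l x \<partial>M) = 0"
    and orth: "\<And>l k. l \<in> L \<Longrightarrow> k \<in> L \<Longrightarrow> (\<integral>x. p l x * p k x \<partial>M) = (if l = k then s else 0)"
  shows "(\<Sum>l\<in>L. (\<integral>x. f x * p l x \<partial>M)^2 / s) \<le> variance_under M f"
proof -
  interpret prob_space M by fact
  define b where "b l = (\<integral>x. f x * p l x \<partial>M)" for l
  define \<mu> where "\<mu> = (\<integral>x. f x \<partial>M)"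
  define g where "g x = f x - \<mu>" for x
  \<comment> \<open>The orthogonal projection of the centred function \<open>g\<close> onto the span
    of the \<open>p l\<close>; each \<open>p l\<close> has squared norm \<open>s\<close>, whence the
    coefficients \<open>b l / s\<close>.\<close>
  define h where "h x = (\<Sum>l\<in>L. b l / s * p l x)" for x
  have ig: "integrable M g" unfolding g_def using f by auto
  have gg: "integrable M (\<lambda>x. g x * g x)"
    unfolding g_def using f by (auto simp: algebra_simps)
  have gp: "integrable M (\<lambda>x. g x * p l x)" if "l \<in> L" for l
    unfolding g_def using fp[OF that] p[OF that] by (auto simp: algebra_simps)
  \<comment> \<open>Since \<open>p l\<close> has mean zero, centring \<open>f\<close> does not
    change its coefficient.\<close>
  have Igp: "(\<integral>x. g x * p l x \<partial>M) = b l" if "l \<in> L" for l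
    unfolding g_def b_def using fp[OF that] p[OF that] p0[OF that] by (simp add: algebra_simps)
  have gh_eq: "g x * h x = (\<Sum>l\<in>L. b l / s * (g x * p l x))" for x
    unfolding h_def by (simp add: sum_distrib_left mult_ac)
  have gh: "integrable M (\<lambda>x. g x * h x)" unfolding gh_eq using gp by auto
  have Igh: "(\<integral>x. g x * h x \<partial>M) = (\<Sum>l\<in>L. (b l)^2 / s)"
    unfolding gh_eq using gp by (simp add: Igp power2_eq_square)
  have hh_eq: "h x * h x = (\<Sum>l\<in>L. \<Sum>k\<in>L. b l / s * (b k / s) * (p l x * p k x))" for x
    unfolding h_def by (simp add: sum_product mult_ac)
  have hh: "integrable M (\<lambda>x. h x * h x)" unfolding hh_eq using pp by auto
  have "(\<integral>x. h x * h x \<partial>M) = (\<Sum>l\<in>L. \<Sum>k\<in>L. b l / s * (b k / s) * (if l = k then s else 0))"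
    unfolding hh_eq using pp by (simp add: orth)
  also have "\<dots> = (\<Sum>l\<in>L. (b l)^2 / s)"
    using fin s by (intro sum.cong) (auto simp: if_distrib[where f="\<lambda>z. _ * z"] power2_eq_square cong: if_cong)
  finally have Ihh: "(\<integral>x. h x * h x \<partial>M) = (\<Sum>l\<in>L. (b l)^2 / s)" .
  \<comment> \<open>The squared distance from \<open>g\<close> to its projection. On expansion the
    cross term contributes minus two copies of the sum of squares and the square of \<open>h\<close>
    gives one back.\<close>
  have "0 \<le> (\<integral>x. (g x - h x)^2 \<partial>M)" by simp
  also have "\<dots> = (\<integral>x. g x * g x - 2 * (g x * h x) + h x * h x \<partial>M)"
    by (simp add: power2_eq_square algebra_simps)
  also have "\<dots> = (\<integral>x. g x * g x \<partial>M) - (\<Sum>l\<in>L. (b l)^2 / s)"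
    using gg gh hh by (simp add: Igh Ihh)
  finally show ?thesis
    unfolding variance_under_def b_def g_def \<mu>_def by (simp add: power2_eq_square)
qed

lemma (in prob_space) integral_diff_le:
  fixes f g :: "'a \<Rightarrow> real"
  assumes f: "integrable M f" and g: "integrable M g"
    and B: "\<And>x. x \<in> space M \<Longrightarrow> \<bar>f x - g x\<bar> \<le> B"
  shows "\<bar>(\<integral>x. f x \<partial>M) - (\<integral>x. g x \<partial>M)\<bar> \<le> B"
proof -
  have "\<bar>\<integral>x. f x - g x \<partial>M\<bar> \<le> (\<integral>x. \<bar>f x - g x\<bar> \<partial>M)" by (rule integral_abs_bound)
  also have "\<dots> \<le> (\<integral>x. B \<partial>M)" using f g B by (intro integral_mono) auto
  finally show ?thesis using f g by (simp add: prob_space)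
qed

text \<open>Fubini with the outer integral kept on the full product space: the inner integral does
  not depend on coordinate \<open>i\<close>, so averaging over that coordinate once more changes
  nothing. All intermediate functions thus live on one space, and coordinates can be replaced one
  after the other.\<close>

lemma integral_PiM_resample:
  fixes f :: "('i \<Rightarrow> 'b) \<Rightarrow> real"
  assumes M: "\<And>i. prob_space (M i)" and I: "finite I" "i \<in> I"
    and f: "integrable (PiM I M) f"
  shows "(\<integral>x. f x \<partial>PiM I M) = (\<integral>x. (\<integral>t. f (x(i := t)) \<partial>M i) \<partial>PiM I M)"
proof -
  interpret product_prob_space M I
    using M by (auto simp: product_prob_space_def product_sigma_finite_def product_prob_space_axioms_def
        intro: prob_space_imp_sigma_finite)
  define J where "J = I - {i}"
  have J: "I = insert i J" "i \<notin> J" "finite J" "J \<subseteq> I" using I by (auto simp: J_def)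
  have fm [measurable]: "f \<in> borel_measurable (PiM (insert i J) M)" using f J by auto
  interpret Mi: prob_space "M i" by (rule M)
  have [measurable]: "(\<lambda>x. \<integral>t. f (x(i := t)) \<partial>M i) \<in> borel_measurable (PiM J M)"
    by measurable
  have "(\<integral>x. f x \<partial>PiM I M) = (\<integral>x. (\<integral>t. f (x(i := t)) \<partial>M i) \<partial>PiM J M)"
    using product_integral_insert[of J i f] J f by simp
  also have "\<dots> = (\<integral>x. (\<integral>t. f ((restrict x J)(i := t)) \<partial>M i) \<partial>PiM I M)"
    by (subst distr_restrict[OF J(4) I(1)], subst integral_distr) (auto intro!: measurable_restrict_subset J(4))
  also have "\<dots> = (\<integral>x. (\<integral>t. f (x(i := t)) \<partial>M i) \<partial>PiM I M)"
  proof (intro Bochner_Integration.integral_cong refl)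
    fix x t assume "x \<in> space (PiM I M)"
    \<comment> \<open>Points of the product space are extensional, so the restriction to
      \<open>J\<close> loses only coordinate \<open>i\<close>, which is overwritten anyway.\<close>
    then have "(restrict x J)(i := t) = x(i := t)"
      using J by (auto simp: space_PiM PiE_def extensional_def restrict_def)
    then show "f ((restrict x J)(i := t)) = f (x(i := t))" by simp
  qed
  finally show ?thesis .
qed

subsection \<open>Families of partial derivatives\<close>

text \<open>
  \<open>F e \<theta>\<close> plays the role of the mixed partial derivative of \<open>F (\<lambda>_. 0)\<close> of order
  \<open>e l\<close> in the coordinate \<open>l\<close>.
\<close>

locale derivative_family =
  fixes m :: nat and F :: "(nat \<Rightarrow> nat) \<Rightarrow> (nat \<Rightarrow> real) \<Rightarrow> real"
  assumes local_dep: "\<And>e \<theta> \<theta>'. (\<And>i. i \<in> {1..m} \<Longrightarrow> \<theta> i = \<theta>' i) \<Longrightarrow> F e \<theta> = F e \<theta>'"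
    and deriv: "\<And>e \<theta> l t. l \<in> {1..m} \<Longrightarrow>
      ((\<lambda>t. F e (\<theta>(l := t))) has_real_derivative F (e(l := Suc (e l))) (\<theta>(l := t))) (at t)"
    and meas: "\<And>e. F e \<in> borel_measurable (PiM {1..m} (\<lambda>_. borel))"
    and bdd: "\<And>e. \<exists>B. \<forall>\<theta>. \<bar>F e \<theta>\<bar> \<le> B"
begin

abbreviation ord :: "nat \<Rightarrow> nat \<Rightarrow> nat \<Rightarrow> nat" where
  "ord l k \<equiv> (\<lambda>_. 0)(l := k)"

text \<open>Measurability of \<open>F e\<close> is known on the product space, whose points are
  extensional, while hybrid points mixing \<open>x\<close> with \<open>\<phi>\<close> need not be.
  By \<open>local_dep\<close> they may be restricted to \<open>{1..m}\<close> without changing the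
  value.\<close>

lemma meas_comp:
  assumes "\<And>i. i \<in> {1..m} \<Longrightarrow> (\<lambda>x. g x i) \<in> borel_measurable N"
  shows "(\<lambda>x. F e (g x)) \<in> borel_measurable N"
proof -
  have "(\<lambda>x. \<lambda>i\<in>{1..m}. g x i) \<in> measurable N (PiM {1..m} (\<lambda>_. borel))"
    using assms by (intro measurable_restrict) auto
  from measurable_compose[OF this meas[of e]]
  show ?thesis using local_dep[of "\<lambda>i\<in>{1..m}. g x i" "g x" e for x] by simp
qed

lemma deriv_iter:
  assumes "l \<in> {1..m}"
  shows "((\<lambda>t. F (e(l := k)) (\<theta>(l := t))) has_real_derivative F (e(l := Suc k)) (\<theta>(l := t))) (at t)"
  using deriv[OF assms, of "e(l := k)" \<theta> t] by simp

text \<open>The bound \<open>a l \<mu>\<close> is demanded only at points agreeing with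
  \<open>\<phi>\<close> at \<open>l\<close> and below \<open>\<mu>\<close>, which are all that
  averaging in this order ever visits. Condition \<open>c\<close> keeps the base of the square
  nonnegative, so that a lower bound on the absolute mean curvature survives squaring. The loss
  \<open>M2 l * M4 l / 4 * r^2\<close> is twice the product of the curvature bound
  \<open>M2 l\<close> and the Taylor error \<open>M4 l * r^2 / 8\<close>.\<close>

lemma variance_lower_bound:
  fixes \<phi> :: "nat \<Rightarrow> real" and a :: "nat \<Rightarrow> nat \<Rightarrow> real"
  assumes r: "0 < r" and L: "L \<subseteq> {1..m}"
    and M2: "\<And>l \<theta>. l \<in> L \<Longrightarrow> \<bar>F (ord l 2) \<theta>\<bar> \<le> M2 l"
    and M4: "\<And>l \<theta>. l \<in> L \<Longrightarrow> \<bar>F (ord l 4) \<theta>\<bar> \<le> M4 l"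
    and a: "\<And>l \<mu> \<theta>. l \<in> L \<Longrightarrow> \<mu> \<in> {1..m} - {l} \<Longrightarrow> (\<And>i. i < \<mu> \<Longrightarrow> \<theta> i = \<phi> i) \<Longrightarrow> \<theta> l = \<phi> l
      \<Longrightarrow> \<bar>F ((ord l 2)(\<mu> := 2)) \<theta>\<bar> \<le> a l \<mu>"
    and c: "\<And>l. l \<in> L \<Longrightarrow> (\<Sum>\<mu>\<in>{1..m} - {l}. a l \<mu>) * r^2 / 6 \<le> \<bar>F (ord l 2) \<phi>\<bar>"
  shows "(\<Sum>l\<in>L. r^4 / 45 * ((\<bar>F (ord l 2) \<phi>\<bar> - (\<Sum>\<mu>\<in>{1..m} - {l}. a l \<mu>) * r^2 / 6)^2
      - M2 l * M4 l / 4 * r^2)) \<le> variance_under (unif_cube m \<phi> r) (F (\<lambda>_. 0))"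
proof -
  define M where "M i = unif (\<phi> i) r" for i
  define Q where "Q = PiM {1..m} M"
  have Q_cube: "unif_cube m \<phi> r = Q" unfolding Q_def M_def unif_cube_def unif_def ..
  have M: "prob_space (M i)" for i unfolding M_def by (rule prob_space_unif[OF r])
  interpret Mi: prob_space "M i" for i by (rule M)
  interpret Q: prob_space Q unfolding Q_def by (rule prob_space_PiM[OF M])
  have setsM [measurable_cong, simp]: "sets (M i) = sets borel" for i by (simp add: M_def)
  have comp [measurable]: "(\<lambda>x. x i) \<in> borel_measurable Q" if "i \<in> {1..m}" for i
    unfolding Q_def using measurable_component_singleton[OF that, of M]
    by (simp cong: measurable_cong_sets)
  have snd_meas [measurable]: "snd \<in> borel_measurable (Q \<Otimes>\<^sub>M M i)" for i
    using measurable_snd[of Q "M i"] by (simp cong: measurable_cong_sets)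
  have fst_meas: "(\<lambda>z. fst z i) \<in> borel_measurable (Q \<Otimes>\<^sub>M M k)" if "i \<in> {1..m}" for i k
    by (rule measurable_compose[OF measurable_fst comp[OF that]])
  have AEQ: "AE x in Q. \<bar>x i - \<phi> i\<bar> \<le> r" if "i \<in> {1..m}" for i
    unfolding Q_def using AE_PiM_component[of "{1..m}" M i "\<lambda>t. \<bar>t - \<phi> i\<bar> \<le> r"] M that AE_unif[OF r, of "\<phi> i", folded M_def] by simp
  have resample: "(\<integral>x. f x \<partial>Q) = (\<integral>x. (\<integral>t. f (x(i := t)) \<partial>M i) \<partial>Q)"
    if "integrable Q f" "i \<in> {1..m}" for f :: "(nat \<Rightarrow> real) \<Rightarrow> real" and i
    using integral_PiM_resample[OF M _ that(2)] that(1) unfolding Q_def by simp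
  have intF: "integrable N (\<lambda>x. F e (g x))"
    if "prob_space N" "\<And>i. i \<in> {1..m} \<Longrightarrow> (\<lambda>x. g x i) \<in> borel_measurable N"
    for N :: "'x measure" and g e
  proof -
    interpret prob_space N by fact
    obtain B where "\<And>\<theta>. \<bar>F e \<theta>\<bar> \<le> B" using bdd[of e] by auto
    then show ?thesis
      by (intro integrable_const_bound[where B = B] meas_comp that) auto
  qed
  have intF1: "integrable (M i) (\<lambda>t. F e (g t))"
    if "\<And>i. i \<in> {1..m} \<Longrightarrow> (\<lambda>x. g x i) \<in> borel_measurable borel" for i e g
    using that by (intro intF M) (simp cong: measurable_cong_sets)
  define p where "p l x = (x l - \<phi> l)^2 - r^2 / 3" for l and x :: "nat \<Rightarrow> real"
  have p_bound: "\<bar>(y - b)^2 - r^2 / 3\<bar> \<le> r^2" if "\<bar>y - b\<bar> \<le> r" for y b :: real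
  proof -
    have "(y - b)^2 \<le> r^2" using that r by (simp add: abs_le_square_iff[symmetric])
    then show ?thesis using zero_le_power2[of "y - b"] zero_le_power2[of r] by linarith
  qed
  have pmeas [measurable]: "p l \<in> borel_measurable Q" if "l \<in> {1..m}" for l
    unfolding p_def using that by measurable
  have AEp: "AE x in Q. \<bar>p l x\<bar> \<le> r^2" if "l \<in> {1..m}" for l
    using AEQ[OF that] by eventually_elim (simp add: p_def p_bound)
  have int_bd: "integrable Q f" if "f \<in> borel_measurable Q" "AE x in Q. \<bar>f x\<bar> \<le> B" for f :: "_ \<Rightarrow> real" and B
    using that by (intro Q.integrable_const_bound[where B = B]) auto
  have intp: "integrable Q (p l)" if "l \<in> {1..m}" for l
    using that by (intro int_bd[OF _ AEp]) auto
  have intpp: "integrable Q (\<lambda>x. p l x * p k x)" if "l \<in> {1..m}" "k \<in> {1..m}" for l k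
  proof (rule int_bd)
    show "AE x in Q. \<bar>p l x * p k x\<bar> \<le> r^2 * r^2"
      using AEp[OF that(1)] AEp[OF that(2)]
    proof eventually_elim
      case (elim x)
      show ?case unfolding abs_mult by (intro mult_mono elim) auto
    qed
  qed (use that in measurable)
  have intFp: "integrable Q (\<lambda>x. F e x * p l x)" if "l \<in> {1..m}" for l e
  proof -
    obtain B where B: "\<And>\<theta>. \<bar>F e \<theta>\<bar> \<le> B" using bdd[of e] by auto
    have [measurable]: "F e \<in> borel_measurable Q" using meas_comp[of "\<lambda>x. x" Q e] comp by simp
    show ?thesis
    proof (rule int_bd)
      have B0: "0 \<le> B" using B[of \<phi>] by linarith
      show "AE x in Q. \<bar>F e x * p l x\<bar> \<le> B * r^2"
        using AEp[OF that(1)] by eventually_elim (auto simp: abs_mult intro!: mult_mono B B0)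
    qed (use that in measurable)
  qed
  have int_q: "(\<integral>t. (t - \<phi> l)^2 - r^2 / 3 \<partial>M l) = 0" for l
    using integrable_moment_unif[OF r, of "\<phi> l" 2, folded M_def] Mi.prob_space[of l]
      moment_unif_even[OF r, of "\<phi> l", folded M_def] by simp
  have int_q2: "(\<integral>t. ((t - \<phi> l)^2 - r^2 / 3) * ((t - \<phi> l)^2 - r^2 / 3) \<partial>M l) = 4 * r^4 / 45" for l
  proof -
    have "((t - \<phi> l)^2 - r^2 / 3) * ((t - \<phi> l)^2 - r^2 / 3)
        = (t - \<phi> l)^4 - 2 * r^2 / 3 * (t - \<phi> l)^2 + r^4 / 9" for t
      by (simp add: field_simps eval_nat_numeral)
    then have "(\<integral>t. ((t - \<phi> l)^2 - r^2 / 3) * ((t - \<phi> l)^2 - r^2 / 3) \<partial>M l)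
        = r^4 / 5 - 2 * r^2 / 3 * (r^2 / 3) + r^4 / 9"
      using integrable_moment_unif[OF r, of "\<phi> l" 2, folded M_def]
        integrable_moment_unif[OF r, of "\<phi> l" 4, folded M_def] Mi.prob_space[of l]
      by (simp add: moment_unif_even[OF r, of "\<phi> l", folded M_def])
    also have "\<dots> = 4 * r^4 / 45" by (simp add: field_simps eval_nat_numeral)
    finally show ?thesis .
  qed
  have p0: "(\<integral>x. p l x \<partial>Q) = 0" if "l \<in> {1..m}" for l
    using resample[OF intp[OF that] that] int_q by (simp add: p_def)
  have orth: "(\<integral>x. p l x * p k x \<partial>Q) = (if l = k then 4 * r^4 / 45 else 0)"
    if "l \<in> {1..m}" "k \<in> {1..m}" for l k
    using resample[OF intpp[OF that] that(1)] int_q int_q2 Q.prob_space by (auto simp: p_def)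
  have "finite L" using L by (rule finite_subset) simp
  have "(\<Sum>l\<in>L. (\<integral>x. F (\<lambda>_. 0) x * p l x \<partial>Q)^2 / (4 * r^4 / 45)) \<le> variance_under Q (F (\<lambda>_. 0))"
  proof (rule bessel_variance[OF Q.prob_space_axioms \<open>finite L\<close>])
    obtain B where B: "\<And>\<theta>. \<bar>F (\<lambda>_. 0) \<theta>\<bar> \<le> B" using bdd[of "\<lambda>_. 0"] by auto
    have [measurable]: "F (\<lambda>_. 0) \<in> borel_measurable Q" using meas_comp[of "\<lambda>x. x" Q] comp by simp
    have B0: "0 \<le> B" using B[of \<phi>] by linarith
    have "\<bar>F (\<lambda>_. 0) x * F (\<lambda>_. 0) x\<bar> \<le> B * B" for x
      unfolding abs_mult by (intro mult_mono B B0) auto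
    then show "integrable Q (\<lambda>x. F (\<lambda>_. 0) x * F (\<lambda>_. 0) x)"
      by (intro int_bd[of _ "B * B"] AE_I2) measurable
    show "integrable Q (F (\<lambda>_. 0))" by (rule int_bd[of _ "B"]) (auto intro!: B)
    show "(\<integral>x. p l x * p k x \<partial>Q) = (if l = k then 4 * r^4 / 45 else 0)" if "l \<in> L" "k \<in> L" for l k
      using that L by (intro orth) auto
  qed (use L r in \<open>auto intro!: intp intpp intFp p0 simp: subset_iff\<close>)
  moreover have "r^4 / 45 * ((\<bar>F (ord l 2) \<phi>\<bar> - (\<Sum>\<mu>\<in>{1..m} - {l}. a l \<mu>) * r^2 / 6)^2 - M2 l * M4 l / 4 * r^2)
     \<le> (\<integral>x. F (\<lambda>_. 0) x * p l x \<partial>Q)^2 / (4 * r^4 / 45)" if lL: "l \<in> L" for l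
  proof -
    have l: "l \<in> {1..m}" using lL L by auto
    \<comment> \<open>Interpolates between the random point and \<open>\<phi>\<close>:
      \<open>D 0\<close> freezes coordinate \<open>l\<close> only, \<open>D m\<close> is the
      curvature at \<open>\<phi>\<close>, and \<open>E j\<close> averages over the coordinates that
      are not yet frozen.\<close>
    define D where "D j x = F (ord l 2) (\<lambda>i. if i \<le> j \<or> i = l then \<phi> i else x i)" for j and x :: "nat \<Rightarrow> real"
    define E where "E j = (\<integral>x. D j x \<partial>Q)" for j
    define I where "I = (\<integral>x. F (\<lambda>_. 0) x * p l x \<partial>Q)"
    have intD: "integrable Q (D j)" for j
      unfolding D_def by (intro intF Q.prob_space_axioms) (auto intro: comp)
    have Em: "E m = F (ord l 2) \<phi>"
    proof -
      have "D m x = F (ord l 2) \<phi>" for x unfolding D_def by (intro local_dep) auto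
      then have "D m = (\<lambda>_. F (ord l 2) \<phi>)" by blast
      then show ?thesis unfolding E_def by (simp add: Q.prob_space)
    qed
    have D0: "D 0 x = F (ord l 2) (x(l := \<phi> l))" for x
      unfolding D_def by (intro local_dep) auto
    \<comment> \<open>Consecutive hybrids differ in one coordinate. Coordinate \<open>l\<close> is
      frozen from the start, so passing it is free.\<close>
    have step: "\<bar>E j - E (Suc j)\<bar> \<le> (if Suc j = l then 0 else a l (Suc j) * r^2 / 6)" if j: "Suc j \<le> m" for j
    proof (cases "Suc j = l")
      case True
      then have "D j = D (Suc j)" unfolding D_def by (intro ext local_dep) (auto simp: le_Suc_eq)
      then show ?thesis using True by (simp add: E_def)
    next
      case False
      have J: "Suc j \<in> {1..m}" using j by auto
      have app: "\<bar>(\<integral>t. D j (x(Suc j := t)) \<partial>M (Suc j)) - D (Suc j) x\<bar> \<le> a l (Suc j) * r^2 / 6" for x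
      proof -
        define y where "y = (\<lambda>i. if i \<le> j \<or> i = l then \<phi> i else x i)"
        define G where "G k t = F ((ord l 2)(Suc j := k)) (y(Suc j := t))" for k t
        have G0: "G 0 t = D j (x(Suc j := t))" for t
          unfolding G_def D_def y_def using False by (auto intro!: local_dep arg_cong2[where f = F])
        have "G 0 (\<phi> (Suc j)) = D (Suc j) x"
          unfolding G0 D_def by (intro local_dep) (auto simp: le_Suc_eq)
        moreover have "\<bar>(\<integral>t. G 0 t \<partial>unif (\<phi> (Suc j)) r) - G 0 (\<phi> (Suc j))\<bar> \<le> a l (Suc j) * r^2 / 6"
        proof (rule unif_mean_approx[OF r])
          show "(G k has_real_derivative G (Suc k) t) (at t)" for k t
            unfolding G_def by (rule deriv_iter[OF J])
          show "\<bar>G 2 t\<bar> \<le> a l (Suc j)" for t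
            unfolding G_def using False J by (intro a lL) (auto simp: y_def)
          show "integrable (unif (\<phi> (Suc j)) r) (G 0)"
            unfolding G_def M_def[symmetric] by (intro intF1) (auto simp: fun_upd_def)
        qed
        ultimately show ?thesis by (simp add: G0 M_def)
      qed
      have Eres: "E j = (\<integral>x. (\<integral>t. D j (x(Suc j := t)) \<partial>M (Suc j)) \<partial>Q)"
        unfolding E_def by (rule resample[OF intD J])
      have meas1 [measurable]: "(\<lambda>x. \<integral>t. D j (x(Suc j := t)) \<partial>M (Suc j)) \<in> borel_measurable Q"
      proof -
        have "(\<lambda>z. D j ((fst z)(Suc j := snd z))) \<in> borel_measurable (Q \<Otimes>\<^sub>M M (Suc j))"
          unfolding D_def
        proof (rule meas_comp)
          fix i assume i: "i \<in> {1..m}"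
          show "(\<lambda>z. if i \<le> j \<or> i = l then \<phi> i else ((fst z)(Suc j := snd z)) i) \<in> borel_measurable (Q \<Otimes>\<^sub>M M (Suc j))"
            using fst_meas[OF i] by (cases "i \<le> j \<or> i = l"; cases "i = Suc j") auto
        qed
        then show ?thesis
          by (intro Mi.borel_measurable_lebesgue_integral) (simp add: case_prod_beta')
      qed
      have intD': "integrable Q (\<lambda>x. \<integral>t. D j (x(Suc j := t)) \<partial>M (Suc j))"
      proof -
        obtain B where B: "\<And>\<theta>. \<bar>F (ord l 2) \<theta>\<bar> \<le> B" using bdd[of "ord l 2"] by auto
        \<comment> \<open>The estimate \<open>app\<close> serves a second time: it bounds the inner
          integral by a value of the bounded function \<open>F (ord l 2)\<close> plus the error,
          which gives integrability.\<close>
        have "\<bar>\<integral>t. D j (x(Suc j := t)) \<partial>M (Suc j)\<bar> \<le> B + a l (Suc j) * r^2 / 6" for x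
          using app[of x] B[of "\<lambda>i. if i \<le> Suc j \<or> i = l then \<phi> i else x i", folded D_def]
          by linarith
        then show ?thesis by (intro int_bd[of _ "B + a l (Suc j) * r^2 / 6"]) auto
      qed
      show ?thesis
        using Q.integral_diff_le[OF intD' intD app, folded Eres E_def] False by simp
    qed
    have tele: "\<bar>E 0 - E k\<bar> \<le> (\<Sum>\<mu>\<in>{1..k} - {l}. a l \<mu>) * r^2 / 6" if "k \<le> m" for k
      using that
    proof (induction k)
      case (Suc k)
      have "{1..Suc k} - {l} = (if Suc k = l then {1..k} - {l} else insert (Suc k) ({1..k} - {l}))"
        by (auto simp: le_Suc_eq)
      then have "(\<Sum>\<mu>\<in>{1..Suc k} - {l}. a l \<mu>) * r^2 / 6 = (\<Sum>\<mu>\<in>{1..k} - {l}. a l \<mu>) * r^2 / 6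
         + (if Suc k = l then 0 else a l (Suc k) * r^2 / 6)"
        by (auto simp: field_simps)
      then show ?case using Suc step[of k] by linarith
    qed simp
    have E0: "\<bar>E 0\<bar> \<le> M2 l"
    proof -
      have "\<bar>E 0\<bar> \<le> (\<integral>x. \<bar>D 0 x\<bar> \<partial>Q)" unfolding E_def by (rule integral_abs_bound)
      also have "\<dots> \<le> (\<integral>x. M2 l \<partial>Q)"
      proof (intro integral_mono)
        show "\<bar>D 0 x\<bar> \<le> M2 l" for x unfolding D_def by (rule M2[OF lL])
      qed (use intD[of 0] in auto)
      finally show ?thesis by (simp add: Q.prob_space)
    qed
    have I: "\<bar>I - 2 * r^4 / 45 * E 0\<bar> \<le> M4 l * r^6 / 180"
    proof -
      have app: "\<bar>(\<integral>t. F (\<lambda>_. 0) (x(l := t)) * p l (x(l := t)) \<partial>M l) - 2 * r^4 / 45 * D 0 x\<bar> \<le> M4 l * r^6 / 180"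
        if x: "x \<in> space Q" for x
      proof -
        define G where "G k t = F (ord l k) (x(l := t))" for k t
        have "\<bar>(\<integral>t. G 0 t * ((t - \<phi> l)^2 - r^2 / 3) \<partial>unif (\<phi> l) r) - 2 * r^4 / 45 * G 2 (\<phi> l)\<bar> \<le> M4 l * r^6 / 180"
        proof (rule unif_curvature_approx[OF r])
          show "(G k has_real_derivative G (Suc k) t) (at t)" for k t
            unfolding G_def by (rule deriv_iter[OF l])
          show "\<bar>G 4 t\<bar> \<le> M4 l" for t unfolding G_def by (rule M4[OF lL])
          obtain B where B: "\<And>\<theta>. \<bar>F (ord l 0) \<theta>\<bar> \<le> B" using bdd[of "ord l 0"] by auto
          have Gm: "G 0 \<in> borel_measurable (M l)"
            unfolding G_def
          proof (rule meas_comp)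
            show "(\<lambda>t. (x(l := t)) i) \<in> borel_measurable (M l)" for i
              by (cases "i = l") (auto cong: measurable_cong_sets)
          qed
          have B0: "0 \<le> B" using B[of \<phi>] by linarith
          have AEg: "AE t in M l. \<bar>G 0 t * ((t - \<phi> l)^2 - r^2 / 3)\<bar> \<le> B * r^2"
            unfolding M_def using AE_unif[OF r, of "\<phi> l"]
            by eventually_elim (auto simp: abs_mult G_def intro!: mult_mono B B0 p_bound)
          have Gq: "(\<lambda>t. G 0 t * ((t - \<phi> l)^2 - r^2 / 3)) \<in> borel_measurable (M l)"
            by (intro borel_measurable_times borel_measurable_diff borel_measurable_power
                borel_measurable_const Gm measurable_ident_sets setsM)
          show "integrable (unif (\<phi> l) r) (\<lambda>t. G 0 t * ((t - \<phi> l)^2 - r^2 / 3))"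
            unfolding M_def[symmetric] using AEg
            by (intro Mi.integrable_const_bound[where B = "B * r^2"] Gq) (simp only: real_norm_def)
        qed
        moreover have "ord l 0 = (\<lambda>_. 0)" by auto
        ultimately show ?thesis by (simp add: G_def M_def D0 p_def)
      qed
      have Ires: "I = (\<integral>x. (\<integral>t. F (\<lambda>_. 0) (x(l := t)) * p l (x(l := t)) \<partial>M l) \<partial>Q)"
        unfolding I_def by (rule resample[OF intFp[OF l] l])
      have [measurable]: "(\<lambda>x. \<integral>t. F (\<lambda>_. 0) (x(l := t)) * p l (x(l := t)) \<partial>M l) \<in> borel_measurable Q"
      proof -
        have "(\<lambda>z. F (\<lambda>_. 0) ((fst z)(l := snd z))) \<in> borel_measurable (Q \<Otimes>\<^sub>M M l)"
        proof (rule meas_comp)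
          fix i assume i: "i \<in> {1..m}"
          show "(\<lambda>z. ((fst z)(l := snd z)) i) \<in> borel_measurable (Q \<Otimes>\<^sub>M M l)"
            using fst_meas[OF i] by (cases "i = l") auto
        qed
        then have "(\<lambda>z. F (\<lambda>_. 0) ((fst z)(l := snd z)) * ((snd z - \<phi> l)^2 - r^2 / 3)) \<in> borel_measurable (Q \<Otimes>\<^sub>M M l)"
          by (intro borel_measurable_times borel_measurable_diff borel_measurable_power snd_meas borel_measurable_const)
        then show ?thesis
          by (intro Mi.borel_measurable_lebesgue_integral) (simp add: case_prod_beta' p_def)
      qed
      have int': "integrable Q (\<lambda>x. \<integral>t. F (\<lambda>_. 0) (x(l := t)) * p l (x(l := t)) \<partial>M l)"
      proof -
        \<comment> \<open>The quadratic weight is unbounded off the cube, so the inner integral is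
          bounded through \<open>app\<close> and not through its integrand.\<close>
        have "\<bar>\<integral>t. F (\<lambda>_. 0) (x(l := t)) * p l (x(l := t)) \<partial>M l\<bar> \<le> 2 * r^4 / 45 * M2 l + M4 l * r^6 / 180"
          if "x \<in> space Q" for x
        proof -
          have "\<bar>2 * r^4 / 45 * D 0 x\<bar> \<le> 2 * r^4 / 45 * M2 l"
            unfolding abs_mult D_def by (intro mult_mono M2 lL) auto
          then show ?thesis using app[OF that] by linarith
        qed
        then show ?thesis by (intro int_bd[of _ "2 * r^4 / 45 * M2 l + M4 l * r^6 / 180"] AE_I2) auto
      qed
      show ?thesis
        using Q.integral_diff_le[OF int' integrable_mult_right[OF intD] app, folded Ires]
        by (simp add: E_def)
    qed
    define A where "A = (\<Sum>\<mu>\<in>{1..m} - {l}. a l \<mu>) * r^2 / 6"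
    \<comment> \<open>The Taylor error in units of curvature: \<open>M4 l * r^6 / 180\<close>
      divided by \<open>2 * r^4 / 45\<close> is \<open>M4 l * r^2 / 8\<close>.\<close>
    define \<delta> where "\<delta> = I * 45 / (2 * r^4) - E 0"
    have I_eq: "I = 2 * r^4 / 45 * (E 0 + \<delta>)" unfolding \<delta>_def using r by (simp add: field_simps)
    have "2 * r^4 / 45 * \<bar>\<delta>\<bar> \<le> 2 * r^4 / 45 * (M4 l * r^2 / 8)"
    proof -
      have "2 * r^4 / 45 * \<bar>\<delta>\<bar> = \<bar>2 * r^4 / 45 * (E 0 + \<delta>) - 2 * r^4 / 45 * E 0\<bar>"
        by (simp add: distrib_left abs_mult)
      also have "\<dots> \<le> M4 l * r^6 / 180" using I unfolding I_eq .
      also have "\<dots> = 2 * r^4 / 45 * (M4 l * r^2 / 8)" by (simp flip: power_add)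
      finally show ?thesis .
    qed
    moreover have "0 < 2 * r^4 / 45" using r by simp
    ultimately have \<delta>: "\<bar>\<delta>\<bar> \<le> M4 l * r^2 / 8" by (simp only: mult_le_cancel_left_pos)
    have "\<bar>F (ord l 2) \<phi>\<bar> - A \<le> \<bar>E 0\<bar>" using tele[of m] unfolding Em A_def by linarith
    moreover have "0 \<le> \<bar>F (ord l 2) \<phi>\<bar> - A" using c[OF lL] unfolding A_def by simp
    ultimately have 1: "(\<bar>F (ord l 2) \<phi>\<bar> - A)^2 \<le> (E 0)^2" using power_mono[of _ "\<bar>E 0\<bar>" 2] by auto
    have "\<bar>E 0\<bar> * \<bar>\<delta>\<bar> \<le> M2 l * (M4 l * r^2 / 8)" using E0 \<delta> by (intro mult_mono) auto
    then have "- (M2 l * M4 l * r^2 / 8) \<le> E 0 * \<delta>" unfolding abs_mult[symmetric] by (simp add: abs_le_iff)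
    \<comment> \<open>Only the cross term of the square can be negative; the term
      \<open>\<delta>^2\<close> is dropped.\<close>
    then have "(E 0)^2 - M2 l * M4 l / 4 * r^2 \<le> (E 0 + \<delta>)^2"
    proof -
      assume "- (M2 l * M4 l * r^2 / 8) \<le> E 0 * \<delta>"
      moreover have "(E 0 + \<delta>)^2 = (E 0)^2 + 2 * (E 0 * \<delta>) + \<delta>^2" by (simp add: power2_sum)
      moreover have "M2 l * M4 l / 4 * r^2 = 2 * (M2 l * M4 l * r^2 / 8)" by simp
      ultimately show ?thesis using zero_le_power2[of \<delta>] by linarith
    qed
    then have "r^4 / 45 * ((\<bar>F (ord l 2) \<phi>\<bar> - A)^2 - M2 l * M4 l / 4 * r^2) \<le> r^4 / 45 * (E 0 + \<delta>)^2"
      using 1 by (intro mult_left_mono) auto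
    also have "\<dots> = I^2 / (4 * r^4 / 45)"
    proof -
      have "R / 45 * x^2 = (2 * R / 45 * x)^2 / (4 * R / 45)" if "0 < R" for R x :: real
        using that by (simp add: field_simps power2_eq_square)
      from this[of "r^4"] show ?thesis unfolding I_eq using r by simp
    qed
    finally show ?thesis unfolding A_def I_def .
  qed
  ultimately show ?thesis unfolding Q_cube by (meson order_trans sum_mono)
qed

end

subsection \<open>Adjoints, norms and commutators\<close>

lemma mult_carrier_square [simp]:
  "A \<in> carrier_mat d d \<Longrightarrow> B \<in> carrier_mat d d \<Longrightarrow> A * B \<in> carrier_mat d d"
  by (rule mult_carrier_mat)

lemma assoc_mult_square:
  fixes A B C :: "'a :: semiring_0 mat"
  shows "A \<in> carrier_mat d d \<Longrightarrow> B \<in> carrier_mat d d \<Longrightarrow> C \<in> carrier_mat d d \<Longrightarrow> A * B * C = A * (B * C)"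
  by (rule assoc_mult_mat)

lemma dim_mat_adjoint [simp]: "dim_row (mat_adjoint A) = dim_col A" "dim_col (mat_adjoint A) = dim_row A"
  by (simp_all add: mat_adjoint_def mat_of_rows_def)

lemma mat_adjoint_carrier [simp]: "A \<in> carrier_mat n k \<Longrightarrow> mat_adjoint A \<in> carrier_mat k n"
  by (intro carrier_matI) auto

lemma index_mat_adjoint [simp]:
  fixes A :: "complex mat"
  shows "i < dim_col A \<Longrightarrow> j < dim_row A \<Longrightarrow> mat_adjoint A $$ (i, j) = cnj (A $$ (j, i))"
  by (simp add: mat_adjoint_def mat_of_rows_def cols_def conjugate_complex_def)

lemma index_mult_mat_sum:
  assumes "A \<in> carrier_mat n k" "B \<in> carrier_mat k l" "i < n" "j < l"
  shows "(A * B) $$ (i, j) = (\<Sum>p<k. A $$ (i, p) * B $$ (p, j))"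
  using assms by (auto simp: scalar_prod_def atLeast0LessThan intro!: sum.cong)

lemma index_mult_vec_sum:
  assumes "A \<in> carrier_mat n k" "v \<in> carrier_vec k" "i < n"
  shows "vec_index (A *\<^sub>v v) i = (\<Sum>p<k. A $$ (i, p) * vec_index v p)"
  using assms by (auto simp: scalar_prod_def atLeast0LessThan intro!: sum.cong)

lemma mat_adjoint_mult:
  fixes A B :: "complex mat"
  assumes A: "A \<in> carrier_mat n k" and B: "B \<in> carrier_mat k l"
  shows "mat_adjoint (A * B) = mat_adjoint B * mat_adjoint A"
proof (rule eq_matI)
  fix i j assume "i < dim_row (mat_adjoint B * mat_adjoint A)" "j < dim_col (mat_adjoint B * mat_adjoint A)"
  then have ij: "i < l" "j < n" using A B by auto
  have "mat_adjoint (A * B) $$ (i, j) = cnj ((A * B) $$ (j, i))" using ij A B by simp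
  also have "\<dots> = (\<Sum>p<k. cnj (A $$ (j, p) * B $$ (p, i)))"
    using index_mult_mat_sum[OF A B ij(2,1)] by simp
  also have "\<dots> = (\<Sum>p<k. mat_adjoint B $$ (i, p) * mat_adjoint A $$ (p, j))"
    using ij A B by (intro sum.cong) (auto simp: mult.commute)
  also have "\<dots> = (mat_adjoint B * mat_adjoint A) $$ (i, j)"
    using index_mult_mat_sum[of "mat_adjoint B" l k "mat_adjoint A" n i j] A B ij by simp
  finally show "mat_adjoint (A * B) $$ (i, j) = (mat_adjoint B * mat_adjoint A) $$ (i, j)" .
qed (use A B in auto)

lemma mat_adjoint_adjoint: "mat_adjoint (mat_adjoint A) = (A :: complex mat)"
  by (rule eq_matI) auto

section \<open>Vector norm, inner product and operator norm\<close>

lemma vnorm_L2: "vnorm v = L2_set (\<lambda>i. cmod (vec_index v i)) {..<dim_vec v}"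
  by (simp add: vnorm_def L2_set_def)

lemma vnorm_nonneg [simp]: "0 \<le> vnorm v"
  by (simp add: vnorm_L2)

lemma vnorm_power2: "(vnorm v)^2 = (\<Sum>i<dim_vec v. (cmod (vec_index v i))^2)"
  by (simp add: vnorm_def sum_nonneg)

lemma vnorm_smult: "vnorm (c \<cdot>\<^sub>v v) = cmod c * vnorm v"
  unfolding vnorm_L2 L2_set_right_distrib[OF norm_ge_zero] by (intro L2_set_cong) (auto simp: norm_mult)

lemma vnorm_add_le:
  assumes "v \<in> carrier_vec d" "w \<in> carrier_vec d"
  shows "vnorm (v + w) \<le> vnorm v + vnorm w"
proof -
  have "vnorm (v + w) \<le> L2_set (\<lambda>i. cmod (vec_index v i) + cmod (vec_index w i)) {..<d}"
    using assms by (auto simp: vnorm_L2 intro!: L2_set_mono norm_triangle_ineq)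
  also have "\<dots> \<le> vnorm v + vnorm w"
    using L2_set_triangle_ineq[of "\<lambda>i. cmod (vec_index v i)" "\<lambda>i. cmod (vec_index w i)" "{..<d}"] assms
    by (simp add: vnorm_L2)
  finally show ?thesis .
qed

lemma vnorm_minus_le:
  assumes "v \<in> carrier_vec d" "w \<in> carrier_vec d"
  shows "vnorm (v - w) \<le> vnorm v + vnorm w"
proof -
  have "v - w = v + (- 1) \<cdot>\<^sub>v w" using assms by (intro eq_vecI) auto
  then show ?thesis using vnorm_add_le[of v d "(- 1) \<cdot>\<^sub>v w"] assms by (simp add: vnorm_smult)
qed

lemma cmod_cinner_le:
  assumes "v \<in> carrier_vec d" "w \<in> carrier_vec d"
  shows "cmod (cinner v w) \<le> vnorm v * vnorm w"
proof -
  have "cmod (cinner v w) \<le> (\<Sum>i<d. \<bar>cmod (vec_index v i)\<bar> * \<bar>cmod (vec_index w i)\<bar>)"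
    using assms unfolding cinner_def by (auto intro!: norm_sum[THEN order_trans] simp: norm_mult)
  also have "\<dots> \<le> vnorm v * vnorm w"
    using L2_set_mult_ineq[of "\<lambda>i. cmod (vec_index v i)" "\<lambda>i. cmod (vec_index w i)" "{..<d}"] assms
    by (simp add: vnorm_L2)
  finally show ?thesis .
qed

lemma cinner_self: "cinner v v = complex_of_real ((vnorm v)^2)"
  unfolding cinner_def vnorm_power2
  by (simp add: complex_norm_square[symmetric] mult.commute)

lemma cinner_adjoint:
  assumes A: "A \<in> carrier_mat d d" and v: "v \<in> carrier_vec d" and w: "w \<in> carrier_vec d"
  shows "cinner v (A *\<^sub>v w) = cinner (mat_adjoint A *\<^sub>v v) w"
proof -
  have "cinner v (A *\<^sub>v w) = (\<Sum>i<d. \<Sum>j<d. cnj (vec_index v i) * A $$ (i, j) * vec_index w j)"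
    using v index_mult_vec_sum[OF A w]
    by (auto simp: cinner_def sum_distrib_left mult.assoc intro!: sum.cong)
  also have "\<dots> = (\<Sum>j<d. \<Sum>i<d. cnj (vec_index v i) * A $$ (i, j) * vec_index w j)"
    by (rule sum.swap)
  also have "\<dots> = cinner (mat_adjoint A *\<^sub>v v) w"
    using A v w index_mult_vec_sum[of "mat_adjoint A" d d v]
    by (auto simp: cinner_def sum_distrib_right sum_distrib_left mult_ac intro!: sum.cong)
  finally show ?thesis .
qed

text \<open>With \<open>c = - (s^2)\<close> this expands the norm of \<open>A (A v) - s^2 v\<close>
  in the search for an eigenvalue of modulus \<open>opnorm A\<close>.\<close>

lemma vnorm_add_power2:
  assumes "v \<in> carrier_vec d" "w \<in> carrier_vec d"
  shows "(vnorm (v + complex_of_real c \<cdot>\<^sub>v w))^2 = (vnorm v)^2 + 2 * c * Re (cinner v w) + c^2 * (vnorm w)^2"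
proof -
  have e: "(cmod (x + complex_of_real c * y))^2 = (cmod x)^2 + 2 * c * Re (cnj x * y) + c^2 * (cmod y)^2" for x y
    by (simp only: cmod_power2) (simp add: power2_eq_square algebra_simps)
  have "(vnorm (v + complex_of_real c \<cdot>\<^sub>v w))^2
      = (\<Sum>i<d. (cmod (vec_index v i + complex_of_real c * vec_index w i))^2)"
    using assms unfolding vnorm_power2 by (intro sum.cong) auto
  then show ?thesis
    using assms unfolding e by (simp add: vnorm_power2 cinner_def sum.distrib sum_distrib_left distrib_left)
qed

text \<open>\<open>opnorm\<close> is a supremum of reals, which says nothing until the set is known
  to be bounded. The sum of the moduli of all entries is a crude bound that settles this.\<close>

lemma opnorm_bound_exists:
  assumes A: "A \<in> carrier_mat d d"
  obtains K where "\<And>v. v \<in> carrier_vec d \<Longrightarrow> vnorm (A *\<^sub>v v) \<le> K * vnorm v" "0 \<le> K"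
proof
  define K where "K = (\<Sum>i<d. \<Sum>j<d. cmod (A $$ (i, j)))"
  show "0 \<le> K" unfolding K_def by (intro sum_nonneg) auto
  fix v :: "complex Matrix.vec" assume v: "v \<in> carrier_vec d"
  have le: "cmod (vec_index v j) \<le> vnorm v" if "j < d" for j
    using member_le_L2_set[of "{..<d}" j "\<lambda>i. cmod (vec_index v i)"] that v by (simp add: vnorm_L2)
  have "vnorm (A *\<^sub>v v) \<le> (\<Sum>i<d. cmod (vec_index (A *\<^sub>v v) i))"
    using A L2_set_le_sum[of "{..<d}" "\<lambda>i. cmod (vec_index (A *\<^sub>v v) i)"] unfolding vnorm_L2 by simp
  also have "\<dots> \<le> (\<Sum>i<d. \<Sum>j<d. cmod (A $$ (i, j)) * vnorm v)"
  proof (intro sum_mono)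
    fix i assume "i \<in> {..<d}"
    then have "vec_index (A *\<^sub>v v) i = (\<Sum>j<d. A $$ (i, j) * vec_index v j)"
      using index_mult_vec_sum[OF A v] by simp
    then show "cmod (vec_index (A *\<^sub>v v) i) \<le> (\<Sum>j<d. cmod (A $$ (i, j)) * vnorm v)"
      by (auto intro!: sum_norm_le simp: norm_mult le mult_left_mono)
  qed
  also have "\<dots> = K * vnorm v" by (simp add: K_def sum_distrib_right)
  finally show "vnorm (A *\<^sub>v v) \<le> K * vnorm v" .
qed

lemma vnorm_zero [simp]: "vnorm (0\<^sub>v d) = 0"
  by (simp add: vnorm_def)

lemma opnorm_bdd_above:
  assumes A: "A \<in> carrier_mat d d"
  shows "bdd_above {vnorm (A *\<^sub>v v) | v. v \<in> carrier_vec (dim_col A) \<and> vnorm v \<le> 1}"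
proof -
  obtain K where K: "\<And>v. v \<in> carrier_vec d \<Longrightarrow> vnorm (A *\<^sub>v v) \<le> K * vnorm v" "0 \<le> K"
    using opnorm_bound_exists[OF A] by blast
  show ?thesis
  proof (rule bdd_aboveI[where M = K])
    fix x assume "x \<in> {vnorm (A *\<^sub>v v) | v. v \<in> carrier_vec (dim_col A) \<and> vnorm v \<le> 1}"
    then obtain v where v: "x = vnorm (A *\<^sub>v v)" "v \<in> carrier_vec d" "vnorm v \<le> 1" using A by auto
    have "x \<le> K * vnorm v" using K(1) v by simp
    also have "\<dots> \<le> K * 1" using K(2) v(3) by (intro mult_left_mono)
    finally show "x \<le> K" by simp
  qed
qed

lemma opnorm_nonneg:
  assumes A: "A \<in> carrier_mat d d"
  shows "0 \<le> opnorm A"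
proof -
  have "vnorm (A *\<^sub>v 0\<^sub>v d) \<le> opnorm A"
    unfolding opnorm_def using A by (intro cSup_upper opnorm_bdd_above) (auto intro!: exI[of _ "0\<^sub>v d"])
  then show ?thesis using vnorm_nonneg order_trans by blast
qed

lemma vnorm_mult_le:
  assumes A: "A \<in> carrier_mat d d" and v: "v \<in> carrier_vec d"
  shows "vnorm (A *\<^sub>v v) \<le> opnorm A * vnorm v"
proof (cases "vnorm v = 0")
  \<comment> \<open>A vector of norm 0 cannot be normalised; the crude bound already shows that its
    image has norm at most 0.\<close>
  case True
  then show ?thesis using opnorm_bound_exists[OF A] v by (metis mult_zero_right)
next
  case False
  then have pos: "0 < vnorm v" using vnorm_nonneg[of v] by linarith
  define u where "u = complex_of_real (1 / vnorm v) \<cdot>\<^sub>v v"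
  have u: "u \<in> carrier_vec d" "vnorm u = 1"
    using v pos by (auto simp: u_def vnorm_smult norm_divide)
  have "vnorm (A *\<^sub>v u) \<le> opnorm A"
    unfolding opnorm_def using A u by (intro cSup_upper opnorm_bdd_above) auto
  moreover have "A *\<^sub>v u = complex_of_real (1 / vnorm v) \<cdot>\<^sub>v (A *\<^sub>v v)"
    unfolding u_def using A v by (simp add: mult_mat_vec)
  ultimately show ?thesis using pos by (simp add: vnorm_smult norm_divide field_simps)
qed

lemma opnorm_le:
  assumes A: "A \<in> carrier_mat d d" and c: "0 \<le> c"
    and b: "\<And>v. v \<in> carrier_vec d \<Longrightarrow> vnorm (A *\<^sub>v v) \<le> c * vnorm v"
  shows "opnorm A \<le> c"
  unfolding opnorm_def
proof (rule cSup_least)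
  show "{vnorm (A *\<^sub>v v) | v. v \<in> carrier_vec (dim_col A) \<and> vnorm v \<le> 1} \<noteq> {}"
    by (auto intro!: exI[of _ "0\<^sub>v (dim_col A)"])
  fix x assume "x \<in> {vnorm (A *\<^sub>v v) | v. v \<in> carrier_vec (dim_col A) \<and> vnorm v \<le> 1}"
  then obtain v where v: "x = vnorm (A *\<^sub>v v)" "v \<in> carrier_vec d" "vnorm v \<le> 1" using A by auto
  have "x \<le> c * vnorm v" using b v by simp
  also have "\<dots> \<le> c * 1" using c v(3) by (intro mult_left_mono)
  finally show "x \<le> c" by simp
qed

lemma opnorm_mult_le:
  assumes A: "A \<in> carrier_mat d d" and B: "B \<in> carrier_mat d d"
  shows "opnorm (A * B) \<le> opnorm A * opnorm B"
proof (rule opnorm_le)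
  show "A * B \<in> carrier_mat d d" "0 \<le> opnorm A * opnorm B"
    using A B opnorm_nonneg[OF A] opnorm_nonneg[OF B] by auto
  fix v :: "complex Matrix.vec" assume v: "v \<in> carrier_vec d"
  have "vnorm ((A * B) *\<^sub>v v) = vnorm (A *\<^sub>v (B *\<^sub>v v))" using assoc_mult_mat_vec[OF A B v] by simp
  also have "\<dots> \<le> opnorm A * vnorm (B *\<^sub>v v)" using A B v by (intro vnorm_mult_le) auto
  also have "\<dots> \<le> opnorm A * (opnorm B * vnorm v)"
    by (intro mult_left_mono vnorm_mult_le[OF B v] opnorm_nonneg[OF A])
  finally show "vnorm ((A * B) *\<^sub>v v) \<le> opnorm A * opnorm B * vnorm v" by (simp add: mult.assoc)
qed

lemma opnorm_minus_le:
  assumes A: "A \<in> carrier_mat d d" and B: "B \<in> carrier_mat d d"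
  shows "opnorm (A - B) \<le> opnorm A + opnorm B"
proof (rule opnorm_le)
  show "A - B \<in> carrier_mat d d" "0 \<le> opnorm A + opnorm B"
    using A B opnorm_nonneg[OF A] opnorm_nonneg[OF B] by auto
  fix v :: "complex Matrix.vec" assume v: "v \<in> carrier_vec d"
  have "vnorm ((A - B) *\<^sub>v v) = vnorm (A *\<^sub>v v - B *\<^sub>v v)" using minus_mult_distrib_mat_vec[OF A B v] by simp
  also have "\<dots> \<le> vnorm (A *\<^sub>v v) + vnorm (B *\<^sub>v v)" using A B v by (intro vnorm_minus_le[of _ d]) auto
  also have "\<dots> \<le> opnorm A * vnorm v + opnorm B * vnorm v"
    using A B v by (intro add_mono vnorm_mult_le[of _ d])
  finally show "vnorm ((A - B) *\<^sub>v v) \<le> (opnorm A + opnorm B) * vnorm v" by (simp add: algebra_simps)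
qed

lemma opnorm_smult_le:
  assumes A: "A \<in> carrier_mat d d"
  shows "opnorm (c \<cdot>\<^sub>m A) \<le> cmod c * opnorm A"
proof (rule opnorm_le)
  show "c \<cdot>\<^sub>m A \<in> carrier_mat d d" "0 \<le> cmod c * opnorm A" using A opnorm_nonneg[OF A] by auto
  fix v :: "complex Matrix.vec" assume v: "v \<in> carrier_vec d"
  have "(c \<cdot>\<^sub>m A) *\<^sub>v v = c \<cdot>\<^sub>v (A *\<^sub>v v)"
    using A v by (intro eq_vecI) (auto simp: index_mult_vec_sum scalar_prod_def sum_distrib_left mult_ac intro!: sum.cong)
  then show "vnorm ((c \<cdot>\<^sub>m A) *\<^sub>v v) \<le> cmod c * opnorm A * vnorm v"
    using vnorm_mult_le[OF A v] by (simp add: vnorm_smult mult_left_mono mult.assoc)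
qed

lemma vnorm_unitary:
  assumes U: "unitary_mat d U" and v: "v \<in> carrier_vec d"
  shows "vnorm (U *\<^sub>v v) = vnorm v"
proof -
  have Uc: "U \<in> carrier_mat d d" and UU: "mat_adjoint U * U = 1\<^sub>m d" using U by (auto simp: unitary_mat_def)
  have "cinner (U *\<^sub>v v) (U *\<^sub>v v) = cinner (mat_adjoint U *\<^sub>v (U *\<^sub>v v)) v"
    using cinner_adjoint[OF Uc _ v, of "U *\<^sub>v v"] Uc v by simp
  also have "mat_adjoint U *\<^sub>v (U *\<^sub>v v) = v"
    using assoc_mult_mat_vec[of "mat_adjoint U" d d U d v] Uc v UU by simp
  finally have "(vnorm (U *\<^sub>v v))^2 = (vnorm v)^2"
    unfolding cinner_self of_real_eq_iff .
  then show ?thesis by simp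
qed

lemma unitary_adjoint: "unitary_mat d U \<Longrightarrow> unitary_mat d (mat_adjoint U)"
  by (auto simp: unitary_mat_def mat_adjoint_adjoint)

lemma opnorm_unitary_le:
  assumes U: "unitary_mat d U"
  shows "opnorm U \<le> 1"
  using U vnorm_unitary[OF U] by (intro opnorm_le[of _ d]) (auto simp: unitary_mat_def)

lemma opnorm_conj_le:
  assumes U: "unitary_mat d U" and X: "X \<in> carrier_mat d d"
  shows "opnorm (mat_adjoint U * X * U) \<le> opnorm X"
proof -
  have Uc: "U \<in> carrier_mat d d" using U by (simp add: unitary_mat_def)
  have "opnorm (mat_adjoint U * X * U) \<le> opnorm (mat_adjoint U * X) * opnorm U"
    using Uc X by (intro opnorm_mult_le[of _ d]) auto
  also have "\<dots> \<le> opnorm (mat_adjoint U * X) * 1"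
    using Uc X opnorm_unitary_le[OF U] by (intro mult_left_mono opnorm_nonneg[of _ d]) auto
  also have "\<dots> \<le> opnorm (mat_adjoint U) * opnorm X"
    using opnorm_mult_le[of "mat_adjoint U" d X] Uc X by simp
  also have "\<dots> \<le> 1 * opnorm X"
    using opnorm_unitary_le[OF unitary_adjoint[OF U]] X by (intro mult_right_mono opnorm_nonneg[of _ d]) auto
  finally show ?thesis by simp
qed

text \<open>One inequality used twice: conjugation with the adjoint of \<open>U\<close> undoes
  conjugation with \<open>U\<close>.\<close>

lemma opnorm_conj:
  assumes U: "unitary_mat d U" and X: "X \<in> carrier_mat d d"
  shows "opnorm (mat_adjoint U * X * U) = opnorm X"
proof (rule antisym[OF opnorm_conj_le[OF U X]])
  have Uc: "U \<in> carrier_mat d d" "mat_adjoint U \<in> carrier_mat d d" and UU: "U * mat_adjoint U = 1\<^sub>m d"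
    using U by (auto simp: unitary_mat_def)
  have "U * (mat_adjoint U * X * U) * mat_adjoint U = (U * mat_adjoint U) * X * (U * mat_adjoint U)"
    using Uc X by (simp add: assoc_mult_square[of _ d])
  also have "\<dots> = X" using X UU by simp
  finally have "opnorm X = opnorm (mat_adjoint (mat_adjoint U) * (mat_adjoint U * X * U) * mat_adjoint U)"
    by (simp only: mat_adjoint_adjoint)
  also have "\<dots> \<le> opnorm (mat_adjoint U * X * U)"
    using Uc X by (intro opnorm_conj_le[OF unitary_adjoint[OF U]]) simp
  finally show "opnorm X \<le> opnorm (mat_adjoint U * X * U)" .
qed

section \<open>Hermitian matrices: norm, extreme eigenvalues, commutators\<close>

lemma smult_one_mult_vec:
  "v \<in> carrier_vec d \<Longrightarrow> (c \<cdot>\<^sub>m 1\<^sub>m d) *\<^sub>v v = c \<cdot>\<^sub>v (v :: complex Matrix.vec)"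
proof (rule eq_vecI)
  assume v: "v \<in> carrier_vec d"
  fix i assume "i < dim_vec (c \<cdot>\<^sub>v v)"
  then have i: "i < d" using v by simp
  have "vec_index ((c \<cdot>\<^sub>m 1\<^sub>m d) *\<^sub>v v) i = (\<Sum>p<d. (c \<cdot>\<^sub>m 1\<^sub>m d) $$ (i, p) * vec_index v p)"
    using i v by (intro index_mult_vec_sum) auto
  also have "\<dots> = (\<Sum>p<d. if p = i then c * vec_index v i else 0)"
    using i by (intro sum.cong) auto
  finally show "vec_index ((c \<cdot>\<^sub>m 1\<^sub>m d) *\<^sub>v v) i = vec_index (c \<cdot>\<^sub>v v) i"
    using i v by simp
qed simp

lemma char_matrix_mult_vec:
  assumes "A \<in> carrier_mat d d" "v \<in> carrier_vec d"
  shows "char_matrix A c *\<^sub>v v = A *\<^sub>v v + (- c) \<cdot>\<^sub>v (v :: complex Matrix.vec)"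
  using assms add_mult_distrib_mat_vec[of A d d "(- c) \<cdot>\<^sub>m 1\<^sub>m d" v] smult_one_mult_vec[of v d "- c"]
  by (simp add: char_matrix_def)

text \<open>Away from the spectrum the characteristic matrix has nonzero determinant and hence a
  left inverse, whose norm is the constant.\<close>

lemma bounded_below_if_not_eigenvalue:
  assumes A: "A \<in> carrier_mat d d" and k: "\<not> eigenvalue A k"
  obtains n where "0 \<le> n" "\<And>v. v \<in> carrier_vec d \<Longrightarrow> vnorm v \<le> n * vnorm (char_matrix A k *\<^sub>v v)"
proof -
  let ?C = "char_matrix A k"
  have C: "?C \<in> carrier_mat d d" using A by simp
  have "Determinant.det ?C \<noteq> 0" using k eigenvalue_det[OF A] by simp
  then have "?C \<in> Units (ring_mat TYPE(complex) d undefined)" by (rule det_non_zero_imp_unit[OF C])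
  then obtain N where N: "N \<in> carrier_mat d d" "N * ?C = 1\<^sub>m d"
    unfolding Units_def by (auto simp: ring_mat_def)
  show thesis
  proof (rule that[of "opnorm N"])
    show "0 \<le> opnorm N" using N by (intro opnorm_nonneg)
    fix v :: "complex Matrix.vec" assume v: "v \<in> carrier_vec d"
    have "N *\<^sub>v (?C *\<^sub>v v) = v"
      using assoc_mult_mat_vec[OF N(1) C v] N(2) v by simp
    then show "vnorm v \<le> opnorm N * vnorm (?C *\<^sub>v v)"
      using vnorm_mult_le[OF N(1), of "?C *\<^sub>v v"] C v by simp
  qed
qed

lemma unit_vec_vnorm: "i < d \<Longrightarrow> vnorm (unit_vec d i) = 1"
proof -
  assume i: "i < d"
  have "(vnorm (unit_vec d i))^2 = (\<Sum>j<d. if j = i then 1 else 0)"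
    unfolding vnorm_power2 by (intro sum.cong) (auto simp: unit_vec_def)
  also have "\<dots> = 1" using i by simp
  finally show ?thesis using vnorm_nonneg[of "unit_vec d i"] by (simp add: power2_eq_1_iff)
qed

text \<open>
  With \<open>s = opnorm A\<close>, Hermiticity gives
  \<open>vnorm ((A\<^sup>2 - s\<^sup>2) v)\<^sup>2 \<le> s\<^sup>2 (s\<^sup>2 (vnorm v)\<^sup>2 - (vnorm (A v))\<^sup>2)\<close>. If \<open>A\<^sup>2 - s\<^sup>2 = (A + s) (A - s)\<close>
  were invertible, this would bound \<open>A\<close> by a constant smaller than its norm.
\<close>

lemma hermitian_opnorm_eigenvalue:
  assumes H: "hermitian_mat d A" and d: "0 < d"
  shows "eigenvalue A (complex_of_real (opnorm A)) \<or> eigenvalue A (- complex_of_real (opnorm A))"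
proof (rule ccontr)
  define s where "s = opnorm A"
  assume "\<not> ?thesis"
  then have n1: "\<not> eigenvalue A (complex_of_real s)" and n2: "\<not> eigenvalue A (- complex_of_real s)"
    by (auto simp: s_def)
  have A: "A \<in> carrier_mat d d" and Aadj: "mat_adjoint A = A" using H by (auto simp: hermitian_mat_def)
  obtain k1 where k1: "0 \<le> k1" "\<And>v. v \<in> carrier_vec d \<Longrightarrow> vnorm v \<le> k1 * vnorm (char_matrix A (complex_of_real s) *\<^sub>v v)"
    using bounded_below_if_not_eigenvalue[OF A n1] by blast
  obtain k2 where k2: "0 \<le> k2" "\<And>v. v \<in> carrier_vec d \<Longrightarrow> vnorm v \<le> k2 * vnorm (char_matrix A (- complex_of_real s) *\<^sub>v v)"
    using bounded_below_if_not_eigenvalue[OF A n2] by blast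
  define K where "K = k1 * k2"
  have s0: "0 \<le> s" unfolding s_def by (rule opnorm_nonneg[OF A])
  have main: "(vnorm v)^2 \<le> K^2 * (s^2 * (s^2 * (vnorm v)^2 - (vnorm (A *\<^sub>v v))^2))"
    if v: "v \<in> carrier_vec d" for v
  proof -
    let ?Av = "A *\<^sub>v v" let ?AAv = "A *\<^sub>v (A *\<^sub>v v)"
    have c: "?Av \<in> carrier_vec d" "?AAv \<in> carrier_vec d" using A v by auto
    define u where "u = char_matrix A (complex_of_real s) *\<^sub>v v"
    have u: "u \<in> carrier_vec d" "u = ?Av + (- complex_of_real s) \<cdot>\<^sub>v v"
      using A v char_matrix_mult_vec[OF A v] by (auto simp: u_def)
    have "char_matrix A (- complex_of_real s) *\<^sub>v u = A *\<^sub>v u + complex_of_real s \<cdot>\<^sub>v u"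
      using char_matrix_mult_vec[OF A u(1)] by simp
    also have "A *\<^sub>v u = ?AAv + (- complex_of_real s) \<cdot>\<^sub>v ?Av"
      unfolding u(2) using A v c by (simp add: mult_add_distrib_mat_vec[of _ d d] mult_mat_vec[of _ d d])
    also have "?AAv + (- complex_of_real s) \<cdot>\<^sub>v ?Av + complex_of_real s \<cdot>\<^sub>v u = ?AAv + complex_of_real (- (s^2)) \<cdot>\<^sub>v v"
      unfolding u(2) using c v A by (intro eq_vecI) (auto simp: algebra_simps power2_eq_square)
    finally have w: "char_matrix A (- complex_of_real s) *\<^sub>v u = ?AAv + complex_of_real (- (s^2)) \<cdot>\<^sub>v v" .
    have "vnorm v \<le> k1 * vnorm u" unfolding u_def by (rule k1(2)[OF v])
    also have "\<dots> \<le> k1 * (k2 * vnorm (?AAv + complex_of_real (- (s^2)) \<cdot>\<^sub>v v))"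
      using k2(2)[OF u(1)] k1(1) unfolding w by (intro mult_left_mono)
    finally have "vnorm v \<le> K * vnorm (?AAv + complex_of_real (- (s^2)) \<cdot>\<^sub>v v)" by (simp add: K_def mult.assoc)
    then have "(vnorm v)^2 \<le> (K * vnorm (?AAv + complex_of_real (- (s^2)) \<cdot>\<^sub>v v))^2"
      by (rule power_mono) simp
    then have 1: "(vnorm v)^2 \<le> K^2 * (vnorm (?AAv + complex_of_real (- (s^2)) \<cdot>\<^sub>v v))^2"
      by (simp only: power_mult_distrib)
    \<comment> \<open>Hermiticity enters here: the cross term becomes \<open>- 2 * s^2\<close> times
      the squared norm of \<open>A *\<^sub>v v\<close>, of which the estimate of the leading term
      uses up one half.\<close>
    have "cinner ?AAv v = cinner ?Av ?Av"
      using cinner_adjoint[OF A c(1) v] Aadj by simp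
    then have "(vnorm (?AAv + complex_of_real (- (s^2)) \<cdot>\<^sub>v v))^2
        = (vnorm ?AAv)^2 - 2 * s^2 * (vnorm ?Av)^2 + s^2 * s^2 * (vnorm v)^2"
      unfolding vnorm_add_power2[OF c(2) v] by (simp add: cinner_self power2_eq_square)
    also have "(vnorm ?AAv)^2 \<le> (s * vnorm ?Av)^2"
      using vnorm_mult_le[OF A c(1)] by (intro power_mono) (auto simp: s_def)
    finally have "(vnorm (?AAv + complex_of_real (- (s^2)) \<cdot>\<^sub>v v))^2 \<le> s^2 * (s^2 * (vnorm v)^2 - (vnorm ?Av)^2)"
      by (simp add: power_mult_distrib algebra_simps)
    then have "K^2 * (vnorm (?AAv + complex_of_real (- (s^2)) \<cdot>\<^sub>v v))^2 \<le> K^2 * (s^2 * (s^2 * (vnorm v)^2 - (vnorm ?Av)^2))"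
      by (rule mult_left_mono) simp
    with 1 show ?thesis by linarith
  qed
  have e: "unit_vec d 0 \<in> carrier_vec d" "vnorm (unit_vec d 0) = 1" using unit_vec_vnorm[OF d] by auto
  \<comment> \<open>Otherwise \<open>main\<close> at a unit vector, available since
    \<open>0 < d\<close>, would read \<open>1 \<le> 0\<close>.\<close>
  have "K^2 * s^2 \<noteq> 0"
  proof
    assume "K^2 * s^2 = 0"
    then have "K = 0 \<or> s = 0" by auto
    then show False using main[OF e(1)] e(2) by auto
  qed
  then have Ks: "0 < K^2 * s^2" and s: "0 < s" using s0 by (auto simp: zero_less_mult_iff)
  \<comment> \<open>Solving \<open>main\<close> for the squared norm of \<open>A *\<^sub>v v\<close>
    yields the factor \<open>s^2 - 1 / (K^2 * s^2)\<close>; the maximum with 0 keeps the square root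
    meaningful.\<close>
  define q where "q = max 0 (s^2 - 1 / (K^2 * s^2))"
  have "s \<le> sqrt q"
    unfolding s_def
  proof (rule opnorm_le[OF A])
    show "0 \<le> sqrt q" by (simp add: q_def)
    fix v :: "complex Matrix.vec" assume v: "v \<in> carrier_vec d"
    have "(vnorm v)^2 / (K^2 * s^2) \<le> s^2 * (vnorm v)^2 - (vnorm (A *\<^sub>v v))^2"
      using main[OF v] Ks by (simp add: divide_le_eq mult_ac)
    then have "(vnorm (A *\<^sub>v v))^2 \<le> (s^2 - 1 / (K^2 * s^2)) * (vnorm v)^2"
      by (simp add: left_diff_distrib)
    also have "\<dots> \<le> q * (vnorm v)^2" by (intro mult_right_mono) (auto simp: q_def)
    also have "\<dots> = (sqrt q * vnorm v)^2" by (simp add: power_mult_distrib q_def)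
    finally show "vnorm (A *\<^sub>v v) \<le> sqrt q * vnorm v"
      by (rule power2_le_imp_le) (simp add: q_def)
  qed
  then have "s^2 \<le> (sqrt q)^2" using s by (intro power_mono) auto
  then have "s^2 \<le> q" by (simp add: q_def)
  moreover have "0 < 1 / (K^2 * s^2)" using Ks by simp
  moreover have "0 < s^2" using s by simp
  ultimately show False by (auto simp: q_def max_def split: if_splits)
qed

text \<open>With the factor \<open>\<i>\<close> this is exactly the derivative of the Heisenberg
  evolution generated by \<open>H\<close>, so higher derivatives are plain iterates without
  phases.\<close>

definition comm_ad :: "complex mat \<Rightarrow> complex mat \<Rightarrow> complex mat" where
  "comm_ad H X = \<i> \<cdot>\<^sub>m (H * X - X * H)"

lemma finite_eigenvalues:
  assumes A: "A \<in> carrier_mat d d"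
  shows "finite {Re k | k. eigenvalue A k}"
proof -
  have "char_poly A \<noteq> 0" using degree_monic_char_poly[OF A] by auto
  then have "finite {k. eigenvalue A k}" unfolding eigenvalue_root_char_poly[OF A] by (rule poly_roots_finite)
  moreover have "{Re k | k. eigenvalue A k} = Re ` {k. eigenvalue A k}" by auto
  ultimately show ?thesis by simp
qed

lemma eigenvalue_bounds:
  assumes A: "A \<in> carrier_mat d d" and k: "eigenvalue A k"
  shows "lambda_min A \<le> Re k" "Re k \<le> lambda_max A"
  unfolding lambda_min_def lambda_max_def using finite_eigenvalues[OF A] k by (auto intro: Min_le Max_ge)

lemma cmod_eigenvalue_le:
  assumes A: "A \<in> carrier_mat d d" and k: "eigenvalue A k"
  shows "cmod k \<le> opnorm A"
proof -
  obtain v where v: "v \<in> carrier_vec d" "v \<noteq> 0\<^sub>v d" "A *\<^sub>v v = k \<cdot>\<^sub>v v"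
    using k A by (auto simp: eigenvalue_def eigenvector_def)
  have "vnorm v \<noteq> 0"
  proof
    assume "vnorm v = 0"
    then have "(\<Sum>i<d. (cmod (vec_index v i))^2) = 0" using vnorm_power2[of v] v(1) by simp
    then have "\<forall>i<d. vec_index v i = 0" by (subst (asm) sum_nonneg_eq_0_iff) auto
    then show False using v(1,2) by (auto intro!: eq_vecI)
  qed
  then have "0 < vnorm v" using vnorm_nonneg[of v] by linarith
  moreover have "cmod k * vnorm v \<le> opnorm A * vnorm v"
    using vnorm_mult_le[OF A v(1)] v(3) by (simp add: vnorm_smult)
  ultimately show ?thesis by simp
qed

text \<open>\<open>Max\<close> and \<open>Min\<close> are meaningful only on a nonempty finite set.
  The spectrum is nonempty because plus or minus the norm is an eigenvalue, and this is where
  \<open>0 < d\<close> matters.\<close>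

lemma omega_max_bounds:
  assumes H: "hermitian_mat d A" and d: "0 < d"
  shows "0 \<le> omega_max A" "omega_max A \<le> 2 * opnorm A"
proof -
  have A: "A \<in> carrier_mat d d" using H by (simp add: hermitian_mat_def)
  let ?S = "{Re k | k. eigenvalue A k}"
  have ne: "?S \<noteq> {}" using hermitian_opnorm_eigenvalue[OF H d] by auto
  note fin = finite_eigenvalues[OF A]
  have b: "\<bar>x\<bar> \<le> opnorm A" if "x \<in> ?S" for x
    using that cmod_eigenvalue_le[OF A] abs_Re_le_cmod order_trans by blast
  have m: "lambda_max A \<in> ?S" "lambda_min A \<in> ?S"
    unfolding lambda_max_def lambda_min_def using Max_in[OF fin ne] Min_in[OF fin ne] by auto
  show "omega_max A \<le> 2 * opnorm A" unfolding omega_max_def using b[OF m(1)] b[OF m(2)] by linarith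
  have "lambda_min A \<le> lambda_max A"
    unfolding lambda_max_def using m(2) fin by (rule Max_ge[rotated])
  then show "0 \<le> omega_max A" by (simp add: omega_max_def)
qed

text \<open>The norm of the shifted matrix is, up to sign, one of its eigenvalues. Adding the
  midpoint \<open>c\<close> back gives an eigenvalue of \<open>A\<close>, which lies between the
  extreme ones and so at most half the width away from \<open>c\<close>.\<close>

lemma opnorm_centered_le:
  assumes H: "hermitian_mat d A" and d: "0 < d"
  defines "c \<equiv> (lambda_max A + lambda_min A) / 2"
  shows "opnorm (char_matrix A (complex_of_real c)) \<le> omega_max A / 2"
proof -
  let ?K = "char_matrix A (complex_of_real c)"
  have A: "A \<in> carrier_mat d d" "mat_adjoint A = A" using H by (auto simp: hermitian_mat_def)
  have K: "?K \<in> carrier_mat d d" using A by simp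
  have "mat_adjoint ?K = ?K"
  proof (rule eq_matI)
    fix i j assume "i < dim_row ?K" "j < dim_col ?K"
    then have ij: "i < d" "j < d" using K by auto
    have "cnj (A $$ (j, i)) = A $$ (i, j)" using index_mat_adjoint[of i A j] A ij by simp
    then show "mat_adjoint ?K $$ (i, j) = ?K $$ (i, j)"
      using ij A K by (auto simp: char_matrix_def)
  qed (use K in auto)
  then have "hermitian_mat d ?K" using K by (simp add: hermitian_mat_def)
  from hermitian_opnorm_eigenvalue[OF this d]
  obtain k where k: "eigenvalue ?K k" "k = complex_of_real (opnorm ?K) \<or> k = - complex_of_real (opnorm ?K)"
    by blast
  have "eigenvalue A (complex_of_real c + k)"
  proof -
    obtain v where v: "v \<in> carrier_vec d" "v \<noteq> 0\<^sub>v d" "?K *\<^sub>v v = k \<cdot>\<^sub>v v"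
      using k K by (auto simp: eigenvalue_def eigenvector_def)
    have "A *\<^sub>v v = (complex_of_real c + k) \<cdot>\<^sub>v v"
    proof (rule eq_vecI)
      fix i assume "i < dim_vec ((complex_of_real c + k) \<cdot>\<^sub>v v)"
      then have i: "i < d" using v by simp
      have "vec_index (A *\<^sub>v v + (- complex_of_real c) \<cdot>\<^sub>v v) i = vec_index (k \<cdot>\<^sub>v v) i"
        using char_matrix_mult_vec[OF A(1) v(1)] v(3) by simp
      then have "vec_index (A *\<^sub>v v) i - complex_of_real c * vec_index v i = k * vec_index v i"
        using i v A by simp
      then show "vec_index (A *\<^sub>v v) i = vec_index ((complex_of_real c + k) \<cdot>\<^sub>v v) i"
        using i v by (simp add: algebra_simps del: index_mult_mat_vec)
    qed (use A v in auto)
    then show ?thesis using v A by (auto simp: eigenvalue_def eigenvector_def)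
  qed
  from eigenvalue_bounds[OF A(1) this] k(2) show ?thesis
    by (auto simp: c_def omega_max_def field_simps)
qed

lemma comm_ad_carrier [simp]: "H \<in> carrier_mat d d \<Longrightarrow> X \<in> carrier_mat d d \<Longrightarrow> comm_ad H X \<in> carrier_mat d d"
  unfolding comm_ad_def by (intro smult_carrier_mat minus_carrier_mat mult_carrier_square)

lemma opnorm_comm_ad_le:
  assumes H: "hermitian_mat d H" and d: "0 < d" and X: "X \<in> carrier_mat d d"
  shows "opnorm (comm_ad H X) \<le> omega_max H * opnorm X"
proof -
  define c where "c = (lambda_max H + lambda_min H) / 2"
  define K where "K = char_matrix H (complex_of_real c)"
  have Hc: "H \<in> carrier_mat d d" using H by (simp add: hermitian_mat_def)
  have K: "K \<in> carrier_mat d d" using Hc by (simp add: K_def)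
  have KX: "K * X = H * X + (- complex_of_real c) \<cdot>\<^sub>m X"
    using Hc X by (simp add: K_def char_matrix_def add_mult_distrib_mat[of _ d d] mult_smult_assoc_mat[of _ d d])
  have XK: "X * K = X * H + (- complex_of_real c) \<cdot>\<^sub>m X"
    using Hc X by (simp add: K_def char_matrix_def mult_add_distrib_mat[of _ d d _ d] mult_smult_distrib[of _ d d _ d])
  have "H * X - X * H = K * X - X * K"
    unfolding KX XK using Hc X by (intro eq_matI) auto
  then have "opnorm (comm_ad H X) \<le> opnorm (K * X - X * K)"
    using opnorm_smult_le[OF minus_carrier_mat[OF mult_carrier_square[OF X K]], of \<i> "K * X"]
    unfolding comm_ad_def by simp
  also have "\<dots> \<le> opnorm (K * X) + opnorm (X * K)" using K X by (intro opnorm_minus_le[of _ d]) auto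
  also have "\<dots> \<le> opnorm K * opnorm X + opnorm X * opnorm K" using K X by (intro add_mono opnorm_mult_le[of _ d]) auto
  also have "\<dots> = 2 * opnorm K * opnorm X" by simp
  also have "\<dots> \<le> omega_max H * opnorm X"
    using opnorm_centered_le[OF H d] opnorm_nonneg[OF X] unfolding K_def c_def by (intro mult_right_mono) auto
  finally show ?thesis .
qed

subsection \<open>States\<close>

text \<open>
  A Cholesky factorisation: eliminate the index \<open>p\<close> by passing to the Schur complement. When the pivot
  \<open>a p p\<close> vanishes the whole row does, and the convention \<open>x / 0 = 0\<close> makes the same formulas correct.
\<close>

lemma psd_factorisation:
  fixes a :: "'i \<Rightarrow> 'i \<Rightarrow> complex"
  assumes "finite I"
    and "\<And>i j. i \<in> I \<Longrightarrow> j \<in> I \<Longrightarrow> a j i = cnj (a i j)"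
    and "\<And>x. 0 \<le> Re (\<Sum>i\<in>I. \<Sum>j\<in>I. cnj (x i) * a i j * x j)"
  shows "\<exists>w. \<forall>i\<in>I. \<forall>j\<in>I. a i j = (\<Sum>k\<in>I. w k i * cnj (w k j))"
  using assms
proof (induction I arbitrary: a rule: finite_induct)
  case (insert p I)
  note herm = insert.prems(1)
  define b where "b = a p p"
  have b_cnj: "cnj b = b" using herm[of p p] by (simp add: b_def)
  have expand: "(\<Sum>i\<in>insert p I. \<Sum>j\<in>insert p I. cnj (x i) * a i j * x j)
      = cnj (x p) * b * x p + cnj (x p) * (\<Sum>j\<in>I. a p j * x j) + cnj (\<Sum>j\<in>I. a p j * x j) * x p
        + (\<Sum>i\<in>I. \<Sum>j\<in>I. cnj (x i) * a i j * x j)" for x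
  proof -
    have "(\<Sum>i\<in>I. cnj (x i) * a i p * x p) = cnj (\<Sum>j\<in>I. a p j * x j) * x p"
      using herm[of p] by (simp add: sum_distrib_right sum_distrib_left mult_ac)
    then show ?thesis
      using insert.hyps by (simp add: sum.distrib sum_distrib_left b_def algebra_simps)
  qed
  have psd: "0 \<le> Re (cnj (x p) * b * x p + cnj (x p) * (\<Sum>j\<in>I. a p j * x j) + cnj (\<Sum>j\<in>I. a p j * x j) * x p
        + (\<Sum>i\<in>I. \<Sum>j\<in>I. cnj (x i) * a i j * x j))" for x
    using insert.prems(2)[of x] unfolding expand .
  have b_real: "b = complex_of_real (Re b)" using b_cnj by (simp add: complex_eq_iff)
  have b0: "0 \<le> Re b" using psd[of "\<lambda>i. if i = p then 1 else 0"] insert.hyps by (simp add: sum.neutral if_distrib cong: if_cong)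
  have row0: "a p j = 0" if b: "b = 0" and j: "j \<in> I" for j
  proof (rule ccontr)
    assume ne: "a p j \<noteq> 0"
    \<comment> \<open>Chosen to refute positivity: at the vector with entry 1 at \<open>j\<close>
      and \<open>- t * a p j\<close> at the pivot, the form has real part
      \<open>Re (a j j) - 2 * t * (cmod (a p j))^2 = - 1\<close>.\<close>
    define t where "t = (Re (a j j) + 1) / (2 * (cmod (a p j))^2)"
    define x where "x = (\<lambda>i. if i = p then - complex_of_real t * a p j else if i = j then 1 else 0)"
    have xp: "x p = - complex_of_real t * a p j" by (simp add: x_def)
    have xI: "x i = (if i = j then 1 else 0)" if "i \<in> I" for i using that insert.hyps by (auto simp: x_def)
    have S: "(\<Sum>i\<in>I. a p i * x i) = a p j"
    proof -
      have "(\<Sum>i\<in>I. a p i * x i) = (\<Sum>i\<in>I. if i = j then a p j else 0)"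
        by (intro sum.cong) (auto simp: xI)
      then show ?thesis using j insert.hyps by simp
    qed
    have Q: "(\<Sum>i\<in>I. \<Sum>k\<in>I. cnj (x i) * a i k * x k) = a j j"
    proof -
      have "(\<Sum>k\<in>I. cnj (x i) * a i k * x k) = (if i = j then a j j else 0)" if i: "i \<in> I" for i
      proof -
        have "(\<Sum>k\<in>I. cnj (x i) * a i k * x k) = (\<Sum>k\<in>I. if k = j then cnj (x i) * a i j else 0)"
          by (intro sum.cong) (auto simp: xI)
        then show ?thesis using i j insert.hyps by (simp add: xI)
      qed
      then have "(\<Sum>i\<in>I. \<Sum>k\<in>I. cnj (x i) * a i k * x k) = (\<Sum>i\<in>I. if i = j then a j j else 0)"
        by (intro sum.cong) auto
      then show ?thesis using j insert.hyps by simp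
    qed
    have "0 \<le> Re (a j j) - 2 * t * (cmod (a p j))^2"
      using psd[of x] unfolding S Q xp b cmod_power2
      by (simp add: algebra_simps power2_eq_square)
    moreover have "2 * t * (cmod (a p j))^2 = Re (a j j) + 1" using ne by (simp add: t_def)
    ultimately show False by simp
  qed
  define a' where "a' i j = a i j - a i p * a p j / b" for i j
  have "\<exists>w. \<forall>i\<in>I. \<forall>j\<in>I. a' i j = (\<Sum>k\<in>I. w k i * cnj (w k j))"
  proof (rule insert.IH)
    show "a' j i = cnj (a' i j)" if "i \<in> I" "j \<in> I" for i j
      using herm[of i j] herm[of i p] herm[of p j] that by (simp add: a'_def b_cnj)
    fix x :: "'i \<Rightarrow> complex"
    define S where "S = (\<Sum>j\<in>I. a p j * x j)"
    \<comment> \<open>Completes the square in the pivot coordinate, so that the form at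
      \<open>y\<close> is the form of the Schur complement at \<open>x\<close>. For
      \<open>b = 0\<close> the quotients are 0 and the identity is immediate.\<close>
    define y where "y = x(p := - S / b)"
    have y: "y i = x i" if "i \<in> I" for i using that insert.hyps by (auto simp: y_def)
    have "cnj (y p) * b * y p + cnj (y p) * (\<Sum>j\<in>I. a p j * y j) + cnj (\<Sum>j\<in>I. a p j * y j) * y p
        + (\<Sum>i\<in>I. \<Sum>j\<in>I. cnj (y i) * a i j * y j)
        = (\<Sum>i\<in>I. \<Sum>j\<in>I. cnj (x i) * a i j * x j) - cnj S * S / b"
    proof -
      have yS: "(\<Sum>j\<in>I. a p j * y j) = S" unfolding S_def by (intro sum.cong) (auto simp: y)
      have yQ: "(\<Sum>i\<in>I. \<Sum>j\<in>I. cnj (y i) * a i j * y j) = (\<Sum>i\<in>I. \<Sum>j\<in>I. cnj (x i) * a i j * x j)"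
        by (intro sum.cong) (auto simp: y)
      have yp: "y p = - S / b" by (simp add: y_def)
      show ?thesis unfolding yS yQ yp by (cases "b = 0") (simp_all add: b_cnj)
    qed
    also have "\<dots> = (\<Sum>i\<in>I. \<Sum>j\<in>I. cnj (x i) * a' i j * x j)"
    proof -
      have "cnj S * S / b = (\<Sum>i\<in>I. \<Sum>j\<in>I. cnj (x i) * (a i p * a p j / b) * x j)"
        unfolding S_def cnj_sum sum_product sum_divide_distrib
        using herm[of p] by (intro sum.cong refl) (simp add: mult_ac)
      then show ?thesis by (simp add: a'_def algebra_simps sum_subtractf)
    qed
    finally show "0 \<le> Re (\<Sum>i\<in>I. \<Sum>j\<in>I. cnj (x i) * a' i j * x j)"
      using psd[of y] by simp
  qed
  then obtain w' where w': "\<And>i j. i \<in> I \<Longrightarrow> j \<in> I \<Longrightarrow> a' i j = (\<Sum>k\<in>I. w' k i * cnj (w' k j))"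
    by blast
  \<comment> \<open>One Cholesky column for the pivot, scaled by the root of \<open>Re b\<close>;
    the vectors of the Schur complement are extended by 0 at \<open>p\<close>.\<close>
  define w where "w k i = (if k = p then a i p / complex_of_real (sqrt (Re b)) else if i = p then 0 else w' k i)" for k i
  have wI: "(\<Sum>k\<in>I. w k i * cnj (w k j)) = (if i = p \<or> j = p then 0 else (\<Sum>k\<in>I. w' k i * cnj (w' k j)))" for i j
  proof -
    have "(\<Sum>k\<in>I. w k i * cnj (w k j)) = (\<Sum>k\<in>I. if i = p \<or> j = p then 0 else w' k i * cnj (w' k j))"
      using insert.hyps by (intro sum.cong) (auto simp: w_def)
    then show ?thesis by simp
  qed
  have wp: "w p i * cnj (w p j) = a i p * a p j / b" if "i \<in> insert p I" "j \<in> insert p I" for i j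
  proof -
    have "complex_of_real (sqrt (Re b)) * complex_of_real (sqrt (Re b)) = b"
      using b0 b_real by (metis of_real_mult real_sqrt_mult_self abs_of_nonneg)
    then show ?thesis using herm[of j p] that by (simp add: w_def)
  qed
  have "a i j = (\<Sum>k\<in>insert p I. w k i * cnj (w k j))" if ij: "i \<in> insert p I" "j \<in> insert p I" for i j
  proof -
    have "(\<Sum>k\<in>insert p I. w k i * cnj (w k j)) = a i p * a p j / b + (\<Sum>k\<in>I. w k i * cnj (w k j))"
      using insert.hyps wp[OF ij] by simp
    also have "\<dots> = a i j"
    proof (cases "i = p \<or> j = p")
      case True
      show ?thesis
      proof (cases "b = 0")
        case b: True
        have "a i j = 0"
          using True ij row0[OF b] herm[of p i] herm[of i p] b by (auto simp: b_def)
        then show ?thesis using True b by (simp add: wI)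
      next
        case False
        then show ?thesis using True by (auto simp: wI b_def)
      qed
    next
      case False
      then show ?thesis using ij by (simp add: wI w'[symmetric] a'_def)
    qed
    finally show ?thesis by simp
  qed
  then show ?case by blast
qed simp

text \<open>The factorisation writes the state as a sum of rank one terms, so the trace against
  \<open>X\<close> is a sum of expectation values in the vectors \<open>w k\<close>, and trace 1
  says that their squared norms sum to 1. Cholesky factors do here what eigenvectors usually
  do.\<close>

lemma density_trace_le:
  assumes rho: "density_op d \<rho>" and X: "X \<in> carrier_mat d d"
  shows "cmod (mtrace (\<rho> * X)) \<le> opnorm X"
proof -
  have R: "\<rho> \<in> carrier_mat d d" "mat_adjoint \<rho> = \<rho>"
    and psd: "\<And>v. v \<in> carrier_vec d \<Longrightarrow> 0 \<le> Re (cinner v (\<rho> *\<^sub>v v))" and tr: "mtrace \<rho> = 1"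
    using rho by (auto simp: density_op_def hermitian_mat_def)
  have "\<exists>w. \<forall>i\<in>{..<d}. \<forall>j\<in>{..<d}. \<rho> $$ (i, j) = (\<Sum>k\<in>{..<d}. w k i * cnj (w k j))"
  proof (rule psd_factorisation)
    show "\<rho> $$ (j, i) = cnj (\<rho> $$ (i, j))" if "i \<in> {..<d}" "j \<in> {..<d}" for i j
      using index_mat_adjoint[of j \<rho> i] R that by simp
    fix x :: "nat \<Rightarrow> complex"
    have "cinner (Matrix.vec d x) (\<rho> *\<^sub>v Matrix.vec d x) = (\<Sum>i<d. \<Sum>j<d. cnj (x i) * \<rho> $$ (i, j) * x j)"
      using R index_mult_vec_sum[OF R(1), of "Matrix.vec d x"]
      by (auto simp: cinner_def sum_distrib_left mult.assoc intro!: sum.cong)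
    then show "0 \<le> Re (\<Sum>i<d. \<Sum>j<d. cnj (x i) * \<rho> $$ (i, j) * x j)"
      using psd[of "Matrix.vec d x"] by simp
  qed simp
  then obtain w where w: "\<And>i j. i < d \<Longrightarrow> j < d \<Longrightarrow> \<rho> $$ (i, j) = (\<Sum>k<d. w k i * cnj (w k j))" by auto
  have trX: "mtrace (\<rho> * Y) = (\<Sum>k<d. cinner (Matrix.vec d (w k)) (Y *\<^sub>v Matrix.vec d (w k)))"
    if Y: "Y \<in> carrier_mat d d" for Y
  proof -
    have "mtrace (\<rho> * Y) = (\<Sum>i<d. \<Sum>j<d. \<rho> $$ (i, j) * Y $$ (j, i))"
      using R Y index_mult_mat_sum[OF R(1) Y] by (simp add: mtrace_def)
    also have "\<dots> = (\<Sum>i<d. \<Sum>j<d. \<Sum>k<d. w k i * cnj (w k j) * Y $$ (j, i))"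
      by (simp add: w sum_distrib_right)
    also have "\<dots> = (\<Sum>i<d. \<Sum>k<d. \<Sum>j<d. w k i * cnj (w k j) * Y $$ (j, i))"
      by (intro sum.cong refl sum.swap)
    also have "\<dots> = (\<Sum>k<d. \<Sum>i<d. \<Sum>j<d. w k i * cnj (w k j) * Y $$ (j, i))" by (rule sum.swap)
    also have "\<dots> = (\<Sum>k<d. \<Sum>j<d. \<Sum>i<d. w k i * cnj (w k j) * Y $$ (j, i))"
      by (intro sum.cong refl sum.swap)
    also have "\<dots> = (\<Sum>k<d. cinner (Matrix.vec d (w k)) (Y *\<^sub>v Matrix.vec d (w k)))"
    proof (intro sum.cong refl)
      fix k
      show "(\<Sum>j<d. \<Sum>i<d. w k i * cnj (w k j) * Y $$ (j, i)) = cinner (Matrix.vec d (w k)) (Y *\<^sub>v Matrix.vec d (w k))"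
        unfolding cinner_def using index_mult_vec_sum[OF Y, of "Matrix.vec d (w k)"]
        by (auto simp: sum_distrib_left mult_ac intro!: sum.cong)
    qed
    finally show ?thesis .
  qed
  have norm1: "(\<Sum>k<d. (vnorm (Matrix.vec d (w k)))^2) = 1"
  proof -
    have "complex_of_real (\<Sum>k<d. (vnorm (Matrix.vec d (w k)))^2) = mtrace (\<rho> * 1\<^sub>m d)"
      unfolding trX[OF one_carrier_mat] by (simp add: cinner_self)
    also have "\<dots> = complex_of_real 1" using R tr by simp
    finally show ?thesis unfolding of_real_eq_iff .
  qed
  have "cmod (mtrace (\<rho> * X)) \<le> (\<Sum>k<d. opnorm X * (vnorm (Matrix.vec d (w k)))^2)"
    unfolding trX[OF X]
  proof (rule sum_norm_le)
    fix k
    let ?v = "Matrix.vec d (w k)"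
    have "cmod (cinner ?v (X *\<^sub>v ?v)) \<le> vnorm ?v * vnorm (X *\<^sub>v ?v)"
      using X by (intro cmod_cinner_le[of _ d]) auto
    also have "\<dots> \<le> vnorm ?v * (opnorm X * vnorm ?v)"
      using X by (intro mult_left_mono vnorm_mult_le[of _ d]) auto
    finally show "cmod (cinner ?v (X *\<^sub>v ?v)) \<le> opnorm X * (vnorm ?v)^2"
      by (simp add: power2_eq_square mult_ac)
  qed
  also have "\<dots> = opnorm X" unfolding sum_distrib_left[symmetric] norm1 by simp
  finally show ?thesis .
qed

subsection \<open>Derivatives of matrix-valued curves\<close>

text \<open>\<open>complex mat\<close> holds matrices of every size, so differentiation is
  entrywise; the carrier conditions travel with the predicate and save separate bookkeeping of
  dimensions.\<close>

definition mat_has_deriv :: "nat \<Rightarrow> (real \<Rightarrow> complex mat) \<Rightarrow> complex mat \<Rightarrow> real \<Rightarrow> bool" where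
  "mat_has_deriv d F F' t \<longleftrightarrow> (\<forall>s. F s \<in> carrier_mat d d) \<and> F' \<in> carrier_mat d d \<and>
     (\<forall>i<d. \<forall>j<d. ((\<lambda>s. F s $$ (i, j)) has_vector_derivative F' $$ (i, j)) (at t))"

lemma mat_has_deriv_const: "A \<in> carrier_mat d d \<Longrightarrow> mat_has_deriv d (\<lambda>_. A) (0\<^sub>m d d) t"
  by (auto simp: mat_has_deriv_def)

lemma mat_has_deriv_mult:
  assumes F: "mat_has_deriv d F F' t" and G: "mat_has_deriv d G G' t"
  shows "mat_has_deriv d (\<lambda>s. F s * G s) (F' * G t + F t * G') t"
proof -
  have c: "\<And>s. F s \<in> carrier_mat d d" "F' \<in> carrier_mat d d" "\<And>s. G s \<in> carrier_mat d d" "G' \<in> carrier_mat d d"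
    using F G by (auto simp: mat_has_deriv_def)
  have "((\<lambda>s. (F s * G s) $$ (i, j)) has_vector_derivative (F' * G t + F t * G') $$ (i, j)) (at t)"
    if ij: "i < d" "j < d" for i j
  proof -
    have "((\<lambda>s. \<Sum>p<d. F s $$ (i, p) * G s $$ (p, j)) has_vector_derivative
        (\<Sum>p<d. F t $$ (i, p) * G' $$ (p, j) + F' $$ (i, p) * G t $$ (p, j))) (at t)"
      using F G ij unfolding mat_has_deriv_def
      by (intro has_vector_derivative_sum has_vector_derivative_mult) auto
    moreover have "(F s * G s) $$ (i, j) = (\<Sum>p<d. F s $$ (i, p) * G s $$ (p, j))" for s
      by (rule index_mult_mat_sum[OF c(1) c(3) ij])
    moreover have "(F' * G t + F t * G') $$ (i, j) = (\<Sum>p<d. F t $$ (i, p) * G' $$ (p, j) + F' $$ (i, p) * G t $$ (p, j))"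
      using index_mult_mat_sum[OF c(2) c(3) ij] index_mult_mat_sum[OF c(1) c(4) ij] c(1)[of t] c(2) c(3)[of t] c(4) ij
      by (simp add: sum.distrib add.commute)
    ultimately show ?thesis by simp
  qed
  then show ?thesis using c unfolding mat_has_deriv_def by (auto intro!: add_carrier_mat mult_carrier_square)
qed

lemma mat_has_deriv_cong: "mat_has_deriv d F F' t \<Longrightarrow> F' = G' \<Longrightarrow> mat_has_deriv d F G' t"
  by simp

lemma mat_has_deriv_mult_left:
  assumes A: "A \<in> carrier_mat d d" and F: "mat_has_deriv d F F' t"
  shows "mat_has_deriv d (\<lambda>s. A * F s) (A * F') t"
proof (rule mat_has_deriv_cong[OF mat_has_deriv_mult[OF mat_has_deriv_const[OF A] F]])
  have "F t \<in> carrier_mat d d" "F' \<in> carrier_mat d d" using F by (auto simp: mat_has_deriv_def)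
  then show "0\<^sub>m d d * F t + A * F' = A * F'" using A by (simp add: left_add_zero_mat[of _ d d])
qed

lemma mat_has_deriv_mult_right:
  assumes A: "A \<in> carrier_mat d d" and F: "mat_has_deriv d F F' t"
  shows "mat_has_deriv d (\<lambda>s. F s * A) (F' * A) t"
proof (rule mat_has_deriv_cong[OF mat_has_deriv_mult[OF F mat_has_deriv_const[OF A]]])
  have "F t \<in> carrier_mat d d" "F' \<in> carrier_mat d d" using F by (auto simp: mat_has_deriv_def)
  then show "F' * A + F t * 0\<^sub>m d d = F' * A" using A by (simp add: right_add_zero_mat[of _ d d])
qed

lemma mat_has_deriv_adjoint:
  assumes "mat_has_deriv d F F' t"
  shows "mat_has_deriv d (\<lambda>s. mat_adjoint (F s)) (mat_adjoint F') t"
proof -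
  have c: "\<And>s. F s \<in> carrier_mat d d" "F' \<in> carrier_mat d d"
    using assms by (auto simp: mat_has_deriv_def)
  have "((\<lambda>s. mat_adjoint (F s) $$ (i, j)) has_vector_derivative mat_adjoint F' $$ (i, j)) (at t)"
    if ij: "i < d" "j < d" for i j
  proof -
    have "((\<lambda>s. cnj (F s $$ (j, i))) has_vector_derivative cnj (F' $$ (j, i))) (at t)"
      using assms ij unfolding mat_has_deriv_def by (intro has_vector_derivative_cnj) auto
    moreover have "mat_adjoint (F s) $$ (i, j) = cnj (F s $$ (j, i))" for s
      using c(1)[of s] ij by simp
    moreover have "mat_adjoint F' $$ (i, j) = cnj (F' $$ (j, i))" using c(2) ij by simp
    ultimately show ?thesis by simp
  qed
  then show ?thesis using c unfolding mat_has_deriv_def by auto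
qed

lemma mat_has_deriv_comm_ad:
  assumes H: "H \<in> carrier_mat d d" and F: "mat_has_deriv d F F' t"
  shows "mat_has_deriv d (\<lambda>s. comm_ad H (F s)) (comm_ad H F') t"
proof -
  have c: "\<And>s. F s \<in> carrier_mat d d" "F' \<in> carrier_mat d d"
    using F by (auto simp: mat_has_deriv_def)
  have e: "comm_ad H X $$ (i, j) = \<i> * ((H * X) $$ (i, j) - (X * H) $$ (i, j))"
    if "X \<in> carrier_mat d d" "i < d" "j < d" for X i j
    using that H by (simp add: comm_ad_def del: index_mult_mat(1))
  have "((\<lambda>s. comm_ad H (F s) $$ (i, j)) has_vector_derivative comm_ad H F' $$ (i, j)) (at t)"
    if ij: "i < d" "j < d" for i j
    unfolding e[OF c(1) ij] e[OF c(2) ij]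
    using mat_has_deriv_mult_left[OF H F] mat_has_deriv_mult_right[OF H F] ij
    by (intro has_vector_derivative_mult_right has_vector_derivative_diff) (auto simp: mat_has_deriv_def)
  then show ?thesis using c H unfolding mat_has_deriv_def by auto
qed

lemma mat_has_deriv_comm_ad_power:
  assumes H: "H \<in> carrier_mat d d" and F: "mat_has_deriv d F F' t"
  shows "mat_has_deriv d (\<lambda>s. (comm_ad H ^^ k) (F s)) ((comm_ad H ^^ k) F') t"
  by (induction k) (auto intro: F mat_has_deriv_comm_ad[OF H])

text \<open>\<open>mat_d2\<close> nests \<open>vector_derivative\<close>, so the first derivative
  has to be known at every point: the outer derivative treats it as a function.\<close>

lemma mat_d2_eq:
  assumes F: "\<And>s. mat_has_deriv d F (F' s) s" and F': "\<And>s. mat_has_deriv d F' (F'' s) s"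
  shows "mat_d2 d F t = F'' t"
proof (rule eq_matI)
  have c: "F'' t \<in> carrier_mat d d" using F' by (auto simp: mat_has_deriv_def)
  fix i j assume "i < dim_row (F'' t)" "j < dim_col (F'' t)"
  then have ij: "i < d" "j < d" using c by auto
  have "vector_derivative (\<lambda>s. F s $$ (i, j)) (at s) = F' s $$ (i, j)" for s
    using F[of s] ij by (intro vector_derivative_at) (auto simp: mat_has_deriv_def)
  then have "d2 (\<lambda>s. F s $$ (i, j)) t = vector_derivative (\<lambda>s. F' s $$ (i, j)) (at t)"
    by (simp add: d2_def)
  also have "\<dots> = F'' t $$ (i, j)"
    using F'[of t] ij by (intro vector_derivative_at) (auto simp: mat_has_deriv_def)
  finally show "mat_d2 d F t $$ (i, j) = F'' t $$ (i, j)" using ij by (simp add: mat_d2_def)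
qed (use F'[of t] in \<open>auto simp: mat_d2_def mat_has_deriv_def\<close>)

subsection \<open>The matrix exponential\<close>

lemma cmod_index_le_opnorm:
  assumes A: "A \<in> carrier_mat d d" and ij: "i < d" "j < d"
  shows "cmod (A $$ (i, j)) \<le> opnorm A"
proof -
  let ?v = "A *\<^sub>v unit_vec d j"
  have "vec_index ?v i = A $$ (i, j)" using A ij by simp
  moreover have "cmod (vec_index ?v i) \<le> vnorm ?v"
    unfolding vnorm_L2 using A ij by (intro member_le_L2_set) auto
  moreover have "vnorm ?v \<le> opnorm A * 1"
    using vnorm_mult_le[OF A, of "unit_vec d j"] unit_vec_vnorm[OF ij(2)] by simp
  ultimately show ?thesis by simp
qed

lemma opnorm_pow_le:
  assumes A: "A \<in> carrier_mat d d"
  shows "opnorm (A ^\<^sub>m k) \<le> opnorm A ^ k"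
proof (induction k)
  case 0
  show ?case using A by (auto intro!: opnorm_le[of _ d])
next
  case (Suc k)
  have "opnorm (A ^\<^sub>m Suc k) \<le> opnorm (A ^\<^sub>m k) * opnorm A"
    using A by (simp add: opnorm_mult_le[of _ d])
  also have "\<dots> \<le> opnorm A ^ k * opnorm A" by (intro mult_right_mono Suc opnorm_nonneg[OF A])
  finally show ?case by (simp add: mult.commute)
qed

lemma pow_mat_commute:
  assumes A: "A \<in> carrier_mat d d"
  shows "A ^\<^sub>m k * A = A * A ^\<^sub>m k"
proof (induction k)
  case (Suc k)
  have "A ^\<^sub>m Suc k * A = A * A ^\<^sub>m k * A" using Suc by simp
  also have "\<dots> = A * A ^\<^sub>m Suc k" using A by (simp add: assoc_mult_square[of _ d])
  finally show ?case .
qed (use A in simp)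

lemma smult_pow_mat:
  assumes A: "A \<in> carrier_mat d d"
  shows "(z \<cdot>\<^sub>m A) ^\<^sub>m k = z ^ k \<cdot>\<^sub>m (A ^\<^sub>m k :: complex mat)"
proof (induction k)
  case (Suc k)
  have "(z \<cdot>\<^sub>m A) ^\<^sub>m Suc k = (z ^ k \<cdot>\<^sub>m A ^\<^sub>m k) * (z \<cdot>\<^sub>m A)" using Suc by simp
  also have "\<dots> = z ^ k \<cdot>\<^sub>m (z \<cdot>\<^sub>m (A ^\<^sub>m k * A))"
    using A by (simp add: mult_smult_assoc_mat[of _ d d _ d] mult_smult_distrib[of _ d d _ d])
      (auto intro!: eq_matI)
  also have "\<dots> = z ^ Suc k \<cdot>\<^sub>m (A ^\<^sub>m Suc k)"
    using A by (intro eq_matI) auto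
  finally show ?case .
qed (use A in \<open>auto intro!: eq_matI\<close>)

lemma mexp_carrier [simp]: "A \<in> carrier_mat d d \<Longrightarrow> mexp A \<in> carrier_mat d d"
  by (auto simp: mexp_def)

text \<open>A power series in \<open>z\<close> with entries of matrix powers as coefficients,
  dominated by the exponential series at \<open>opnorm A * cmod z\<close>. In this form termwise
  differentiation applies.\<close>

lemma summable_mexp:
  fixes A :: "complex mat"
  assumes A: "A \<in> carrier_mat d d" and ij: "i < d" "j < d"
  shows "summable (\<lambda>k. (A ^\<^sub>m k) $$ (i, j) / of_nat (fact k) * z ^ k)"
proof -
  have "summable (\<lambda>k. inverse (fact k) * (opnorm A * cmod z) ^ k)" by (rule summable_exp)
  moreover have "norm ((A ^\<^sub>m k) $$ (i, j) / of_nat (fact k) * z ^ k) \<le> inverse (fact k) * (opnorm A * cmod z) ^ k" for k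
  proof -
    have "cmod ((A ^\<^sub>m k) $$ (i, j)) \<le> opnorm A ^ k"
      using cmod_index_le_opnorm[of "A ^\<^sub>m k" d i j] opnorm_pow_le[OF A, of k] A ij by simp
    then have "cmod ((A ^\<^sub>m k) $$ (i, j)) * (cmod z ^ k / fact k) \<le> opnorm A ^ k * (cmod z ^ k / fact k)"
      by (intro mult_right_mono) auto
    then show ?thesis
      by (simp add: norm_mult norm_divide norm_power power_mult_distrib field_simps)
  qed
  ultimately show ?thesis by (rule summable_comparison_test'[where N = 0])
qed

lemma mexp_smult_index:
  assumes A: "A \<in> carrier_mat d d" and ij: "i < d" "j < d"
  shows "mexp (z \<cdot>\<^sub>m A) $$ (i, j) = (\<Sum>k. (A ^\<^sub>m k) $$ (i, j) / of_nat (fact k) * z ^ k)"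
proof -
  have "((z \<cdot>\<^sub>m A) ^\<^sub>m k) $$ (i, j) = z ^ k * (A ^\<^sub>m k) $$ (i, j)" for k
    using A ij by (simp add: smult_pow_mat[OF A])
  then show ?thesis using A ij by (simp add: mexp_def mult_ac)
qed

text \<open>Multiplication by \<open>A\<close> only shifts the power. The same series arises from
  multiplication on the right, which gives commutation, and from termwise differentiation, which
  gives the derivative.\<close>

lemma mexp_sums_left:
  assumes A: "A \<in> carrier_mat d d" and ij: "i < d" "j < d"
  shows "(\<lambda>k. (A ^\<^sub>m Suc k) $$ (i, j) / of_nat (fact k) * z ^ k) sums (A * mexp (z \<cdot>\<^sub>m A)) $$ (i, j)"
proof -
  have "(\<lambda>k. \<Sum>p<d. A $$ (i, p) * ((A ^\<^sub>m k) $$ (p, j) / of_nat (fact k) * z ^ k))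
      sums (\<Sum>p<d. A $$ (i, p) * mexp (z \<cdot>\<^sub>m A) $$ (p, j))"
    using ij by (intro sums_sum sums_mult) (simp only: mexp_smult_index[OF A] summable_mexp[OF A] summable_sums lessThan_iff)
  moreover have "(A ^\<^sub>m Suc k) $$ (i, j) / of_nat (fact k) * z ^ k
      = (\<Sum>p<d. A $$ (i, p) * ((A ^\<^sub>m k) $$ (p, j) / of_nat (fact k) * z ^ k))" for k
    using index_mult_mat_sum[OF A, of "A ^\<^sub>m k" d i j] A ij
    by (simp add: pow_mat_commute[OF A] sum_distrib_right sum_divide_distrib mult.assoc del: index_mult_mat(1))
  ultimately show ?thesis using index_mult_mat_sum[OF A, of "mexp (z \<cdot>\<^sub>m A)" d i j] A ij by simp
qed

lemma mexp_sums_right: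
  assumes A: "A \<in> carrier_mat d d" and ij: "i < d" "j < d"
  shows "(\<lambda>k. (A ^\<^sub>m Suc k) $$ (i, j) / of_nat (fact k) * z ^ k) sums (mexp (z \<cdot>\<^sub>m A) * A) $$ (i, j)"
proof -
  have "(\<lambda>k. \<Sum>p<d. ((A ^\<^sub>m k) $$ (i, p) / of_nat (fact k) * z ^ k) * A $$ (p, j))
      sums (\<Sum>p<d. mexp (z \<cdot>\<^sub>m A) $$ (i, p) * A $$ (p, j))"
    using ij by (intro sums_sum sums_mult2) (simp only: mexp_smult_index[OF A] summable_mexp[OF A] summable_sums lessThan_iff)
  moreover have "(A ^\<^sub>m Suc k) $$ (i, j) / of_nat (fact k) * z ^ k
      = (\<Sum>p<d. ((A ^\<^sub>m k) $$ (i, p) / of_nat (fact k) * z ^ k) * A $$ (p, j))" for k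
    using index_mult_mat_sum[OF _ A, of "A ^\<^sub>m k" d i j] A ij
    by (simp add: sum_distrib_right sum_distrib_left sum_divide_distrib mult_ac del: index_mult_mat(1))
  ultimately show ?thesis using index_mult_mat_sum[OF _ A, of "mexp (z \<cdot>\<^sub>m A)" d i j] A ij by simp
qed

lemma mexp_commute:
  assumes A: "A \<in> carrier_mat d d"
  shows "mexp (z \<cdot>\<^sub>m A) * A = A * mexp (z \<cdot>\<^sub>m A)"
proof (rule eq_matI)
  fix i j assume "i < dim_row (A * mexp (z \<cdot>\<^sub>m A))" "j < dim_col (A * mexp (z \<cdot>\<^sub>m A))"
  then have "i < d" "j < d" using A by (auto simp: mexp_def)
  then show "(mexp (z \<cdot>\<^sub>m A) * A) $$ (i, j) = (A * mexp (z \<cdot>\<^sub>m A)) $$ (i, j)"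
    using sums_unique2[OF mexp_sums_right[OF A] mexp_sums_left[OF A]] by blast
qed (use A in \<open>auto simp: mexp_def\<close>)

lemma mexp_deriv:
  assumes A: "A \<in> carrier_mat d d" and ij: "i < d" "j < d"
  shows "((\<lambda>z. mexp (z \<cdot>\<^sub>m A) $$ (i, j)) has_field_derivative (A * mexp (z \<cdot>\<^sub>m A)) $$ (i, j)) (at z)"
proof -
  define c where "c k = (A ^\<^sub>m k) $$ (i, j) / of_nat (fact k)" for k
  have "((\<lambda>z. \<Sum>k. c k * z ^ k) has_field_derivative (\<Sum>k. diffs c k * z ^ k)) (at z)"
    unfolding c_def by (intro termdiffs_strong_converges_everywhere summable_mexp[OF A ij])
  moreover have "diffs c k = (A ^\<^sub>m Suc k) $$ (i, j) / of_nat (fact k)" for k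
  proof -
    have "of_nat (Suc k) * (x / of_nat (fact (Suc k))) = x / of_nat (fact k)" for x :: complex
      unfolding fact_Suc of_nat_mult by (simp del: of_nat_Suc)
    then show ?thesis by (simp only: diffs_def c_def)
  qed
  then have "(\<Sum>k. diffs c k * z ^ k) = (A * mexp (z \<cdot>\<^sub>m A)) $$ (i, j)"
    using sums_unique[OF mexp_sums_left[OF A ij, of z]] by simp
  ultimately show ?thesis by (simp add: mexp_smult_index[OF A ij] c_def)
qed

section \<open>Gates generated by Hermitian matrices and conjugation by them\<close>

definition evo :: "complex mat \<Rightarrow> real \<Rightarrow> complex mat" where
  "evo H t = mexp ((- \<i> * complex_of_real t) \<cdot>\<^sub>m H)"

lemma evo_carrier [simp]: "H \<in> carrier_mat d d \<Longrightarrow> evo H t \<in> carrier_mat d d"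
  by (simp add: evo_def)

lemma evo_commute: "H \<in> carrier_mat d d \<Longrightarrow> evo H t * H = H * evo H t"
  unfolding evo_def by (rule mexp_commute)

lemma evo_deriv:
  assumes H: "H \<in> carrier_mat d d"
  shows "mat_has_deriv d (evo H) ((- \<i>) \<cdot>\<^sub>m (H * evo H t)) t"
proof -
  have "((\<lambda>s. evo H s $$ (i, j)) has_vector_derivative ((- \<i>) \<cdot>\<^sub>m (H * evo H t)) $$ (i, j)) (at t)"
    if ij: "i < d" "j < d" for i j
  proof -
    have "((\<lambda>s. - \<i> * complex_of_real s) has_vector_derivative - \<i> * 1) (at t)"
      by (intro has_vector_derivative_mult_right has_vector_derivative_of_real) (auto intro: derivative_eq_intros)
    from field_vector_diff_chain_at[OF this mexp_deriv[OF H ij]]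
    have "((\<lambda>s. evo H s $$ (i, j)) has_vector_derivative - \<i> * 1 * (H * evo H t) $$ (i, j)) (at t)"
      by (simp only: o_def evo_def)
    moreover have "((- \<i>) \<cdot>\<^sub>m X) $$ (i, j) = - \<i> * 1 * X $$ (i, j)" if "X \<in> carrier_mat d d" for X
      using that ij by simp
    ultimately show ?thesis using H by simp
  qed
  then show ?thesis unfolding mat_has_deriv_def using H by simp
qed

lemma evo_0:
  assumes H: "H \<in> carrier_mat d d"
  shows "evo H 0 = 1\<^sub>m d"
proof (rule eq_matI)
  fix i j assume "i < dim_row (1\<^sub>m d :: complex mat)" "j < dim_col (1\<^sub>m d :: complex mat)"
  then have ij: "i < d" "j < d" by auto
  show "evo H 0 $$ (i, j) = 1\<^sub>m d $$ (i, j)"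
    unfolding evo_def mexp_smult_index[OF H ij] using H ij
    by (simp add: powser_zero[of "\<lambda>k. (H ^\<^sub>m k) $$ (i, j) / of_nat (fact k)", simplified])
qed (use evo_carrier[OF H, of 0] in auto)

lemma mat_adjoint_smult: "mat_adjoint (c \<cdot>\<^sub>m A) = cnj c \<cdot>\<^sub>m mat_adjoint (A :: complex mat)"
  by (rule eq_matI) auto

lemma evo_adjoint_deriv:
  assumes H: "hermitian_mat d H"
  shows "mat_has_deriv d (\<lambda>s. mat_adjoint (evo H s)) (\<i> \<cdot>\<^sub>m (mat_adjoint (evo H t) * H)) t"
proof -
  have Hc: "H \<in> carrier_mat d d" "mat_adjoint H = H" using H by (auto simp: hermitian_mat_def)
  have "mat_adjoint ((- \<i>) \<cdot>\<^sub>m (H * evo H t)) = \<i> \<cdot>\<^sub>m (mat_adjoint (evo H t) * H)"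
    unfolding mat_adjoint_smult mat_adjoint_mult[OF Hc(1) evo_carrier[OF Hc(1)]] Hc(2) by simp
  then show ?thesis using mat_has_deriv_adjoint[OF evo_deriv[OF Hc(1), of t]] by simp
qed

lemma evo_adjoint_commute:
  assumes H: "hermitian_mat d H"
  shows "mat_adjoint (evo H t) * H = H * mat_adjoint (evo H t)"
proof -
  have Hc: "H \<in> carrier_mat d d" "mat_adjoint H = H" using H by (auto simp: hermitian_mat_def)
  have "mat_adjoint (H * evo H t) = mat_adjoint (evo H t * H)" by (simp add: evo_commute[OF Hc(1)])
  then show ?thesis using Hc by (simp add: mat_adjoint_mult[of _ d d _ d])
qed

lemma smult_i_diff:
  assumes "X \<in> carrier_mat d d" "Y \<in> carrier_mat d d"
  shows "\<i> \<cdot>\<^sub>m X + (- \<i>) \<cdot>\<^sub>m Y = \<i> \<cdot>\<^sub>m (X - Y)"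
  using assms by (intro eq_matI) (auto simp: algebra_simps)

text \<open>The adjoint times the gate has derivative zero in the angle and is the identity at angle
  0, hence always. For square matrices this left inverse is also a right inverse.\<close>

lemma evo_unitary:
  assumes H: "hermitian_mat d H"
  shows "unitary_mat d (evo H t)"
proof -
  have Hc: "H \<in> carrier_mat d d" using H by (auto simp: hermitian_mat_def)
  note ec = evo_carrier[OF Hc] mat_adjoint_carrier[OF evo_carrier[OF Hc]]
  have deriv0: "mat_has_deriv d (\<lambda>s. mat_adjoint (evo H s) * evo H s) (0\<^sub>m d d) s" for s
  proof (rule mat_has_deriv_cong[OF mat_has_deriv_mult[OF evo_adjoint_deriv[OF H] evo_deriv[OF Hc]]])
    let ?E = "evo H s" and ?E' = "mat_adjoint (evo H s)"
    have "\<i> \<cdot>\<^sub>m (?E' * H) * ?E = \<i> \<cdot>\<^sub>m (?E' * H * ?E)"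
      using ec Hc by (simp add: mult_smult_assoc_mat[of _ d d _ d])
    moreover have "?E' * (- \<i> \<cdot>\<^sub>m (H * ?E)) = - \<i> \<cdot>\<^sub>m (?E' * H * ?E)"
      using ec Hc by (simp add: mult_smult_distrib[of _ d d _ d] assoc_mult_square[of _ d])
    moreover have "\<i> \<cdot>\<^sub>m X + (- \<i>) \<cdot>\<^sub>m X = 0\<^sub>m d d" if "X \<in> carrier_mat d d" for X
      using that by (intro eq_matI) auto
    ultimately show "\<i> \<cdot>\<^sub>m (?E' * H) * ?E + ?E' * (- \<i> \<cdot>\<^sub>m (H * ?E)) = 0\<^sub>m d d"
      using ec Hc by simp
  qed
  have "mat_adjoint (evo H t) * evo H t = 1\<^sub>m d"
  proof (rule eq_matI)
    fix i j assume "i < dim_row (1\<^sub>m d :: complex mat)" "j < dim_col (1\<^sub>m d :: complex mat)"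
    then have ij: "i < d" "j < d" by auto
    obtain c where c: "\<And>s. (mat_adjoint (evo H s) * evo H s) $$ (i, j) = c"
      using has_vector_derivative_zero_constant[of UNIV "\<lambda>s. (mat_adjoint (evo H s) * evo H s) $$ (i, j)"]
        deriv0 ij by (auto simp: mat_has_deriv_def)
    have "mat_adjoint (evo H 0) * evo H 0 = 1\<^sub>m d"
    proof -
      have "mat_adjoint (1\<^sub>m d) = (1\<^sub>m d :: complex mat)" by (rule eq_matI) auto
      then show ?thesis by (simp add: evo_0[OF Hc])
    qed
    then show "(mat_adjoint (evo H t) * evo H t) $$ (i, j) = 1\<^sub>m d $$ (i, j)" using c[of 0] c[of t] by simp
  qed (use evo_carrier[OF Hc, of t] in auto)
  then show ?thesis
    using mat_mult_left_right_inverse[OF ec(2) ec(1)] ec unfolding unitary_mat_def by blast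
qed

text \<open>\<open>H\<close> commutes with the gate it generates, so commutators with
  \<open>H\<close> may be taken before or after that gate. This later removes the angle of a gate
  from the norm of a derivative in its own direction.\<close>

lemma comm_ad_conj:
  assumes H: "hermitian_mat d H" and Z: "Z \<in> carrier_mat d d"
  shows "comm_ad H (mat_adjoint (evo H t) * Z * evo H t) = mat_adjoint (evo H t) * comm_ad H Z * evo H t"
proof -
  have Hc: "H \<in> carrier_mat d d" using H by (auto simp: hermitian_mat_def)
  let ?E = "evo H t" and ?E' = "mat_adjoint (evo H t)"
  have ec: "?E \<in> carrier_mat d d" "?E' \<in> carrier_mat d d" using Hc by auto
  have 1: "H * (?E' * Z * ?E) = ?E' * (H * Z) * ?E"
  proof -
    have "H * (?E' * Z * ?E) = (H * ?E') * Z * ?E" using ec Hc Z by (simp add: assoc_mult_square[of _ d])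
    also have "\<dots> = (?E' * H) * Z * ?E" by (simp add: evo_adjoint_commute[OF H])
    also have "\<dots> = ?E' * (H * Z) * ?E" using ec Hc Z by (simp add: assoc_mult_square[of _ d])
    finally show ?thesis .
  qed
  have 2: "?E' * Z * ?E * H = ?E' * (Z * H) * ?E"
  proof -
    have "?E' * Z * ?E * H = ?E' * Z * (?E * H)" using ec Hc Z by (simp add: assoc_mult_square[of _ d])
    also have "\<dots> = ?E' * Z * (H * ?E)" by (simp add: evo_commute[OF Hc])
    also have "\<dots> = ?E' * (Z * H) * ?E" using ec Hc Z by (simp add: assoc_mult_square[of _ d])
    finally show ?thesis .
  qed
  have "?E' * (\<i> \<cdot>\<^sub>m (H * Z - Z * H)) * ?E = \<i> \<cdot>\<^sub>m (?E' * (H * Z - Z * H) * ?E)"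
    using ec Hc Z by (simp add: mult_smult_assoc_mat[of _ d d _ d] mult_smult_distrib[of _ d d _ d] minus_carrier_mat)
  also have "?E' * (H * Z - Z * H) * ?E = ?E' * (H * Z) * ?E - ?E' * (Z * H) * ?E"
    using ec Hc Z by (simp add: mult_minus_distrib_mat[of _ d d _ d] minus_mult_distrib_mat[of _ d d _ _ d])
  finally show ?thesis unfolding comm_ad_def 1 2 ..
qed

lemma comm_ad_power_carrier [simp]:
  "H \<in> carrier_mat d d \<Longrightarrow> X \<in> carrier_mat d d \<Longrightarrow> (comm_ad H ^^ k) X \<in> carrier_mat d d"
  by (induction k) auto

lemma comm_ad_power_conj:
  assumes H: "hermitian_mat d H" and Z: "Z \<in> carrier_mat d d"
  shows "(comm_ad H ^^ k) (mat_adjoint (evo H t) * Z * evo H t)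
    = mat_adjoint (evo H t) * (comm_ad H ^^ k) Z * evo H t"
  using H Z by (induction k) (auto simp: comm_ad_conj[of d] hermitian_mat_def)

text \<open>The Heisenberg equation: the product rule brings down \<open>H\<close> once on either
  side with opposite signs, and commuting it past the gates collects the two terms into a
  commutator.\<close>

lemma conj_evo_deriv:
  assumes H: "hermitian_mat d H" and Z: "Z \<in> carrier_mat d d"
  shows "mat_has_deriv d (\<lambda>s. mat_adjoint (evo H s) * Z * evo H s)
    (comm_ad H (mat_adjoint (evo H t) * Z * evo H t)) t"
proof -
  have Hc: "H \<in> carrier_mat d d" using H by (auto simp: hermitian_mat_def)
  let ?E = "evo H t" and ?E' = "mat_adjoint (evo H t)"
  have ec: "?E \<in> carrier_mat d d" "?E' \<in> carrier_mat d d" using Hc by auto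
  show ?thesis
  proof (rule mat_has_deriv_cong[OF mat_has_deriv_mult[OF mat_has_deriv_mult_right[OF Z evo_adjoint_deriv[OF H]] evo_deriv[OF Hc]]])
    have "\<i> \<cdot>\<^sub>m (?E' * H) * Z * ?E = \<i> \<cdot>\<^sub>m (H * (?E' * Z * ?E))"
      using ec Hc Z by (simp add: mult_smult_assoc_mat[of _ d d _ d] evo_adjoint_commute[OF H] assoc_mult_square[of _ d])
    moreover have "?E' * Z * (- \<i> \<cdot>\<^sub>m (H * ?E)) = - \<i> \<cdot>\<^sub>m (?E' * Z * ?E * H)"
      using ec Hc Z by (simp add: mult_smult_distrib[of _ d d _ d] evo_commute[OF Hc, symmetric] assoc_mult_square[of _ d])
    ultimately show "\<i> \<cdot>\<^sub>m (?E' * H) * Z * ?E + ?E' * Z * (- \<i> \<cdot>\<^sub>m (H * ?E)) = comm_ad H (?E' * Z * ?E)"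
      using smult_i_diff[of "H * (?E' * Z * ?E)" d "?E' * Z * ?E * H"] ec Hc Z
      by (simp only: comm_ad_def mult_carrier_square)
  qed
qed

subsection \<open>Heisenberg evolution and its partial derivatives\<close>

text \<open>
  The observable evolved through the first \<open>j\<close> layers, with \<open>e i\<close> commutators with the generator of
  layer \<open>i\<close> inserted after that layer; since the derivative of a layer is such a commutator, this is
  a mixed partial derivative of the evolved observable.
\<close>

primrec evolved :: "(nat \<Rightarrow> complex mat) \<Rightarrow> (nat \<Rightarrow> complex mat) \<Rightarrow> complex mat
    \<Rightarrow> (nat \<Rightarrow> nat) \<Rightarrow> (nat \<Rightarrow> real) \<Rightarrow> nat \<Rightarrow> complex mat" where
  "evolved V H Obs e \<theta> 0 = Obs"
| "evolved V H Obs e \<theta> (Suc j) = (comm_ad (H (Suc j)) ^^ e (Suc j))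
     (mat_adjoint (evo (H (Suc j)) (\<theta> (Suc j)))
       * (mat_adjoint (V (Suc j)) * evolved V H Obs e \<theta> j * V (Suc j)) * evo (H (Suc j)) (\<theta> (Suc j)))"

lemma evolved_cong:
  assumes "\<And>i. i \<in> {1..j} \<Longrightarrow> e i = e' i" "\<And>i. i \<in> {1..j} \<Longrightarrow> \<theta> i = \<theta>' i"
  shows "evolved V H Obs e \<theta> j = evolved V H Obs e' \<theta>' j"
  using assms by (induction j) auto

text \<open>\<open>foldr\<close> puts a new layer at the inner end, next to the seed
  \<open>1\<^sub>m d\<close>; associativity pulls it out as a right factor. In the Heisenberg
  picture the last layer therefore acts outermost.\<close>

lemma circU_Suc:
  assumes "\<And>l. l \<in> {1..Suc j} \<Longrightarrow> V l \<in> carrier_mat d d \<and> H l \<in> carrier_mat d d"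
  shows "circU d (Suc j) V H \<theta> = circU d j V H \<theta> * (V (Suc j) * evo (H (Suc j)) (\<theta> (Suc j)))"
    and "circU d j V H \<theta> \<in> carrier_mat d d"
proof -
  define W where "W l = V l * evo (H l) (\<theta> l)" for l
  have W: "W l \<in> carrier_mat d d" if "l \<in> {1..Suc j}" for l using assms[OF that] by (simp add: W_def)
  have circ: "circU d k V H \<theta> = foldr (\<lambda>l A. W l * A) [1..<Suc k] (1\<^sub>m d)" for k
    unfolding circU_def W_def evo_def ..
  have fold: "foldr (\<lambda>l A. W l * A) ls (1\<^sub>m d) \<in> carrier_mat d d
      \<and> foldr (\<lambda>l A. W l * A) ls B = foldr (\<lambda>l A. W l * A) ls (1\<^sub>m d) * B"
    if "set ls \<subseteq> {1..Suc j}" "B \<in> carrier_mat d d" for ls B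
    using that by (induction ls) (auto simp: W assoc_mult_square[of _ d])
  have s: "set [1..<Suc j] \<subseteq> {1..Suc j}" by auto
  show "circU d j V H \<theta> \<in> carrier_mat d d" unfolding circ using fold[OF s one_carrier_mat] by simp
  have "circU d (Suc j) V H \<theta> = foldr (\<lambda>l A. W l * A) [1..<Suc j] (W (Suc j) * 1\<^sub>m d)"
    unfolding circ by simp
  also have "\<dots> = circU d j V H \<theta> * W (Suc j)"
    unfolding circ using fold[OF s, of "W (Suc j)"] W[of "Suc j"] by simp
  finally show "circU d (Suc j) V H \<theta> = circU d j V H \<theta> * (V (Suc j) * evo (H (Suc j)) (\<theta> (Suc j)))"
    unfolding W_def .
qed

lemma mtrace_comm:
  assumes A: "A \<in> carrier_mat d d" and B: "B \<in> carrier_mat d d"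
  shows "mtrace (A * B) = mtrace (B * A)"
proof -
  have "mtrace (A * B) = (\<Sum>i<d. \<Sum>j<d. A $$ (i, j) * B $$ (j, i))"
    using A B index_mult_mat_sum[OF A B] by (simp add: mtrace_def)
  also have "\<dots> = (\<Sum>j<d. \<Sum>i<d. B $$ (j, i) * A $$ (i, j))"
    by (subst sum.swap) (simp add: mult.commute)
  also have "\<dots> = mtrace (B * A)" using A B index_mult_mat_sum[OF B A] by (simp add: mtrace_def)
  finally show ?thesis .
qed

section \<open>Measurability of matrix-valued functions\<close>

definition mat_measurable :: "nat \<Rightarrow> 'a measure \<Rightarrow> ('a \<Rightarrow> complex mat) \<Rightarrow> bool" where
  "mat_measurable d N F \<longleftrightarrow> (\<forall>x. F x \<in> carrier_mat d d) \<and>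
     (\<forall>i<d. \<forall>j<d. (\<lambda>x. F x $$ (i, j)) \<in> borel_measurable N)"

lemma mat_measurable_const: "A \<in> carrier_mat d d \<Longrightarrow> mat_measurable d N (\<lambda>_. A)"
  by (simp add: mat_measurable_def)

lemma mat_measurable_mult:
  assumes F: "mat_measurable d N F" and G: "mat_measurable d N G"
  shows "mat_measurable d N (\<lambda>x. F x * G x)"
proof -
  have c: "\<And>x. F x \<in> carrier_mat d d" "\<And>x. G x \<in> carrier_mat d d"
    using F G by (auto simp: mat_measurable_def)
  have "(\<lambda>x. (F x * G x) $$ (i, j)) \<in> borel_measurable N" if ij: "i < d" "j < d" for i j
    unfolding index_mult_mat_sum[OF c ij] using F G ij
    by (intro borel_measurable_sum borel_measurable_times) (auto simp: mat_measurable_def)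
  then show ?thesis using c by (simp add: mat_measurable_def)
qed

lemma mat_measurable_adjoint:
  assumes F: "mat_measurable d N F"
  shows "mat_measurable d N (\<lambda>x. mat_adjoint (F x))"
proof -
  have c: "F x \<in> carrier_mat d d" for x using F by (auto simp: mat_measurable_def)
  have e: "mat_adjoint (F x) $$ (i, j) = cnj (F x $$ (j, i))" if ij: "i < d" "j < d" for i j x
    using c[of x] ij by simp
  have "(\<lambda>x. mat_adjoint (F x) $$ (i, j)) \<in> borel_measurable N" if ij: "i < d" "j < d" for i j
    unfolding e[OF ij] using F ij
    by (intro borel_measurable_continuous_on[where f = cnj] continuous_intros) (auto simp: mat_measurable_def)
  then show ?thesis using c by (simp add: mat_measurable_def)
qed

lemma mat_measurable_comm_ad_power:
  assumes H: "H \<in> carrier_mat d d" and F: "mat_measurable d N F"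
  shows "mat_measurable d N (\<lambda>x. (comm_ad H ^^ k) (F x))"
proof (induction k)
  case (Suc k)
  let ?G = "\<lambda>x. (comm_ad H ^^ k) (F x)"
  have c: "?G x \<in> carrier_mat d d" for x using Suc by (auto simp: mat_measurable_def)
  have HG: "mat_measurable d N (\<lambda>x. H * ?G x)" "mat_measurable d N (\<lambda>x. ?G x * H)"
    using mat_measurable_mult[OF mat_measurable_const[OF H] Suc] mat_measurable_mult[OF Suc mat_measurable_const[OF H]] .
  have e: "comm_ad H X $$ (i, j) = \<i> * ((H * X) $$ (i, j) - (X * H) $$ (i, j))"
    if "i < d" "j < d" "X \<in> carrier_mat d d" for X i j
    using that H by (simp add: comm_ad_def del: index_mult_mat(1))
  have "(\<lambda>x. comm_ad H (?G x) $$ (i, j)) \<in> borel_measurable N" if ij: "i < d" "j < d" for i j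
    unfolding e[OF ij c] using HG ij
    by (intro borel_measurable_times borel_measurable_diff) (auto simp: mat_measurable_def)
  then show ?case using c H by (simp add: mat_measurable_def)
qed (use F in simp)

lemma mat_measurable_evo:
  assumes H: "H \<in> carrier_mat d d" and g: "g \<in> borel_measurable N"
  shows "mat_measurable d N (\<lambda>x. evo H (g x))"
proof -
  have "continuous_on UNIV (\<lambda>t. evo H t $$ (i, j))" if "i < d" "j < d" for i j
  proof (rule continuous_at_imp_continuous_on, rule ballI)
    fix t
    have "((\<lambda>s. evo H s $$ (i, j)) has_vector_derivative ((- \<i>) \<cdot>\<^sub>m (H * evo H t)) $$ (i, j)) (at t)"
      using evo_deriv[OF H, of t] that by (simp add: mat_has_deriv_def)
    then show "isCont (\<lambda>s. evo H s $$ (i, j)) t" by (rule has_vector_derivative_continuous)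
  qed
  then show ?thesis
    using H g borel_measurable_continuous_on[of "\<lambda>t. evo H t $$ (i, j)" g N for i j]
    by (auto simp: mat_measurable_def)
qed

section \<open>The circuit layer by layer: derivatives and their norms\<close>

locale circuit =
  fixes d m :: nat and \<rho> Obs :: "complex mat" and V H :: "nat \<Rightarrow> complex mat"
  assumes d_pos: "0 < d" and density: "density_op d \<rho>" and observable: "hermitian_mat d Obs"
    and V_unitary: "\<And>l. l \<in> {1..m} \<Longrightarrow> unitary_mat d (V l)"
    and H_herm: "\<And>l. l \<in> {1..m} \<Longrightarrow> hermitian_mat d (H l)"
begin

lemma carriers: "\<rho> \<in> carrier_mat d d" "Obs \<in> carrier_mat d d"
    "\<And>l. l \<in> {1..m} \<Longrightarrow> V l \<in> carrier_mat d d" "\<And>l. l \<in> {1..m} \<Longrightarrow> H l \<in> carrier_mat d d"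
  using density observable V_unitary H_herm by (auto simp: density_op_def hermitian_mat_def unitary_mat_def)

abbreviation X :: "(nat \<Rightarrow> nat) \<Rightarrow> (nat \<Rightarrow> real) \<Rightarrow> nat \<Rightarrow> complex mat" where
  "X \<equiv> evolved V H Obs"

lemma X_carrier: "j \<le> m \<Longrightarrow> X e \<theta> j \<in> carrier_mat d d"
proof (induction j)
  case (Suc j)
  then have "Suc j \<in> {1..m}" by simp
  then show ?case using Suc carriers(3,4)[of "Suc j"] by simp
qed (simp add: carriers)

text \<open>Induction over the layers: the layer that carries the angle gains one commutator with
  its generator by the Heisenberg equation, and every later layer is a fixed linear map that passes
  the derivative on.\<close>

lemma X_deriv:
  assumes "j \<le> m" "l \<in> {1..j}"
  shows "mat_has_deriv d (\<lambda>t. X e (\<theta>(l := t)) j) (X (e(l := Suc (e l))) (\<theta>(l := t)) j) t"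
  using assms
proof (induction j)
  case (Suc j)
  let ?H = "H (Suc j)" and ?V = "V (Suc j)"
  have Sj: "Suc j \<in> {1..m}" using Suc.prems by simp
  note c = carriers(3,4)[OF Sj]
  have Xc: "X e' \<theta>' j \<in> carrier_mat d d" for e' \<theta>' using Suc.prems by (intro X_carrier) simp
  show ?case
  proof (cases "l = Suc j")
    case True
    define Z where "Z = mat_adjoint ?V * X e \<theta> j * ?V"
    have Z: "Z \<in> carrier_mat d d" unfolding Z_def using c Xc by simp
    have const: "X e (\<theta>(Suc j := s)) j = X e \<theta> j" "X (e(Suc j := k)) (\<theta>(Suc j := s)) j = X e \<theta> j" for s k
      by (intro evolved_cong; simp)+
    have "mat_has_deriv d (\<lambda>s. (comm_ad ?H ^^ e (Suc j)) (mat_adjoint (evo ?H s) * Z * evo ?H s))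
      ((comm_ad ?H ^^ e (Suc j)) (comm_ad ?H (mat_adjoint (evo ?H t) * Z * evo ?H t))) t"
      by (intro mat_has_deriv_comm_ad_power c conj_evo_deriv H_herm Sj Z)
    \<comment> \<open>The new commutator appears innermost; as all of them are with the same
      generator it can be counted as the outermost one, the way \<open>evolved\<close>
      unfolds.\<close>
    then show ?thesis
      unfolding True evolved.simps const by (simp add: Z_def funpow_swap1)
  next
    case False
    then have l: "l \<in> {1..j}" using Suc.prems by auto
    have IH: "mat_has_deriv d (\<lambda>t. X e (\<theta>(l := t)) j) (X (e(l := Suc (e l))) (\<theta>(l := t)) j) t"
      by (rule Suc.IH) (use Suc.prems l in auto)
    let ?E = "evo ?H (\<theta> (Suc j))"
    have "mat_has_deriv d (\<lambda>s. (comm_ad ?H ^^ e (Suc j)) (mat_adjoint ?E * (mat_adjoint ?V * X e (\<theta>(l := s)) j * ?V) * ?E))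
      ((comm_ad ?H ^^ e (Suc j)) (mat_adjoint ?E * (mat_adjoint ?V * X (e(l := Suc (e l))) (\<theta>(l := t)) j * ?V) * ?E)) t"
      using c by (intro mat_has_deriv_comm_ad_power mat_has_deriv_mult_right mat_has_deriv_mult_left IH) auto
    moreover have "(\<theta>(l := s)) (Suc j) = \<theta> (Suc j)" "(e(l := k)) (Suc j) = e (Suc j)" for s k
      using False by auto
    ultimately show ?thesis unfolding evolved.simps by (simp only:)
  qed
qed simp

lemma heis_eq: "heis d m V H Obs \<theta> = X (\<lambda>_. 0) \<theta> m"
proof -
  have "heis d j V H Obs \<theta> = X (\<lambda>_. 0) \<theta> j" if "j \<le> m" for j
    using that
  proof (induction j)
    case 0
    have "mat_adjoint (1\<^sub>m d) = (1\<^sub>m d :: complex mat)" by (rule eq_matI) auto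
    then show ?case using carriers by (simp add: heis_def circU_def)
  next
    case (Suc j)
    have Sj: "Suc j \<in> {1..m}" using Suc.prems by simp
    note c = carriers(3,4)[OF Sj]
    let ?U = "circU d j V H \<theta>" and ?V = "V (Suc j)" and ?E = "evo (H (Suc j)) (\<theta> (Suc j))"
    have U: "?U \<in> carrier_mat d d" "circU d (Suc j) V H \<theta> = ?U * (?V * ?E)"
      using circU_Suc[of j V d H \<theta>] carriers(3,4) Suc.prems by auto
    have E: "?E \<in> carrier_mat d d" using c by simp
    have adj: "mat_adjoint (?U * (?V * ?E)) = mat_adjoint ?E * mat_adjoint ?V * mat_adjoint ?U"
      using U(1) c E by (simp add: mat_adjoint_mult[of _ d d _ d])
    have "heis d (Suc j) V H Obs \<theta> = mat_adjoint ?E * (mat_adjoint ?V * (mat_adjoint ?U * Obs * ?U) * ?V) * ?E"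
      unfolding heis_def U(2) adj using U(1) c E carriers(2) by (simp add: assoc_mult_square[of _ d])
    also have "mat_adjoint ?U * Obs * ?U = X (\<lambda>_. 0) \<theta> j" using Suc by (simp add: heis_def)
    finally show ?case by simp
  qed
  then show ?thesis by simp
qed

text \<open>The gate of the layer commutes past the commutators inserted there and is unitary, so
  the norm is blind to the angle \<open>\<theta> (Suc j)\<close>.\<close>

lemma opnorm_X_Suc:
  assumes "Suc j \<le> m"
  shows "opnorm (X e \<theta> (Suc j)) = opnorm ((comm_ad (H (Suc j)) ^^ e (Suc j)) (mat_adjoint (V (Suc j)) * X e \<theta> j * V (Suc j)))"
proof -
  have Sj: "Suc j \<in> {1..m}" using assms by simp
  let ?Z = "mat_adjoint (V (Suc j)) * X e \<theta> j * V (Suc j)"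
  have Z: "?Z \<in> carrier_mat d d" using carriers(3)[OF Sj] X_carrier[of j e \<theta>] assms by simp
  then show ?thesis
    using opnorm_conj[OF evo_unitary[OF H_herm[OF Sj]], of "(comm_ad (H (Suc j)) ^^ e (Suc j)) ?Z" "\<theta> (Suc j)"]
      carriers(4)[OF Sj] by (simp add: comm_ad_power_conj[OF H_herm[OF Sj] Z])
qed

text \<open>The offset of the indices is the point: multi-indices must agree up to
  \<open>Suc j\<close>, angles only up to \<open>j\<close>.\<close>

lemma opnorm_X_indep:
  assumes "Suc j \<le> m" "\<And>i. i \<le> Suc j \<Longrightarrow> e i = e' i" "\<And>i. i \<le> j \<Longrightarrow> \<theta> i = \<theta>' i"
  shows "opnorm (X e \<theta> (Suc j)) = opnorm (X e' \<theta>' (Suc j))"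
proof -
  have "X e \<theta> j = X e' \<theta>' j" using assms by (intro evolved_cong) auto
  then show ?thesis using assms by (simp only: opnorm_X_Suc)
qed

lemma opnorm_X_pass:
  assumes "Suc j \<le> m" "e (Suc j) = 0"
  shows "opnorm (X e \<theta> (Suc j)) = opnorm (X e \<theta> j)"
  using assms V_unitary[of "Suc j"] X_carrier[of j e \<theta>] by (simp only: opnorm_X_Suc) (simp add: opnorm_conj)

lemma opnorm_X_tail:
  assumes "j \<le> k" "k \<le> m" "\<And>i. j < i \<Longrightarrow> i \<le> k \<Longrightarrow> e i = 0"
  shows "opnorm (X e \<theta> k) = opnorm (X e \<theta> j)"
  using assms
proof (induction k rule: dec_induct)
  case (step k)
  then show ?case using opnorm_X_pass[of k e \<theta>] by simp
qed simp

lemma opnorm_comm_ad_power_le: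
  assumes l: "l \<in> {1..m}" and Y: "Y \<in> carrier_mat d d"
  shows "opnorm ((comm_ad (H l) ^^ k) Y) \<le> omega_max (H l) ^ k * opnorm Y"
proof (induction k)
  case (Suc k)
  have "opnorm ((comm_ad (H l) ^^ Suc k) Y) \<le> omega_max (H l) * opnorm ((comm_ad (H l) ^^ k) Y)"
    using opnorm_comm_ad_le[OF H_herm[OF l] d_pos] carriers(4)[OF l] Y by simp
  also have "\<dots> \<le> omega_max (H l) * (omega_max (H l) ^ k * opnorm Y)"
    by (intro mult_left_mono Suc omega_max_bounds(1)[OF H_herm[OF l] d_pos])
  finally show ?case by (simp add: mult.assoc)
qed simp

lemma opnorm_X_step_le:
  assumes j: "Suc j \<le> m"
  shows "opnorm (X e \<theta> (Suc j)) \<le> omega_max (H (Suc j)) ^ e (Suc j) * opnorm (X e \<theta> j)"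
proof -
  have Sj: "Suc j \<in> {1..m}" using j by simp
  have X: "X e \<theta> j \<in> carrier_mat d d" using j by (intro X_carrier) simp
  show ?thesis
    unfolding opnorm_X_Suc[OF j]
    using opnorm_comm_ad_power_le[OF Sj, of "mat_adjoint (V (Suc j)) * X e \<theta> j * V (Suc j)"]
      carriers(3)[OF Sj] X opnorm_conj[OF V_unitary[OF Sj] X] by simp
qed

text \<open>Counting the exponent as \<open>p + k\<close> places the \<open>p\<close> additional
  commutators outermost, where each costs one factor \<open>omega_max (H (Suc j))\<close>.\<close>

lemma opnorm_X_raise_le:
  assumes j: "Suc j \<le> m" and e: "e (Suc j) = k" and e': "e' = e(Suc j := p + k)"
  shows "opnorm (X e' \<theta> (Suc j)) \<le> omega_max (H (Suc j)) ^ p * opnorm (X e \<theta> (Suc j))"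
proof -
  have Sj: "Suc j \<in> {1..m}" using j by simp
  have X: "X e' \<theta> j = X e \<theta> j" unfolding e' by (intro evolved_cong) auto
  let ?Z = "mat_adjoint (V (Suc j)) * X e \<theta> j * V (Suc j)"
  have Z: "?Z \<in> carrier_mat d d" using carriers(3)[OF Sj] X_carrier[of j e \<theta>] j by simp
  show ?thesis
    unfolding opnorm_X_Suc[OF j] X
    using opnorm_comm_ad_power_le[OF Sj, of "(comm_ad (H (Suc j)) ^^ k) ?Z" p] carriers(4)[OF Sj] Z
    by (simp add: e e' funpow_add)
qed

lemma opnorm_X_le:
  assumes "j \<le> m"
  shows "opnorm (X e \<theta> j) \<le> (\<Prod>i\<in>{1..j}. omega_max (H i) ^ e i) * opnorm Obs"
  using assms
proof (induction j)
  case (Suc j)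
  have Sj: "Suc j \<in> {1..m}" using Suc.prems by simp
  have "opnorm (X e \<theta> (Suc j)) \<le> omega_max (H (Suc j)) ^ e (Suc j) * opnorm (X e \<theta> j)"
    by (rule opnorm_X_step_le[OF Suc.prems])
  also have "\<dots> \<le> omega_max (H (Suc j)) ^ e (Suc j) * ((\<Prod>i\<in>{1..j}. omega_max (H i) ^ e i) * opnorm Obs)"
    using Suc omega_max_bounds(1)[OF H_herm[OF Sj] d_pos] by (intro mult_left_mono) auto
  finally show ?case by (simp add: mult_ac)
qed simp

section \<open>The loss as a derivative family, and its variance\<close>

definition F :: "(nat \<Rightarrow> nat) \<Rightarrow> (nat \<Rightarrow> real) \<Rightarrow> real" where
  "F e \<theta> = Re (mtrace (\<rho> * X e \<theta> m))"

lemma abs_F_le: "\<bar>F e \<theta>\<bar> \<le> opnorm (X e \<theta> m)"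
  unfolding F_def using density_trace_le[OF density X_carrier[of m e \<theta>]] abs_Re_le_cmod order_trans by blast

lemma lossL_eq: "lossL d m V H \<rho> Obs \<theta> = F (\<lambda>_. 0) \<theta>"
proof -
  let ?U = "circU d m V H \<theta>"
  have U: "?U \<in> carrier_mat d d"
  proof (cases m)
    case (Suc k)
    then show ?thesis using circU_Suc[of k V d H \<theta>] carriers(3,4) by simp
  qed (simp add: circU_def)
  have "mtrace (?U * \<rho> * mat_adjoint ?U * Obs) = mtrace (?U * (\<rho> * mat_adjoint ?U * Obs))"
    using U carriers(1,2) by (simp add: assoc_mult_square[of _ d])
  also have "\<dots> = mtrace (\<rho> * mat_adjoint ?U * Obs * ?U)"
    using U carriers(1,2) by (intro mtrace_comm[of _ d]) auto
  also have "\<dots> = mtrace (\<rho> * heis d m V H Obs \<theta>)"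
    unfolding heis_def using U carriers(1,2) by (simp add: assoc_mult_square[of _ d])
  finally show ?thesis by (simp add: lossL_def F_def heis_eq)
qed

lemma X_measurable:
  assumes "j \<le> m"
  shows "mat_measurable d (PiM {1..m} (\<lambda>_. borel)) (\<lambda>\<theta>. X e \<theta> j)"
  using assms
proof (induction j)
  case (Suc j)
  have Sj: "Suc j \<in> {1..m}" using Suc.prems by simp
  note c = carriers(3,4)[OF Sj]
  have "(\<lambda>\<theta>. \<theta> (Suc j)) \<in> borel_measurable (PiM {1..m} (\<lambda>_. borel :: real measure))"
    using measurable_component_singleton[OF Sj] by simp
  then show ?case
    using Suc c
    by (simp, intro mat_measurable_comm_ad_power mat_measurable_mult mat_measurable_adjoint mat_measurable_evo
        mat_measurable_const) auto
qed (simp add: mat_measurable_const carriers)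

sublocale derivative_family m F
proof
  fix e :: "nat \<Rightarrow> nat" and \<theta> \<theta>' :: "nat \<Rightarrow> real"
  assume "\<And>i. i \<in> {1..m} \<Longrightarrow> \<theta> i = \<theta>' i"
  then show "F e \<theta> = F e \<theta>'" unfolding F_def using evolved_cong[of m e e \<theta> \<theta>'] by simp
next
  fix e :: "nat \<Rightarrow> nat" and \<theta> :: "nat \<Rightarrow> real" and l t assume l: "l \<in> {1..m}"
  have "mat_has_deriv d (\<lambda>t. \<rho> * X e (\<theta>(l := t)) m) (\<rho> * X (e(l := Suc (e l))) (\<theta>(l := t)) m) t"
    by (intro mat_has_deriv_mult_left carriers X_deriv l order_refl)
  then have "((\<lambda>t. \<Sum>i<d. (\<rho> * X e (\<theta>(l := t)) m) $$ (i, i)) has_vector_derivative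
      (\<Sum>i<d. (\<rho> * X (e(l := Suc (e l))) (\<theta>(l := t)) m) $$ (i, i))) (at t)"
    by (intro has_vector_derivative_sum) (auto simp: mat_has_deriv_def)
  moreover have "dim_row \<rho> = d" using carriers(1) by simp
  ultimately show "((\<lambda>t. F e (\<theta>(l := t))) has_real_derivative F (e(l := Suc (e l))) (\<theta>(l := t))) (at t)"
    unfolding F_def mtrace_def by (simp add: has_vector_derivative_complex_iff del: index_mult_mat(1))
next
  fix e :: "nat \<Rightarrow> nat"
  have "mat_measurable d (PiM {1..m} (\<lambda>_. borel)) (\<lambda>\<theta>. \<rho> * X e \<theta> m)"
    by (intro mat_measurable_mult mat_measurable_const carriers X_measurable order_refl)
  then have "(\<lambda>\<theta>. Re (\<Sum>i<d. (\<rho> * X e \<theta> m) $$ (i, i))) \<in> borel_measurable (PiM {1..m} (\<lambda>_. borel))"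
    by (intro measurable_compose[OF _ borel_measurable_Re] borel_measurable_sum) (auto simp: mat_measurable_def)
  moreover have "dim_row \<rho> = d" using carriers(1) by simp
  ultimately show "F e \<in> borel_measurable (PiM {1..m} (\<lambda>_. borel))"
    unfolding F_def mtrace_def by (simp del: index_mult_mat(1) Re_sum)
next
  fix e :: "nat \<Rightarrow> nat"
  have "\<bar>F e \<theta>\<bar> \<le> (\<Prod>i\<in>{1..m}. omega_max (H i) ^ e i) * opnorm Obs" for \<theta>
    using abs_F_le[of e \<theta>] opnorm_X_le[of m e \<theta>] by simp
  then show "\<exists>B. \<forall>\<theta>. \<bar>F e \<theta>\<bar> \<le> B" by blast
qed

lemma c_coef_eq:
  assumes l: "l \<in> {1..m}"
  shows "c_coef d m V H \<rho> Obs \<phi> l = \<bar>F (ord l 2) \<phi>\<bar>"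
proof -
  have dF: "vector_derivative (\<lambda>t. F (ord l k) (\<phi>(l := t))) (at s) = F (ord l (Suc k)) (\<phi>(l := s))" for k s
    using deriv_iter[OF l, of "\<lambda>_. 0" k \<phi> s]
    by (intro vector_derivative_at) (simp add: has_real_derivative_iff_has_vector_derivative)
  have "(\<lambda>_. 0) = ord l 0" by auto
  then have "d2 (\<lambda>t. lossL d m V H \<rho> Obs (\<phi>(l := t))) (\<phi> l) = d2 (\<lambda>t. F (ord l 0) (\<phi>(l := t))) (\<phi> l)"
    by (simp only: lossL_eq)
  also have "\<dots> = F (ord l 2) \<phi>" unfolding d2_def dF by (simp add: numeral_2_eq_2)
  finally show ?thesis by (simp add: c_coef_def)
qed

lemma mat_d2_X:
  assumes l: "l \<in> {1..m}"
  shows "mat_d2 d (\<lambda>t. X (e(l := 0)) (\<theta>(l := t)) m) s = X (e(l := 2)) (\<theta>(l := s)) m"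
proof -
  have D: "mat_has_deriv d (\<lambda>t. X (e(l := k)) (\<theta>(l := t)) m) (X (e(l := Suc k)) (\<theta>(l := t)) m) t" for k t
    using X_deriv[OF order_refl l, of "e(l := k)" \<theta> t] by simp
  show ?thesis using mat_d2_eq[OF D[of 0] D[of "Suc 0"]] by (simp add: numeral_2_eq_2)
qed

lemma omega_eff_power2:
  assumes l: "l \<in> {1..m}"
  shows "(omega_eff d m V H Obs \<phi> l)^2 = opnorm (X (ord l 2) \<phi> m)"
proof -
  have "ord l 0 = (\<lambda>_. 0)" by auto
  then have "mat_d2 d (\<lambda>t. heis d m V H Obs (\<phi>(l := t))) (\<phi> l) = X (ord l 2) \<phi> m"
    using mat_d2_X[OF l, of "\<lambda>_. 0" \<phi> "\<phi> l"] by (simp add: heis_eq)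
  then show ?thesis unfolding omega_eff_def using opnorm_nonneg[OF X_carrier[of m "ord l 2" \<phi>]] by simp
qed

lemma omega_tilde_power2:
  assumes l: "l \<in> {1..m}" and \<mu>: "\<mu> \<in> {1..m}" "\<mu> \<noteq> l"
  shows "(omega_tilde d m V H Obs \<phi> l \<mu>)^2 = opnorm (X ((ord l 2)(\<mu> := 2)) \<phi> m)"
proof -
  have ord0: "ord l 0 = (\<lambda>_. 0)" "(ord l 2)(\<mu> := 0) = ord l 2" using \<mu> by auto
  have upd: "\<phi>(\<mu> := a, l := \<phi> l) = \<phi>(\<mu> := a)" for a using \<mu> by auto
  have "mat_d2 d (\<lambda>b. heis d m V H Obs (\<phi>(\<mu> := a, l := b))) (\<phi> l) = X (ord l 2) (\<phi>(\<mu> := a)) m" for a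
    using mat_d2_X[OF l, of "\<lambda>_. 0" "\<phi>(\<mu> := a)" "\<phi> l"] by (simp only: heis_eq ord0 upd)
  then have "mat_d2 d (\<lambda>a. mat_d2 d (\<lambda>b. heis d m V H Obs (\<phi>(\<mu> := a, l := b))) (\<phi> l)) (\<phi> \<mu>)
      = X ((ord l 2)(\<mu> := 2)) \<phi> m"
    using mat_d2_X[OF \<mu>(1), of "ord l 2" \<phi> "\<phi> \<mu>"] by (simp only: ord0 fun_upd_triv)
  then show ?thesis
    unfolding omega_tilde_def using opnorm_nonneg[OF X_carrier[of m "(ord l 2)(\<mu> := 2)" \<phi>]] by simp
qed

text \<open>Layers beyond \<open>\<mu>\<close> carry no derivative and are unitary conjugations, and
  the angle of layer \<open>\<mu>\<close> itself drops out as well; only the angles below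
  \<open>\<mu>\<close> remain.\<close>

lemma opnorm_X_agree:
  assumes \<mu>: "\<mu> \<in> {1..m}" and e: "\<And>i. \<mu> < i \<Longrightarrow> i \<le> m \<Longrightarrow> e i = 0"
    and \<theta>: "\<And>i. i < \<mu> \<Longrightarrow> \<theta> i = \<phi> i"
  shows "opnorm (X e \<theta> m) = opnorm (X e \<phi> m)"
proof -
  obtain k where k: "\<mu> = Suc k" using \<mu> by (cases \<mu>) auto
  have "opnorm (X e \<theta> m) = opnorm (X e \<theta> \<mu>)" using \<mu> e by (intro opnorm_X_tail) auto
  also have "\<dots> = opnorm (X e \<phi> \<mu>)" unfolding k using \<mu> \<theta> k by (intro opnorm_X_indep) auto
  also have "\<dots> = opnorm (X e \<phi> m)" using \<mu> e by (intro opnorm_X_tail[symmetric]) auto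
  finally show ?thesis .
qed

lemma opnorm_X_ord_le:
  assumes l: "l \<in> {1..m}"
  shows "opnorm (X (ord l k) \<theta> m) \<le> omega_max (H l) ^ k * opnorm Obs"
proof -
  have "(\<Prod>i\<in>{1..m}. omega_max (H i) ^ ord l k i) = omega_max (H l) ^ k"
    using l by (subst prod.remove[of _ l]) auto
  then show ?thesis using opnorm_X_le[of m "ord l k" \<theta>] by simp
qed

lemma opnorm_X_mixed_le:
  assumes l: "l \<in> {1..m}" and \<mu>: "\<mu> \<in> {1..m}" "\<mu> \<noteq> l"
  shows "opnorm (X ((ord l 2)(\<mu> := 2)) \<theta> m) \<le> (omega_max (H l))^2 * (omega_max (H \<mu>))^2 * opnorm Obs"
proof -
  have "(\<Prod>i\<in>{1..m}. omega_max (H i) ^ ((ord l 2)(\<mu> := 2)) i)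
     = (omega_max (H l))^2 * ((omega_max (H \<mu>))^2 * (\<Prod>i\<in>{1..m} - {l} - {\<mu>}. omega_max (H i) ^ ((ord l 2)(\<mu> := 2)) i))"
    using l \<mu> by (subst prod.remove[of _ l], simp, simp, subst prod.remove[of _ \<mu>]) auto
  also have "(\<Prod>i\<in>{1..m} - {l} - {\<mu>}. omega_max (H i) ^ ((ord l 2)(\<mu> := 2)) i) = 1"
    by (intro prod.neutral) auto
  finally have P: "(\<Prod>i\<in>{1..m}. omega_max (H i) ^ ((ord l 2)(\<mu> := 2)) i)
     = (omega_max (H l))^2 * ((omega_max (H \<mu>))^2 * 1)" .
  show ?thesis using opnorm_X_le[of m "(ord l 2)(\<mu> := 2)" \<theta>] unfolding P by (simp add: mult.assoc)
qed

text \<open>Layer \<open>l\<close> is the last one differentiated, so its two commutators act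
  outermost and cost \<open>omega_max (H l)\<close> each. What is left is the derivative measured by
  \<open>omega_eff\<close>, which produces the first sum of \<open>A_coef\<close>.\<close>

lemma opnorm_X_mixed_low_le:
  assumes l: "l \<in> {1..m}" and \<mu>: "\<mu> \<in> {1..m}" "\<mu> < l"
  shows "opnorm (X ((ord l 2)(\<mu> := 2)) \<theta> m) \<le> (omega_max (H l))^2 * opnorm (X (ord \<mu> 2) \<theta> m)"
proof -
  obtain k where k: "l = Suc k" using \<mu> by (cases l) auto
  let ?e = "(ord l 2)(\<mu> := 2)"
  have e: "?e = (ord \<mu> 2)(Suc k := 2 + 0)" using \<mu> by (auto simp: k)
  have "opnorm (X ?e \<theta> m) = opnorm (X ?e \<theta> (Suc k))" using l \<mu> k by (intro opnorm_X_tail) auto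
  also have "\<dots> \<le> (omega_max (H l))^2 * opnorm (X (ord \<mu> 2) \<theta> (Suc k))"
    using l k \<mu> opnorm_X_raise_le[OF _ _ e, of \<theta>] by simp
  also have "opnorm (X (ord \<mu> 2) \<theta> (Suc k)) = opnorm (X (ord \<mu> 2) \<theta> m)"
    using l \<mu> k by (intro opnorm_X_tail[symmetric]) auto
  finally show ?thesis .
qed

theorem variance_bound:
  assumes r: "0 < r" and L: "L \<subseteq> {1..m}"
    and c: "\<And>l. l \<in> L \<Longrightarrow> A_coef d m V H Obs \<phi> l * r^2 / 6 \<le> c_coef d m V H \<rho> Obs \<phi> l"
  shows "(\<Sum>l\<in>L. r^4 / 45 * ((c_coef d m V H \<rho> Obs \<phi> l - 1/6 * A_coef d m V H Obs \<phi> l * r^2)^2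
      - beta_coef d m V H Obs \<phi> l * r^2)) \<le> variance_under (unif_cube m \<phi> r) (lossL d m V H \<rho> Obs)"
proof -
  define w where "w l = omega_max (H l)" for l
  define b where "b l = (omega_eff d m V H Obs \<phi> l)^2" for l
  \<comment> \<open>The two cases are the two sums of \<open>A_coef\<close>. For
    \<open>\<mu> < l\<close> the mixed derivative is at most \<open>(w l)^2 * b \<mu>\<close>, which
    the factor 4 covers. For \<open>\<mu> > l\<close> all angles below \<open>\<mu>\<close>, that of
    \<open>l\<close> included, are already those of \<open>\<phi>\<close>, so the norm is the one in
    \<open>omega_tilde\<close>.\<close>
  define a where "a l \<mu> = (if \<mu> < l then 4 * (w l)^2 * b \<mu> else (omega_tilde d m V H Obs \<phi> l \<mu>)^2)" for l \<mu>
  define M2 where "M2 l = (if l = 1 then b 1 else (w l)^2 * opnorm Obs)" for l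
  define M4 where "M4 l = (if l = 1 then (w 1)^2 * b 1 else (w l)^4 * opnorm Obs)" for l
  have w0: "0 \<le> w l" if "l \<in> {1..m}" for l
    unfolding w_def using omega_max_bounds(1)[OF H_herm[OF that] d_pos] .
  have A: "(\<Sum>\<mu>\<in>{1..m} - {l}. a l \<mu>) = A_coef d m V H Obs \<phi> l" if l: "l \<in> {1..m}" for l
  proof -
    have "{1..m} - {l} = {1..<l} \<union> {l<..m}" using l by auto
    then have "(\<Sum>\<mu>\<in>{1..m} - {l}. a l \<mu>) = (\<Sum>\<mu>\<in>{1..<l}. a l \<mu>) + (\<Sum>\<mu>\<in>{l<..m}. a l \<mu>)"
      using sum.union_disjoint[of "{1..<l}" "{l<..m}" "a l"] by (simp only:) force
    also have "(\<Sum>\<mu>\<in>{1..<l}. a l \<mu>) = 4 * (w l)^2 * (\<Sum>\<mu>\<in>{1..<l}. b \<mu>)"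
      by (simp add: a_def sum_distrib_left)
    also have "(\<Sum>\<mu>\<in>{l<..m}. a l \<mu>) = (\<Sum>\<mu>\<in>{l<..m}. (omega_tilde d m V H Obs \<phi> l \<mu>)^2)"
      by (intro sum.cong) (auto simp: a_def)
    finally show ?thesis by (simp add: A_coef_def w_def b_def)
  qed
  have first: "opnorm (X (ord 1 2) \<theta> m) = b 1" if "1 \<in> {1..m}" for \<theta>
  proof -
    have X2: "opnorm (X (ord 1 2) \<theta> m) = opnorm (X (ord 1 2) \<phi>' m)" if "\<phi>' 0 = \<theta> 0" for \<phi>'
      using \<open>1 \<in> {1..m}\<close> that by (intro opnorm_X_agree[of 1]) auto
    \<comment> \<open>\<open>opnorm_X_agree\<close> asks for agreement at every index below 1, that
      is at 0, which is no layer; the value there is patched.\<close>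
    have "X (ord 1 2) (\<phi>(0 := \<theta> 0)) m = X (ord 1 2) \<phi> m" by (intro evolved_cong) auto
    then show ?thesis using X2[of "\<phi>(0 := \<theta> 0)"] omega_eff_power2[OF that] by (simp add: b_def)
  qed
  have main: "(\<Sum>l\<in>L. r^4 / 45 * ((\<bar>F (ord l 2) \<phi>\<bar> - (\<Sum>\<mu>\<in>{1..m} - {l}. a l \<mu>) * r^2 / 6)^2
      - M2 l * M4 l / 4 * r^2)) \<le> variance_under (unif_cube m \<phi> r) (F (\<lambda>_. 0))"
  proof (rule variance_lower_bound[OF r L])
    fix l \<theta> assume "l \<in> L"
    then have l: "l \<in> {1..m}" using L by auto
    show "\<bar>F (ord l 2) \<theta>\<bar> \<le> M2 l"
    proof (cases "l = 1")
      case True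
      then show ?thesis using abs_F_le[of "ord l 2" \<theta>] first[of \<theta>] l by (simp add: M2_def)
    next
      case False
      then show ?thesis
        using abs_F_le[of "ord l 2" \<theta>] opnorm_X_ord_le[OF l, of 2 \<theta>] by (simp add: M2_def w_def)
    qed
    show "\<bar>F (ord l 4) \<theta>\<bar> \<le> M4 l"
    proof (cases "l = 1")
      case True
      \<comment> \<open>The fourth derivative is two more commutators on top of the second, whose
        norm at layer 1 is the same at all points.\<close>
      have e: "ord 1 4 = (ord 1 2)(Suc 0 := 2 + 2)" by auto
      have "opnorm (X (ord 1 4) \<theta> m) = opnorm (X (ord 1 4) \<theta> (Suc 0))"
        using l by (intro opnorm_X_tail) auto
      also have "\<dots> \<le> (w 1)^2 * opnorm (X (ord 1 2) \<theta> (Suc 0))"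
        using l opnorm_X_raise_le[OF _ _ e, of \<theta>] by (simp add: w_def)
      also have "opnorm (X (ord 1 2) \<theta> (Suc 0)) = opnorm (X (ord 1 2) \<theta> m)"
        using l by (intro opnorm_X_tail[symmetric]) auto
      also have "\<dots> = b 1" using l True by (intro first) simp
      finally have "opnorm (X (ord 1 4) \<theta> m) \<le> (w 1)^2 * b 1" .
      moreover have "M4 1 = (w 1)^2 * b 1" by (simp add: M4_def)
      ultimately show ?thesis unfolding True using abs_F_le[of "ord 1 4" \<theta>] by linarith
    next
      case False
      then show ?thesis
        using abs_F_le[of "ord l 4" \<theta>] opnorm_X_ord_le[OF l, of 4 \<theta>] by (simp add: M4_def w_def)
    qed
  next
    fix l \<mu> \<theta> assume "l \<in> L" and \<mu>: "\<mu> \<in> {1..m} - {l}" and \<theta>: "\<And>i. i < \<mu> \<Longrightarrow> \<theta> i = \<phi> i" "\<theta> l = \<phi> l"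
    then have l: "l \<in> {1..m}" using L by auto
    let ?e = "(ord l 2)(\<mu> := 2)"
    show "\<bar>F ?e \<theta>\<bar> \<le> a l \<mu>"
    proof (cases "\<mu> < l")
      case True
      have "opnorm (X ?e \<theta> m) \<le> (w l)^2 * opnorm (X (ord \<mu> 2) \<theta> m)"
        unfolding w_def using l \<mu> True by (intro opnorm_X_mixed_low_le) auto
      also have "opnorm (X (ord \<mu> 2) \<theta> m) = opnorm (X (ord \<mu> 2) \<phi> m)"
        using \<mu> \<theta> by (intro opnorm_X_agree[of \<mu>]) auto
      also have "\<dots> = b \<mu>" using \<mu> omega_eff_power2[of \<mu>] by (simp add: b_def)
      finally have "\<bar>F ?e \<theta>\<bar> \<le> (w l)^2 * b \<mu>" using abs_F_le[of ?e \<theta>] by linarith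
      moreover have "0 \<le> (w l)^2 * b \<mu>" by (simp add: b_def)
      ultimately show ?thesis using True by (simp add: a_def)
    next
      case False
      then have "l < \<mu>" using \<mu> by auto
      have "opnorm (X ?e \<theta> m) = opnorm (X ?e \<phi> m)"
        using \<mu> \<theta> \<open>l < \<mu>\<close> by (intro opnorm_X_agree[of \<mu>]) auto
      then show ?thesis
        using abs_F_le[of ?e \<theta>] omega_tilde_power2[OF l, of \<mu>] \<mu> False by (simp add: a_def)
    qed
  next
    fix l assume lL: "l \<in> L"
    then have l: "l \<in> {1..m}" using L by auto
    show "(\<Sum>\<mu>\<in>{1..m} - {l}. a l \<mu>) * r^2 / 6 \<le> \<bar>F (ord l 2) \<phi>\<bar>"
      unfolding A[OF l] c_coef_eq[OF l, symmetric] by (rule c[OF lL])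
  qed
  have "r^4 / 45 * ((c_coef d m V H \<rho> Obs \<phi> l - 1/6 * A_coef d m V H Obs \<phi> l * r^2)^2
      - beta_coef d m V H Obs \<phi> l * r^2)
    \<le> r^4 / 45 * ((\<bar>F (ord l 2) \<phi>\<bar> - (\<Sum>\<mu>\<in>{1..m} - {l}. a l \<mu>) * r^2 / 6)^2 - M2 l * M4 l / 4 * r^2)"
    if "l \<in> L" for l
  proof -
    have l: "l \<in> {1..m}" using that L by auto
    \<comment> \<open>The product has the shape of \<open>beta_coef\<close> with the constant
      \<open>1/4\<close>, which lies below both \<open>2/3\<close> and \<open>32/3\<close>.\<close>
    have "M2 l * M4 l / 4 \<le> beta_coef d m V H Obs \<phi> l"
    proof (cases "l = 1")
      case True
      have "M2 l * M4 l / 4 = (w 1)^2 * (b 1)^2 / 4"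
        using True by (simp add: M2_def M4_def power2_eq_square)
      moreover have "beta_coef d m V H Obs \<phi> l = 2/3 * ((w 1)^2 * (b 1)^2)"
        using True by (simp add: beta_coef_def w_def b_def flip: power_mult)
      moreover have "0 \<le> (w 1)^2 * (b 1)^2" by simp
      ultimately show ?thesis by linarith
    next
      case False
      have "M2 l * M4 l / 4 = (w l)^6 * (opnorm Obs)^2 / 4"
        using False by (simp add: M2_def M4_def power2_eq_square eval_nat_numeral)
      moreover have "beta_coef d m V H Obs \<phi> l = 32/3 * ((w l)^6 * (opnorm Obs)^2)"
        using False by (simp add: beta_coef_def w_def)
      moreover have "0 \<le> (w l)^6 * (opnorm Obs)^2" using w0[OF l] by simp
      ultimately show ?thesis by linarith
    qed
    then have "M2 l * M4 l / 4 * r^2 \<le> beta_coef d m V H Obs \<phi> l * r^2" by (rule mult_right_mono) simp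
    then show ?thesis unfolding A[OF l] c_coef_eq[OF l] by (intro mult_left_mono) auto
  qed
  then have "(\<Sum>l\<in>L. r^4 / 45 * ((c_coef d m V H \<rho> Obs \<phi> l - 1/6 * A_coef d m V H Obs \<phi> l * r^2)^2
      - beta_coef d m V H Obs \<phi> l * r^2)) \<le> variance_under (unif_cube m \<phi> r) (F (\<lambda>_. 0))"
    using main by (meson order_trans sum_mono)
  moreover have "lossL d m V H \<rho> Obs = F (\<lambda>_. 0)" by (rule ext) (rule lossL_eq)
  ultimately show ?thesis by simp
qed

section \<open>Size of the coefficients and admissible radii\<close>

lemma A_coef_nonneg: "0 \<le> A_coef d m V H Obs \<phi> l"
  unfolding A_coef_def by (intro add_nonneg_nonneg mult_nonneg_nonneg sum_nonneg) auto

lemma beta_coef_nonneg: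
  assumes "l \<in> {1..m}"
  shows "0 \<le> beta_coef d m V H Obs \<phi> l"
  using omega_max_bounds(1)[OF H_herm[OF assms] d_pos] unfolding beta_coef_def by auto

text \<open>Everything follows from \<open>omega_max\<close> being at most \<open>2 * K\<close>. The
  terms of the first sum are at most \<open>4 * (2 * K)^2 * 4 * K^3 = 64 * K^5\<close>; those of the
  second are at most \<open>16 * K^5\<close> and are rounded up so that both sums merge. The number
  683 is \<open>32/3 * 64\<close> rounded up.\<close>

lemma coef_bounds:
  assumes K: "opnorm Obs \<le> K" "\<And>j. j \<in> {1..m} \<Longrightarrow> opnorm (H j) \<le> K" and l: "l \<in> {1..m}"
  shows "A_coef d m V H Obs \<phi> l \<le> 64 * K^5 * real m" "beta_coef d m V H Obs \<phi> l \<le> 683 * K^8"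
proof -
  have O0: "0 \<le> opnorm Obs" by (rule opnorm_nonneg[OF carriers(2)])
  have K0: "0 \<le> K" using O0 K(1) by linarith
  have w: "0 \<le> omega_max (H j)" "omega_max (H j) \<le> 2 * K" if "j \<in> {1..m}" for j
    using omega_max_bounds[OF H_herm[OF that] d_pos] K(2)[OF that] by auto
  have wp: "omega_max (H j) ^ k \<le> (2 * K) ^ k" if "j \<in> {1..m}" for j k
    by (intro power_mono w that)
  have eff: "(omega_eff d m V H Obs \<phi> j)^2 \<le> 4 * K^3" if j: "j \<in> {1..m}" for j
  proof -
    have "(omega_eff d m V H Obs \<phi> j)^2 \<le> (omega_max (H j))^2 * opnorm Obs"
      unfolding omega_eff_power2[OF j] by (rule opnorm_X_ord_le[OF j])
    also have "\<dots> \<le> (2 * K)^2 * K" using wp[OF j, of 2] K O0 K0 by (intro mult_mono) auto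
    finally show ?thesis by (simp add: power2_eq_square power3_eq_cube)
  qed
  have til: "(omega_tilde d m V H Obs \<phi> l j)^2 \<le> 64 * K^5" if j: "j \<in> {1..m}" "j \<noteq> l" for j
  proof -
    have "(omega_tilde d m V H Obs \<phi> l j)^2 \<le> (omega_max (H l))^2 * (omega_max (H j))^2 * opnorm Obs"
      unfolding omega_tilde_power2[OF l j] by (rule opnorm_X_mixed_le[OF l j])
    also have "\<dots> \<le> (2 * K)^2 * (2 * K)^2 * K"
      using wp[OF j(1), of 2] wp[OF l, of 2] K O0 K0 by (intro mult_mono) auto
    also have "\<dots> = 16 * K^5" by (simp add: eval_nat_numeral)
    also have "\<dots> \<le> 64 * K^5" using K0 by simp
    finally show ?thesis .
  qed
  have "4 * (omega_max (H l))^2 * (\<Sum>\<mu>\<in>{1..<l}. (omega_eff d m V H Obs \<phi> \<mu>)^2)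
      \<le> 4 * (2 * K)^2 * (\<Sum>\<mu>\<in>{1..<l}. 4 * K^3)"
    using l K0 by (intro mult_mono sum_mono eff wp sum_nonneg) auto
  also have "\<dots> = 64 * K^5 * real (l - 1)" by (simp add: eval_nat_numeral)
  finally have 1: "4 * (omega_max (H l))^2 * (\<Sum>\<mu>\<in>{1..<l}. (omega_eff d m V H Obs \<phi> \<mu>)^2) \<le> 64 * K^5 * real (l - 1)" .
  have "(\<Sum>\<mu>\<in>{l<..m}. (omega_tilde d m V H Obs \<phi> l \<mu>)^2) \<le> (\<Sum>\<mu>\<in>{l<..m}. 64 * K^5)"
    using l by (intro sum_mono til) auto
  also have "\<dots> = 64 * K^5 * real (m - l)" by simp
  finally have "A_coef d m V H Obs \<phi> l \<le> 64 * K^5 * real (l - 1) + 64 * K^5 * real (m - l)"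
    using 1 unfolding A_coef_def by linarith
  also have "\<dots> = 64 * K^5 * real (m - 1)" using l by (simp add: of_nat_diff algebra_simps)
  also have "\<dots> \<le> 64 * K^5 * real m" using K0 by (intro mult_left_mono) auto
  finally show "A_coef d m V H Obs \<phi> l \<le> 64 * K^5 * real m" .
  show "beta_coef d m V H Obs \<phi> l \<le> 683 * K^8"
  proof (cases "l = 1")
    case True
    have "((omega_eff d m V H Obs \<phi> 1)^2)^2 \<le> (4 * K^3)^2"
      using eff[of 1] l True by (intro power_mono) auto
    then have "(omega_max (H 1))^2 * ((omega_eff d m V H Obs \<phi> 1)^2)^2 \<le> (2 * K)^2 * (4 * K^3)^2"
      using l True wp[OF l, of 2] by (intro mult_mono) auto
    also have "\<dots> = 64 * K^8" by (simp add: eval_nat_numeral)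
    finally have "(omega_max (H 1))^2 * (omega_eff d m V H Obs \<phi> 1)^4 \<le> 64 * K^8" by (simp flip: power_mult)
    moreover have "beta_coef d m V H Obs \<phi> l = 2/3 * ((omega_max (H 1))^2 * (omega_eff d m V H Obs \<phi> 1)^4)"
      using True by (simp add: beta_coef_def)
    moreover have "0 \<le> K^8" using K0 by simp
    ultimately show ?thesis by linarith
  next
    case False
    have "(omega_max (H l))^6 * (opnorm Obs)^2 \<le> (2 * K)^6 * K^2"
      using K O0 K0 by (intro mult_mono wp l power_mono) auto
    also have "\<dots> = 64 * K^8" by (simp add: eval_nat_numeral)
    finally have "(omega_max (H l))^6 * (opnorm Obs)^2 \<le> 64 * K^8" .
    moreover have "beta_coef d m V H Obs \<phi> l = 32/3 * ((omega_max (H l))^6 * (opnorm Obs)^2)"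
      using False by (simp add: beta_coef_def)
    moreover have "0 \<le> K^8" using K0 by simp
    ultimately show ?thesis by linarith
  qed
qed

end

lemma qinstance_circuit: "qinstance n m \<rho> Obs V H \<Longrightarrow> circuit (2 ^ n) m \<rho> Obs V H"
  by unfold_locales (auto simp: qinstance_def)

text \<open>Positivity of \<open>r\<close> excludes the default value 0 of a division by zero and
  then forces \<open>0 < c\<close>. Dropping the term with \<open>\<beta>\<close> and cancelling
  \<open>c\<close> leaves \<open>8 * (A * r^2) \<le> 9 * c\<close>, more than the second conclusion
  asks for.\<close>

lemma patch_radius:
  fixes c A \<beta> r :: real
  assumes c: "0 \<le> c" and A: "0 \<le> A" and \<beta>: "0 \<le> \<beta>" and r: "0 < r"
    and patch: "r^2 \<le> 9 * c^2 / (8 * c * A + 24 * \<beta>)"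
  shows "8 * c * A * r^2 + 24 * \<beta> * r^2 \<le> 9 * c^2" "A * r^2 / 6 \<le> c"
proof -
  define D where "D = 8 * c * A + 24 * \<beta>"
  have r2: "0 < r^2" using r by simp
  have "D \<noteq> 0" using patch r2 by (auto simp: D_def)
  moreover have "0 \<le> D" using c A \<beta> by (simp add: D_def)
  ultimately have D: "0 < D" by simp
  then have rD: "r^2 * D \<le> 9 * c^2" using patch by (simp add: D_def[symmetric] le_divide_eq)
  then show 1: "8 * c * A * r^2 + 24 * \<beta> * r^2 \<le> 9 * c^2" by (simp add: D_def algebra_simps)
  have "0 < r^2 * D" using r2 D by simp
  then have "0 < 9 * c^2" using rD by linarith
  then have c0: "0 < c" using c by (cases "c = 0") auto
  have "0 \<le> 24 * \<beta> * r^2" using \<beta> by simp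
  then have "c * (8 * (A * r^2)) \<le> c * (9 * c)" using 1 by (simp add: power2_eq_square algebra_simps)
  then have "8 * (A * r^2) \<le> 9 * c" using c0 by simp
  then show "A * r^2 / 6 \<le> c" using c by linarith
qed

lemma variance_under_nonneg: "0 \<le> variance_under M f"
  by (simp add: variance_under_def)

text \<open>The radius makes \<open>A * r^2 \<le> 1 / (64 * K^5) \<le> 1 / K \<le> c\<close> and, as
  \<open>683/4096\<close> is below \<open>1/4\<close>, also
  \<open>\<beta> * r^2 \<le> c^2 / 4\<close>. The bracket then keeps at least
  \<open>(5/6)^2 - 1/4\<close> of \<open>c^2\<close>, which exceeds \<open>5/16\<close>, and
  \<open>5/16\<close> divided by 45 is \<open>1/144\<close>.\<close>

lemma poly_radius_bound:
  fixes K c A \<beta> M r :: real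
  assumes K: "1 \<le> K" and M: "1 \<le> M" and c: "1 / K \<le> c"
    and A: "A \<le> 64 * K^5 * M" and \<beta>: "\<beta> \<le> 683 * K^8"
    and r: "r = 1 / (64 * K^5 * sqrt M)"
  shows "A * r^2 / 6 \<le> c"
    and "1 / (144 * K^2 * (64 * K^5)^4 * M^2) \<le> r^4 / 45 * ((c - 1/6 * A * r^2)^2 - \<beta> * r^2)"
proof -
  have K0: "0 < K" using K by simp
  have r2: "r^2 = 1 / (4096 * K^10 * M)"
    using M by (simp add: r power_divide power_mult_distrib flip: power_mult)
  have r4: "r^4 = 1 / ((64 * K^5)^4 * M^2)"
  proof -
    have "(sqrt M)^4 = ((sqrt M)^2)^2" by (simp flip: power_mult)
    then have "(sqrt M)^4 = M^2" using M by simp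
    then show ?thesis by (simp add: r power_divide power_mult_distrib)
  qed
  have "0 < 1 / K" using K0 by simp
  then have c0: "0 < c" using c by linarith
  have K5: "K \<le> K^5" using power_increasing[of 1 5 K] K by simp
  have "A * r^2 \<le> 64 * K^5 * M * r^2" by (intro mult_right_mono A) simp
  also have "\<dots> = 1 / (64 * K^5)"
  proof -
    have "K^10 = K^5 * K^5" by (simp flip: power_add)
    then show ?thesis unfolding r2 using K0 M by (simp add: field_simps)
  qed
  also have "\<dots> \<le> 1 / (1 * K)" using K5 K0 by (intro divide_left_mono mult_mono) auto
  also have "\<dots> \<le> c" using c by simp
  finally have A1: "A * r^2 \<le> c" .
  then show "A * r^2 / 6 \<le> c" using c0 by linarith
  have "\<beta> * r^2 \<le> 683 * K^8 * r^2" by (intro mult_right_mono \<beta>) simp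
  also have "\<dots> = 683 / 4096 * (1 / (K^2 * M))"
  proof -
    have "K^10 = K^8 * K^2" by (simp flip: power_add)
    then show ?thesis unfolding r2 using K0 M by (simp add: field_simps)
  qed
  also have "\<dots> \<le> 1 / 4 * (1 / (K^2 * 1))"
    using K0 M by (intro mult_mono divide_left_mono mult_left_mono) auto
  also have "1 / (K^2 * 1) = (1 / K)^2" by (simp add: power_divide)
  also have "1 / 4 * (1 / K)^2 \<le> 1 / 4 * c^2" using c K0 by (intro mult_left_mono power_mono) auto
  finally have \<beta>1: "\<beta> * r^2 \<le> c^2 / 4" by simp
  have "(5 / 6 * c)^2 \<le> (c - 1/6 * A * r^2)^2" using A1 c0 by (intro power_mono) auto
  moreover have "(5 / 6 * c)^2 = 25 / 36 * c^2" by (simp add: power_mult_distrib power_divide)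
  ultimately have "5 / 16 * c^2 \<le> (c - 1/6 * A * r^2)^2 - \<beta> * r^2"
    using \<beta>1 zero_le_power2[of c] by linarith
  moreover have "5 / 16 * (1 / K)^2 \<le> 5 / 16 * c^2" using c K0 by (intro mult_left_mono power_mono) auto
  ultimately have "5 / 16 * (1 / K)^2 \<le> (c - 1/6 * A * r^2)^2 - \<beta> * r^2" by linarith
  then have "r^4 / 45 * (5 / 16 * (1 / K)^2) \<le> r^4 / 45 * ((c - 1/6 * A * r^2)^2 - \<beta> * r^2)"
    by (intro mult_left_mono) auto
  moreover have "r^4 / 45 * (5 / 16 * (1 / K)^2) = 1 / (144 * K^2 * (64 * K^5)^4 * M^2)"
    unfolding r4 by (simp add: power_divide)
  ultimately show "1 / (144 * K^2 * (64 * K^5)^4 * M^2) \<le> r^4 / 45 * ((c - 1/6 * A * r^2)^2 - \<beta> * r^2)"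
    by simp
qed

theorem theorem3:
  fixes n m :: nat and \<rho> Obs :: "complex mat" and V H :: "nat \<Rightarrow> complex mat"
    and \<phi> :: "nat \<Rightarrow> real" and \<Lambda> :: "nat set"
  assumes inst: "qinstance n m \<rho> Obs V H"
    and \<Lambda>_sub: "\<Lambda> \<subseteq> {1..m}" and \<Lambda>_ne: "\<Lambda> \<noteq> {}"
  shows
   "(\<forall>r::real. 0 < r \<and> r^2 \<le> rpatch2 (2^n) m V H \<rho> Obs \<phi> \<Lambda> \<longrightarrow>
       variance_under (unif_cube m \<phi> r) (lossL (2^n) m V H \<rho> Obs)
       \<ge> (\<Sum>l\<in>\<Lambda>. r^4 / 45 *
             ((c_coef (2^n) m V H \<rho> Obs \<phi> l - 1/6 * A_coef (2^n) m V H Obs \<phi> l * r^2)^2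
              - beta_coef (2^n) m V H Obs \<phi> l * r^2)))
    \<and> variance_under (unif_cube m \<phi> (sqrt (rpatch2 (2^n) m V H \<rho> Obs \<phi> \<Lambda>))) (lossL (2^n) m V H \<rho> Obs)
       \<ge> 1/72 * (\<Sum>l\<in>\<Lambda>. (c_coef (2^n) m V H \<rho> Obs \<phi> l)^2)
             * (sqrt (rpatch2 (2^n) m V H \<rho> Obs \<phi> \<Lambda>))^4
    \<and> (\<forall>(mm :: nat \<Rightarrow> nat) (\<rho>s :: nat \<Rightarrow> complex mat) (Os :: nat \<Rightarrow> complex mat)
         (Vs :: nat \<Rightarrow> nat \<Rightarrow> complex mat) (Hs :: nat \<Rightarrow> nat \<Rightarrow> complex mat)
         (\<phi>s :: nat \<Rightarrow> nat \<Rightarrow> real) (\<Lambda>s :: nat \<Rightarrow> nat set) (q :: nat \<Rightarrow> nat) (C :: real) (k :: nat).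
         (\<forall>N. qinstance N (mm N) (\<rho>s N) (Os N) (Vs N) (Hs N)
               \<and> \<Lambda>s N \<subseteq> {1..mm N} \<and> q N \<in> \<Lambda>s N)
         \<and> 0 < C
         \<and> (\<forall>\<^sub>F N in sequentially. opnorm (Os N) \<le> C * (real N + 1)^k)
         \<and> (\<forall>\<^sub>F N in sequentially. \<forall>j\<in>{1..mm N}. opnorm (Hs N j) \<le> C * (real N + 1)^k)
         \<and> (\<forall>\<^sub>F N in sequentially.
               c_coef (2^N) (mm N) (Vs N) (Hs N) (\<rho>s N) (Os N) (\<phi>s N) (q N) \<ge> 1 / (C * (real N + 1)^k))
       \<longrightarrow> (\<exists>(a::real) (b::nat). 0 < a \<and>
             (\<exists>(C'::real) (k'::nat). 0 < C' \<and>
               (\<forall>\<^sub>F N in sequentially.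
                  variance_under
                    (unif_cube (mm N) (\<phi>s N) (1 / (a * (real N + 1)^b * sqrt (real (mm N)))))
                    (lossL (2^N) (mm N) (Vs N) (Hs N) (\<rho>s N) (Os N))
                  \<ge> 1 / (C' * (real N + 1)^k' * (real (mm N))^2)))))"
proof (intro conjI)
  interpret circuit "2 ^ n" m \<rho> Obs V H using inst by (rule qinstance_circuit)
  let ?c = "c_coef (2^n) m V H \<rho> Obs \<phi>" and ?A = "A_coef (2^n) m V H Obs \<phi>"
    and ?b = "beta_coef (2^n) m V H Obs \<phi>" and ?R = "rpatch2 (2^n) m V H \<rho> Obs \<phi> \<Lambda>"
  have fin: "finite \<Lambda>" using \<Lambda>_sub finite_subset by blast
  have c0: "0 \<le> ?c l" for l by (simp add: c_coef_def)
  have R_le: "?R \<le> 9 * (?c l)^2 / (8 * ?c l * ?A l + 24 * ?b l)" if "l \<in> \<Lambda>" for l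
    unfolding rpatch2_def using fin that by (intro Min_le) auto
  have patch: "8 * ?c l * ?A l * r^2 + 24 * ?b l * r^2 \<le> 9 * (?c l)^2" "?A l * r^2 / 6 \<le> ?c l"
    if "0 < r" "r^2 \<le> ?R" "l \<in> \<Lambda>" for r l
    using patch_radius[of "?c l" "?A l" "?b l" r] c0 A_coef_nonneg beta_coef_nonneg[of l] R_le[OF that(3)] that \<Lambda>_sub
    by (auto simp: subset_iff)
  have bound: "(\<Sum>l\<in>\<Lambda>. r^4 / 45 * ((?c l - 1/6 * ?A l * r^2)^2 - ?b l * r^2))
      \<le> variance_under (unif_cube m \<phi> r) (lossL (2^n) m V H \<rho> Obs)" if "0 < r" "r^2 \<le> ?R" for r
    by (rule variance_bound[OF that(1) \<Lambda>_sub patch(2)[OF that]])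
  then show "\<forall>r::real. 0 < r \<and> r^2 \<le> ?R \<longrightarrow>
       variance_under (unif_cube m \<phi> r) (lossL (2^n) m V H \<rho> Obs)
       \<ge> (\<Sum>l\<in>\<Lambda>. r^4 / 45 * ((?c l - 1/6 * ?A l * r^2)^2 - ?b l * r^2))"
    by blast
  show "variance_under (unif_cube m \<phi> (sqrt ?R)) (lossL (2^n) m V H \<rho> Obs)
       \<ge> 1/72 * (\<Sum>l\<in>\<Lambda>. (?c l)^2) * (sqrt ?R)^4"
  \<comment> \<open>\<open>?R\<close> can be 0, through a vanishing coefficient or through a zero
    denominator, whose quotient is 0 by convention. The claim then reduces to nonnegativity of the
    variance.\<close>
  proof (cases "0 < ?R")
    case True
    define r where "r = sqrt ?R"
    have r: "0 < r" "r^2 \<le> ?R" using True by (auto simp: r_def)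
    \<comment> \<open>\<open>1/72\<close> is \<open>5/8\<close> of \<open>1/45\<close>: the patch
      condition divided by 24 limits the losses to \<open>3/8\<close> of the squared
      coefficient.\<close>
    have "1/72 * (\<Sum>l\<in>\<Lambda>. (?c l)^2) * r^4 = (\<Sum>l\<in>\<Lambda>. r^4 / 45 * (5/8 * (?c l)^2))"
      by (simp add: sum_distrib_left sum_distrib_right mult_ac)
    also have "\<dots> \<le> (\<Sum>l\<in>\<Lambda>. r^4 / 45 * ((?c l - 1/6 * ?A l * r^2)^2 - ?b l * r^2))"
    proof (intro sum_mono mult_left_mono)
      fix l assume "l \<in> \<Lambda>"
      from patch(1)[OF r this]
      have "?c l * (?A l * r^2) / 3 + ?b l * r^2 \<le> 3/8 * (?c l)^2" by (simp add: field_simps)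
      moreover have "(?c l - 1/6 * ?A l * r^2)^2 = (?c l)^2 - ?c l * (?A l * r^2) / 3 + (1/6 * ?A l * r^2)^2"
        by (simp add: power2_diff)
      ultimately show "5/8 * (?c l)^2 \<le> (?c l - 1/6 * ?A l * r^2)^2 - ?b l * r^2"
        using zero_le_power2[of "1/6 * ?A l * r^2"] by linarith
    qed simp
    also have "\<dots> \<le> variance_under (unif_cube m \<phi> r) (lossL (2^n) m V H \<rho> Obs)" by (rule bound[OF r])
    finally show ?thesis by (simp add: r_def)
  next
    case False
    have "?R \<in> (\<lambda>l. 9 * (?c l)^2 / (8 * ?c l * ?A l + 24 * ?b l)) ` \<Lambda>"
      unfolding rpatch2_def using fin \<Lambda>_ne by (intro Min_in) auto
    then obtain l where l: "l \<in> \<Lambda>" "?R = 9 * (?c l)^2 / (8 * ?c l * ?A l + 24 * ?b l)" by auto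
    have "0 \<le> 8 * ?c l * ?A l + 24 * ?b l"
      using c0[of l] A_coef_nonneg[of \<phi> l] beta_coef_nonneg[of l \<phi>] l(1) \<Lambda>_sub by auto
    then have "0 \<le> ?R" unfolding l(2) by (intro divide_nonneg_nonneg) auto
    then have "?R = 0" using False by simp
    then show ?thesis using variance_under_nonneg by simp
  qed
next
  show "\<forall>(mm :: nat \<Rightarrow> nat) (\<rho>s :: nat \<Rightarrow> complex mat) (Os :: nat \<Rightarrow> complex mat)
         (Vs :: nat \<Rightarrow> nat \<Rightarrow> complex mat) (Hs :: nat \<Rightarrow> nat \<Rightarrow> complex mat)
         (\<phi>s :: nat \<Rightarrow> nat \<Rightarrow> real) (\<Lambda>s :: nat \<Rightarrow> nat set) (q :: nat \<Rightarrow> nat) (C :: real) (k :: nat).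
         (\<forall>N. qinstance N (mm N) (\<rho>s N) (Os N) (Vs N) (Hs N)
               \<and> \<Lambda>s N \<subseteq> {1..mm N} \<and> q N \<in> \<Lambda>s N)
         \<and> 0 < C
         \<and> (\<forall>\<^sub>F N in sequentially. opnorm (Os N) \<le> C * (real N + 1)^k)
         \<and> (\<forall>\<^sub>F N in sequentially. \<forall>j\<in>{1..mm N}. opnorm (Hs N j) \<le> C * (real N + 1)^k)
         \<and> (\<forall>\<^sub>F N in sequentially.
               c_coef (2^N) (mm N) (Vs N) (Hs N) (\<rho>s N) (Os N) (\<phi>s N) (q N) \<ge> 1 / (C * (real N + 1)^k))
       \<longrightarrow> (\<exists>(a::real) (b::nat). 0 < a \<and>
             (\<exists>(C'::real) (k'::nat). 0 < C' \<and>
               (\<forall>\<^sub>F N in sequentially.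
                  variance_under
                    (unif_cube (mm N) (\<phi>s N) (1 / (a * (real N + 1)^b * sqrt (real (mm N)))))
                    (lossL (2^N) (mm N) (Vs N) (Hs N) (\<rho>s N) (Os N))
                  \<ge> 1 / (C' * (real N + 1)^k' * (real (mm N))^2))))"
  proof (intro allI impI, elim conjE)
    fix mm :: "nat \<Rightarrow> nat" and \<rho>s Os :: "nat \<Rightarrow> complex mat" and Vs Hs :: "nat \<Rightarrow> nat \<Rightarrow> complex mat"
      and \<phi>s :: "nat \<Rightarrow> nat \<Rightarrow> real" and \<Lambda>s :: "nat \<Rightarrow> nat set" and q :: "nat \<Rightarrow> nat" and C :: real and k :: nat
    assume fam: "\<forall>N. qinstance N (mm N) (\<rho>s N) (Os N) (Vs N) (Hs N) \<and> \<Lambda>s N \<subseteq> {1..mm N} \<and> q N \<in> \<Lambda>s N"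
      and C: "0 < C"
      and evO: "\<forall>\<^sub>F N in sequentially. opnorm (Os N) \<le> C * (real N + 1)^k"
      and evH: "\<forall>\<^sub>F N in sequentially. \<forall>j\<in>{1..mm N}. opnorm (Hs N j) \<le> C * (real N + 1)^k"
      and evc: "\<forall>\<^sub>F N in sequentially.
               c_coef (2^N) (mm N) (Vs N) (Hs N) (\<rho>s N) (Os N) (\<phi>s N) (q N) \<ge> 1 / (C * (real N + 1)^k)"
    \<comment> \<open>Makes \<open>K = D * P\<close> below at least 1, so that higher powers of
      \<open>K\<close> dominate lower ones.\<close>
    define D where "D = max C 1"
    have D: "1 \<le> D" "C \<le> D" by (auto simp: D_def)
    \<comment> \<open>Radius and bound of \<open>poly_radius_bound\<close> at
      \<open>K = D * (real N + 1)^k\<close>: the radius contains \<open>K^5\<close>, hence the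
      exponent \<open>5 * k\<close>, and the bound contains \<open>K^2 * (K^5)^4\<close>, hence
      \<open>22 * k\<close>.\<close>
    let ?r = "\<lambda>N. 1 / (64 * D^5 * (real N + 1)^(5 * k) * sqrt (real (mm N)))"
    let ?v = "\<lambda>N. 1 / (144 * D^2 * (64 * D^5)^4 * (real N + 1)^(22 * k) * (real (mm N))^2)"
    have "\<forall>\<^sub>F N in sequentially. variance_under (unif_cube (mm N) (\<phi>s N) (?r N))
        (lossL (2^N) (mm N) (Vs N) (Hs N) (\<rho>s N) (Os N)) \<ge> ?v N"
      using evO evH evc
    proof eventually_elim
      case (elim N)
      interpret circuit "2 ^ N" "mm N" "\<rho>s N" "Os N" "Vs N" "Hs N"
        using fam by (intro qinstance_circuit) blast
      have q: "q N \<in> {1..mm N}" using fam by blast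
      then have m: "1 \<le> real (mm N)" by auto
      define P where "P = (real N + 1)^k"
      have P: "1 \<le> P" unfolding P_def by (rule one_le_power) simp
      define K where "K = D * P"
      have K: "1 \<le> K" unfolding K_def using mult_mono[of 1 D 1 P] D P by simp
      have CK: "C * P \<le> K" unfolding K_def using D P by (intro mult_right_mono) auto
      have CP: "0 < C * P" using C P by simp
      let ?c = "c_coef (2^N) (mm N) (Vs N) (Hs N) (\<rho>s N) (Os N) (\<phi>s N) (q N)"
      have c: "1 / K \<le> ?c"
        using frac_le[of 1 1 "C * P" K] elim(3)[folded P_def] CP CK by linarith
      have OK: "opnorm (Os N) \<le> K" using elim(1)[folded P_def] CK by linarith
      have HK: "opnorm (Hs N j) \<le> K" if "j \<in> {1..mm N}" for j using elim(2)[folded P_def] that CK order_trans by blast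
      have K5: "64 * D^5 * (real N + 1)^(5 * k) = 64 * K^5"
        unfolding K_def P_def power_mult_distrib power_mult[symmetric] by (simp add: mult.commute)
      have r: "?r N = 1 / (64 * K^5 * sqrt (real (mm N)))" unfolding K5 ..
      have r0: "0 < ?r N" unfolding r using K m by simp
      have v: "?v N = 1 / (144 * K^2 * (64 * K^5)^4 * (real (mm N))^2)"
      proof -
        have "(real N + 1)^(22 * k) = P^22" unfolding P_def power_mult[symmetric] by (simp add: mult.commute)
        also have "\<dots> = P^2 * (P^5)^4" by (simp flip: power_mult power_add)
        finally have "144 * D^2 * (64 * D^5)^4 * (real N + 1)^(22 * k) = 144 * K^2 * (64 * K^5)^4"
          unfolding K_def power_mult_distrib by (simp only: mult_ac)
        then show ?thesis by (simp only:)
      qed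
      note pb = poly_radius_bound[OF K m c coef_bounds(1)[OF OK HK q] coef_bounds(2)[OF OK HK q] r]
      \<comment> \<open>Only \<open>q N\<close> is known to have a large coefficient; the other
        members of \<open>\<Lambda>s N\<close> could violate the hypothesis of
        \<open>variance_bound\<close> at this radius, so it is applied to the singleton.\<close>
      have "?v N \<le> (\<Sum>l\<in>{q N}. (?r N)^4 / 45 *
         ((c_coef (2^N) (mm N) (Vs N) (Hs N) (\<rho>s N) (Os N) (\<phi>s N) l
            - 1/6 * A_coef (2^N) (mm N) (Vs N) (Hs N) (Os N) (\<phi>s N) l * (?r N)^2)^2
          - beta_coef (2^N) (mm N) (Vs N) (Hs N) (Os N) (\<phi>s N) l * (?r N)^2))"
        unfolding v using pb(2) by (simp only: sum.insert finite.emptyI sum.empty empty_iff not_False_eq_True add_0_right)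
      also have "\<dots> \<le> variance_under (unif_cube (mm N) (\<phi>s N) (?r N)) (lossL (2^N) (mm N) (Vs N) (Hs N) (\<rho>s N) (Os N))"
        using q pb(1) by (intro variance_bound r0) auto
      finally show ?case .
    qed
    moreover have "0 < 64 * D^5" "0 < 144 * D^2 * (64 * D^5)^4" using D by simp_all
    ultimately show "\<exists>(a::real) (b::nat). 0 < a \<and>
             (\<exists>(C'::real) (k'::nat). 0 < C' \<and>
               (\<forall>\<^sub>F N in sequentially.
                  variance_under
                    (unif_cube (mm N) (\<phi>s N) (1 / (a * (real N + 1)^b * sqrt (real (mm N)))))
                    (lossL (2^N) (mm N) (Vs N) (Hs N) (\<rho>s N) (Os N))
                  \<ge> 1 / (C' * (real N + 1)^k' * (real (mm N))^2)))"
      by blast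
  qed
qed

end
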